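(* Let $0<s<\frac12$ and consider the spatially homogeneous Boltzmann equation $\partial_t g=Q(g,g)$ on $\mathbb{R}^3$, $g|_{t=0}=g_0$, with Maxwellian collision kernel $B(|v-v_*|,\cos\theta)=b(\cos\theta)$ (i.e. $\Phi\equiv1$), where, for some $K>0$, $\sin\theta\,b(\cos\theta)\approx K\theta^{-1-2s}$ as $\theta\to0$. Let $g_0\in L^1_{2+2s}(\mathbb{R}^3)\cap L\log L(\mathbb{R}^3)$, $g_0\ge0$, be radially symmetric. If $g\in L^\infty(]0,+\infty[;L^1_{2+2s}(\mathbb{R}^3)\cap L\log L(\mathbb{R}^3))$ is a nonnegative radially symmetric weak solution of this Cauchy problem, then $$g(t,\cdot)\in G^{\frac{1}{2s'}}(\mathbb{R}^3_v)\qquad\text{for every } t>0\text{ and every } 0<s'<s.$$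
   Context: Boltzmann operator: $Q(g,f)(v)=\int_{\mathbb{R}^3}\int_{\mathbb{S}^2}b(\cos\theta)\{g(v_*')f(v')-g(v_* )f(v)\}\,d\sigma\,dv_*$, with $v'=\frac{v+v_*}{2}+\frac{|v-v_*|}{2}\sigma$, $v_*'=\frac{v+v_*}{2}-\frac{|v-v_*|}{2}\sigma$, $\cos\theta=\big\langle\frac{v-v_*}{|v-v_*|},\sigma\big\rangle$, the angle being restricted to $|\theta|\le\frac{\pi}{2}$ (i.e. $b$ is supported in $\cos\theta\ge0$). Here $b\ge0$ is measurable, and $\theta=0$ is its only singularity (for every $\epsilon>0$, $\sin\theta\,b(\cos\theta)$ is integrable on $[\epsilon,\pi/2]$); $\sin\theta\,b(\cos\theta)\approx K\theta^{-1-2s}$ means that $\theta^{1+2s}\sin\theta\,b(\cos\theta)\to K$ as $\theta\to0^+$. Function spaces: $\langle v\rangle=(1+|v|^2)^{1/2}$; $\|f\|_{L^p_\ell}=\|\langle v\rangle^\ell f\|_{L^p}$; $L\log L=\{f:\int|f|\log(1+|f|)\,dv<\infty\}$. Radially symmetric: $g(t,v)=g(t,Av)$ for every rotation $A$ of $\mathbb{R}^3$. Gevrey class: for $\alpha\ge1$, $u\in G^\alpha(\mathbb{R}^n)$ means there is $C>0$ with $\|D^ku\|_{L^2(\mathbb{R}^n)}\le C^{k+1}(k!)^\alpha$ for all $k\in\mathbb{N}$; equivalently there is $c_0>0$ with $e^{c_0\langle D\rangle^{1/\alpha}}u\in L^2(\mathbb{R}^n)$, where $\langle D\rangle=(1+|D_v|^2)^{1/2}$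 is a Fourier multiplier. Nonnegative weak solution: $g\ge0$ such that for every $\varphi\in C_c^\infty(\mathbb{R}^3)$ and every $t\ge0$, $$\int g(t,v)\varphi(v)\,dv-\int g_0\varphi\,dv=\int_0^t\iint_{\mathbb{R}^3\times\mathbb{R}^3}\int_{\mathbb{S}^2}b(\cos\theta)g(\tau,v_* )g(\tau,v)\big(\varphi(v')-\varphi(v)\big)\,d\sigma\,dv_*\,dv\,d\tau,$$ and which satisfies, for all $t$, $\int g(t,v)\,dv=\int g_0\,dv$, $\int g(t,v)|v|^2dv=\int g_0|v|^2dv$ and $\int g(t,v)\log g(t,v)\,dv\le\int g_0\log g_0\,dv$. *)

theory Defs
  imports "HOL-Analysis.Analysis"
begin

section \<open>Integration over the unit sphere\<close>

text \<open>
  Surface measure on the unit sphere, as the cone measure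
  \<open>\<sigma>(A) = d \<cdot> \<lambda> {x. 0 < |x| \<le> 1 \<and> x / |x| \<in> A}\<close>, where \<open>d\<close> is the dimension. It satisfies the
  polar coordinates formula \<open>\<integral> f = \<integral>\<^sub>0\<^sup>\<infinity> \<integral> f(r \<sigma>) r\<^bsup>d-1\<^esup> d\<sigma> dr\<close>, and has total mass \<open>4 \<pi>\<close> for \<open>d = 3\<close>.
\<close>

definition sphere_measure :: "'a::euclidean_space measure" where
  "sphere_measure = scale_measure (of_nat DIM('a))
     (distr (restrict_space lborel (cball 0 1 - {0})) (restrict_space borel (sphere 0 1))
            (\<lambda>x. x /\<^sub>R norm x))"


section \<open>Smooth functions, weak derivatives and Gevrey classes\<close>

text \<open>Iterated classical partial derivative along a list of coordinate indices.\<close>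

primrec partials :: "'n::finite list \<Rightarrow> (real^'n \<Rightarrow> real) \<Rightarrow> real^'n \<Rightarrow> real" where
  "partials [] f = f"
| "partials (i # I) f = (\<lambda>x. frechet_derivative (partials I f) (at x) (axis i 1))"

text \<open>
  If all iterated partial derivatives are differentiable, they are all continuous;
  so this is \<open>C\<^sup>\<infinity>\<close>.
\<close>

definition smooth :: "(real^'n::finite \<Rightarrow> real) \<Rightarrow> bool" where
  "smooth f \<longleftrightarrow> (\<forall>I. partials I f differentiable_on UNIV)"

definition test_functions :: "(real^'n::finite \<Rightarrow> real) set" where
  "test_functions = {\<phi>. smooth \<phi> \<and> compact (closure {x. \<phi> x \<noteq> 0})}"

definition L2 :: "(real^'n::finite \<Rightarrow> real) set" where
  "L2 = {f \<in> borel_measurable lborel. integrable lborel (\<lambda>x. (f x)\<^sup>2)}"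

definition L2_norm :: "(real^'n::finite \<Rightarrow> real) \<Rightarrow> real" where
  "L2_norm f = sqrt (LINT x|lborel. (f x)\<^sup>2)"

text \<open>
  The function \<open>w\<close> is the distributional derivative of \<open>u\<close> along the list of indices \<open>I\<close>.
  Only meant for locally integrable \<open>u\<close> and \<open>w\<close>.
\<close>

definition has_weak_partial ::
    "(real^'n::finite \<Rightarrow> real) \<Rightarrow> 'n list \<Rightarrow> (real^'n \<Rightarrow> real) \<Rightarrow> bool" where
  "has_weak_partial u I w \<longleftrightarrow>
     (\<forall>\<phi>\<in>test_functions.
        (LINT x|lborel. u x * partials I \<phi> x) = (- 1) ^ length I * (LINT x|lborel. w x * \<phi> x))"

text \<open>
  The family \<open>W\<close> collects the weak derivatives of \<open>u\<close>; \<open>D\<^sup>k u\<close> is the tensor of all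
  \<open>n\<^sup>k\<close> partial derivatives of order \<open>k\<close>, and its \<open>L\<^sup>2\<close> norm uses the Euclidean norm of tensors.
\<close>

definition gevrey :: "real \<Rightarrow> (real^'n::finite \<Rightarrow> real) set" where
  "gevrey \<alpha> = {u \<in> L2. \<exists>W.
      (\<forall>I. W I \<in> L2 \<and> has_weak_partial u I (W I)) \<and>
      (\<exists>C>0. \<forall>k::nat.
         sqrt (\<Sum>I | length I = k. (L2_norm (W I))\<^sup>2) \<le> C ^ (k + 1) * (fact k) powr \<alpha>)}"


section \<open>Weighted spaces and symmetry\<close>

definition jbracket :: "real^3 \<Rightarrow> real" where
  "jbracket v = sqrt (1 + (norm v)\<^sup>2)"

definition L1w_norm :: "real \<Rightarrow> (real^3 \<Rightarrow> real) \<Rightarrow> ennreal" where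
  "L1w_norm l f = (\<integral>\<^sup>+v. ennreal \<bar>jbracket v powr l * f v\<bar> \<partial>lborel)"

definition L1w :: "real \<Rightarrow> (real^3 \<Rightarrow> real) set" where
  "L1w l = {f \<in> borel_measurable lborel. L1w_norm l f < \<infinity>}"

definition LlogL_size :: "(real^3 \<Rightarrow> real) \<Rightarrow> ennreal" where
  "LlogL_size f = (\<integral>\<^sup>+v. ennreal (\<bar>f v\<bar> * ln (1 + \<bar>f v\<bar>)) \<partial>lborel)"

definition LlogL :: "(real^3 \<Rightarrow> real) set" where
  "LlogL = {f \<in> borel_measurable lborel. LlogL_size f < \<infinity>}"

text \<open>
  Time-dependent functions of class \<open>L\<^sup>\<infinity>(]0,\<infinity>[; L\<^sup>1\<^sub>l \<inter> L log L)\<close>. Time measurability is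
  expressed as joint Lebesgue measurability of the representative. Boundedness of
  \<open>LlogL_size\<close> together with that of the \<open>L\<^sup>1\<close> norm amounts to boundedness of the Luxemburg
  norm of \<open>L log L\<close>.
\<close>

definition Linfty_L1w_LlogL :: "real \<Rightarrow> (real \<Rightarrow> real^3 \<Rightarrow> real) set" where
  "Linfty_L1w_LlogL l = {g.
     (\<lambda>(t, v). g t v) \<in> borel_measurable (lebesgue_on ({0<..} \<times> UNIV)) \<and>
     (\<exists>M::real. AE t in lborel. 0 < t \<longrightarrow>
        g t \<in> L1w l \<inter> LlogL \<and> L1w_norm l (g t) \<le> ennreal M \<and> LlogL_size (g t) \<le> ennreal M)}"

text \<open>
  The functions considered are representatives of classes modulo null sets; so
  pointwise properties are required almost everywhere.
\<close>

definition radially_symmetric :: "(real^3 \<Rightarrow> real) \<Rightarrow> bool" where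
  "radially_symmetric f \<longleftrightarrow>
     (\<forall>A::real^3^3. rotation_matrix A \<longrightarrow> (AE v in lborel. f (A *v v) = f v))"


section \<open>The Boltzmann equation with Maxwellian kernel\<close>

text \<open>The function \<open>b\<close> takes the cosine of the deviation angle as its argument.\<close>

definition angular_kernel :: "(real \<Rightarrow> real) \<Rightarrow> bool" where
  "angular_kernel b \<longleftrightarrow>
     b \<in> borel_measurable (restrict_space borel {-1..1}) \<and>
     (\<forall>x\<in>{-1..1}. 0 \<le> b x) \<and>
     (\<forall>x\<in>{-1..<0}. b x = 0) \<and>
     (\<forall>\<epsilon>>0. set_integrable lborel {\<epsilon>..pi/2} (\<lambda>\<theta>. sin \<theta> * b (cos \<theta>)))"

text \<open>Here \<open>w\<close> stands for the second velocity \<open>v_*\<close>, and \<open>cos_dev\<close> is \<open>0\<close> for \<open>v = w\<close>.\<close>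

definition post_v :: "real^3 \<Rightarrow> real^3 \<Rightarrow> real^3 \<Rightarrow> real^3" where
  "post_v v w \<sigma> = (v + w) /\<^sub>R 2 + (norm (v - w) / 2) *\<^sub>R \<sigma>"

definition cos_dev :: "real^3 \<Rightarrow> real^3 \<Rightarrow> real^3 \<Rightarrow> real" where
  "cos_dev v w \<sigma> = ((v - w) /\<^sub>R norm (v - w)) \<bullet> \<sigma>"

text \<open>
  The Bochner integral of a non-integrable function is \<open>0\<close>; so the integrability that the
  conservation laws and the entropy inequality presuppose is explicit. The time integral is with
  respect to the complete measure, since \<open>g\<close> is only Lebesgue measurable jointly.
\<close>

definition weak_solution ::
    "(real \<Rightarrow> real) \<Rightarrow> (real^3 \<Rightarrow> real) \<Rightarrow> (real \<Rightarrow> real^3 \<Rightarrow> real) \<Rightarrow> bool" where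
  "weak_solution b g\<^sub>0 g \<longleftrightarrow>
     (\<forall>\<phi>\<in>test_functions. \<forall>t\<ge>0.
        (LINT v|lborel. g t v * \<phi> v) - (LINT v|lborel. g\<^sub>0 v * \<phi> v) =
        (LINT \<tau>:{0..t}|lebesgue. LINT (v, w)|(lborel \<Otimes>\<^sub>M lborel). LINT \<sigma>|sphere_measure.
           b (cos_dev v w \<sigma>) * g \<tau> w * g \<tau> v * (\<phi> (post_v v w \<sigma>) - \<phi> v))) \<and>
     (\<forall>t\<ge>0.
        integrable lborel (g t) \<and>
        (LINT v|lborel. g t v) = (LINT v|lborel. g\<^sub>0 v) \<and>
        integrable lborel (\<lambda>v. g t v * (norm v)\<^sup>2) \<and>
        (LINT v|lborel. g t v * (norm v)\<^sup>2) = (LINT v|lborel. g\<^sub>0 v * (norm v)\<^sup>2) \<and>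
        integrable lborel (\<lambda>v. g t v * ln (g t v)) \<and>
        (LINT v|lborel. g t v * ln (g t v)) \<le> (LINT v|lborel. g\<^sub>0 v * ln (g\<^sub>0 v)))"

definition nonneg_weak_solution ::
    "(real \<Rightarrow> real) \<Rightarrow> (real^3 \<Rightarrow> real) \<Rightarrow> (real \<Rightarrow> real^3 \<Rightarrow> real) \<Rightarrow> bool" where
  "nonneg_weak_solution b g\<^sub>0 g \<longleftrightarrow>
     (\<forall>t\<ge>0. AE v in lborel. 0 \<le> g t v) \<and> weak_solution b g\<^sub>0 g"

end

theory Submission
  imports Defs "HOL-Probability.Characteristic_Functions" "HOL-Probability.Sinc_Integral"
begin

text \<open>
  Since \<open>g\<close> is radially symmetric, its Fourier transform \<open>\<psi>(t, \<xi>)\<close> is real, and Bobylev's identity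
  turns the equation into \<open>\<partial>\<^sub>t \<psi>(\<xi>) = \<integral> b (\<psi>(\<xi>\<^sup>+) \<psi>(\<xi>\<^sup>-) - M \<psi>(\<xi>)) d\<sigma>\<close>, \<open>M\<close> being the mass. After
  normalization to \<open>M = 1\<close>, \<open>\<bar>\<psi>\<bar>\<close> is compared with the barrier \<open>exp (- \<kappa> h\<^sub>\<tau>(\<bar>\<xi>\<bar>\<^sup>2))\<close>, where
  \<open>h\<^sub>\<tau>(x) = x\<close> for \<open>x \<le> 1\<close>, \<open>h\<^sub>\<tau>(x) = 1 + \<tau> (x powr s' - 1)\<close> for \<open>x \<ge> 1\<close> and \<open>\<tau> = 1 - exp (- \<epsilon> t)\<close>.
  At a touching point with \<open>\<bar>\<xi>\<bar> > 1\<close> the singularity of \<open>b\<close> and the concavity of \<open>h\<^sub>\<tau>\<close> (with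
  \<open>h\<^sub>\<tau>(x) = x\<close> at the low frequencies \<open>\<xi>\<^sup>-\<close>) bound the collision term by a negative multiple of
  \<open>\<kappa> (\<bar>\<xi>\<bar> powr (2 s') - 1)\<close> times the barrier; for small \<open>\<epsilon>\<close> this beats the time
  derivative of the barrier. Adding \<open>\<delta> exp (L t) \<bar>\<xi>\<bar>\<close> to the barrier confines touching points to a compact
  set; its cost is the momentum transfer \<open>\<integral> b sin (\<theta>/2) d\<sigma>\<close>, finite because \<open>2 s < 1\<close>. At \<open>t = 0\<close> the barrier
  only requires \<open>\<bar>\<psi>\<bar> \<le> exp (- \<kappa> min (\<bar>\<xi>\<bar>\<^sup>2, 1))\<close>, which holds for small \<open>\<kappa>\<close> because
  \<open>g\<^sub>0\<close> is an integrable density. The resulting decay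
  \<open>exp (- c \<bar>\<xi>\<bar> powr (2 s'))\<close> of \<open>\<psi>\<close> for \<open>t > 0\<close> is Gevrey regularity, by Fourier inversion and
  Plancherel's inequality.
\<close>

section \<open>Test functions\<close>

text \<open>Two facts shape the argument. First, \<open>b\<close> is not integrable over the sphere,
  so gain and loss cannot be separated: every estimate keeps their difference together and extracts
  a factor sin (\<theta>/2) from a Lipschitz bound, in velocity for the weak formulation and in
  frequency for the modes. The same bound admits cos (\<xi> . v) as a test function, as a limit of
  compactly supported waves whose Lipschitz constants do not grow with the cutoff radius. Second,
  the barrier must be quadratic at the origin: finite energy makes 1 - \<psi> at most of order
  |\<xi>|^2, so exp (- \<kappa> |\<xi>|^(2s')) would lie below \<psi> at low frequencies. Bobylev's
  frequencies satisfy |\<xi>+|^2 + |\<xi>-|^2 = |\<xi>|^2; hence the natural variable is x =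
  |\<xi>|^2, and the product of two barriers is controlled by subadditivity of the exponent, which
  holds for a concave function vanishing at 0. The factor \<tau> starts from 0 because the initial
  datum has no decay beyond its frequency gap. Since the comparison is pointwise in \<xi>, no energy
  estimate and no commutator with a Fourier multiplier occurs.\<close>

definition bump :: "real poly \<Rightarrow> real \<Rightarrow> real" where
  "bump p x = (if x > 0 then poly p (1 / x) * exp (- (1 / x)) else 0)"

lemma tendsto_poly_times_exp: "((\<lambda>x::real. poly p x * exp (- x)) \<longlongrightarrow> 0) at_top"
proof -
  have "((\<lambda>x::real. \<Sum>i\<le>degree p. coeff p i * (x ^ i / exp x)) \<longlongrightarrow> (\<Sum>i\<le>degree p. coeff p i * 0)) at_top"
    by (intro tendsto_intros tendsto_power_div_exp_0)
  then show ?thesis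
    by (simp add: poly_altdef exp_minus sum_distrib_right divide_inverse mult.assoc)
qed

lemma bump_zero_right: "(bump p \<longlongrightarrow> 0) (at_right 0)"
proof -
  have "((\<lambda>x. poly p (inverse x) * exp (- inverse x)) \<longlongrightarrow> 0) (at_right 0)"
    by (rule filterlim_compose[OF tendsto_poly_times_exp filterlim_inverse_at_top_right])
  then show ?thesis
    by (rule Lim_transform_eventually)
       (auto simp: eventually_at_filter bump_def inverse_eq_divide)
qed

text \<open>The derivative of p(1/x) exp (-1/x) is x^(-2) (p - p')(1/x) exp (-1/x), again of the
  form \<open>bump\<close>. The polynomial parameter closes the family under differentiation, so
  smoothness across 0 needs no argument order by order.\<close>

lemma bump_has_real_derivative [derivative_intros]:
  assumes "(f has_real_derivative d) (at x)"
  shows "((\<lambda>x. bump p (f x)) has_real_derivative bump ([:0, 0, 1:] * (p - pderiv p)) (f x) * d) (at x)"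
proof -
  have "(bump p has_real_derivative bump ([:0, 0, 1:] * (p - pderiv p)) x) (at x)" for x
  proof -
    consider "x > 0" | "x < 0" | "x = 0" by linarith
    then show ?thesis
    proof cases
      case 1
      have "((\<lambda>x. poly p (1 / x) * exp (- (1 / x))) has_real_derivative
              bump ([:0, 0, 1:] * (p - pderiv p)) x) (at x)"
        using 1 by (auto intro!: derivative_eq_intros simp: bump_def field_simps power2_eq_square)
      then show ?thesis
        by (rule has_field_derivative_transform_within_open[where S = "{0<..}"]) (use 1 in \<open>auto simp: bump_def\<close>)
    next
      case 2
      have "((\<lambda>x. 0) has_real_derivative bump ([:0, 0, 1:] * (p - pderiv p)) x) (at x)"
        using 2 by (simp add: bump_def)
      then show ?thesis
        by (rule has_field_derivative_transform_within_open[where S = "{..<0}"]) (use 2 in \<open>auto simp: bump_def\<close>)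
    next
      case 3
      \<comment> \<open>To the right of 0 the difference quotient is itself \<open>bump\<close> of
        the polynomial X p, hence tends to 0.\<close>
      have "((\<lambda>h. bump p h / h) \<longlongrightarrow> 0) (at_right 0)"
        by (rule Lim_transform_eventually[OF bump_zero_right[of "[:0, 1:] * p"]])
           (auto simp: eventually_at_filter bump_def field_simps)
      moreover have "((\<lambda>h. bump p h / h) \<longlongrightarrow> 0) (at_left 0)"
        by (rule Lim_transform_eventually[OF tendsto_const])
           (auto simp: eventually_at_filter bump_def)
      ultimately have "((\<lambda>h. bump p h / h) \<longlongrightarrow> 0) (at 0)"
        by (simp add: filterlim_split_at)
      then show ?thesis
        using 3 by (simp add: DERIV_def bump_def)
    qed
  qed
  then show ?thesis
    using DERIV_chain2 assms by blast
qed

text \<open>\<open>bump [:0, 0, 1:]\<close> is the derivative of \<open>bump 1\<close>; the bound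
  comes from y^2 / 2 <= exp y at y = 1/z and enters the Lipschitz constant of
  \<open>cutoff\<close>.\<close>

lemma abs_bump_square_le: "\<bar>bump [:0, 0, 1:] z\<bar> \<le> 2"
proof (cases "z > 0")
  case True
  have "(1 / z)\<^sup>2 / 2 \<le> exp (1 / z)"
    using exp_lower_Taylor_quadratic[of "1/z"] True by (smt (verit) divide_nonneg_nonneg)
  then have "(1 / z)\<^sup>2 * exp (- (1 / z)) \<le> 2"
  proof -
    assume *: "(1 / z)\<^sup>2 / 2 \<le> exp (1 / z)"
    have "(1 / z)\<^sup>2 * exp (- (1 / z)) \<le> (2 * exp (1 / z)) * exp (- (1 / z))"
      using * by (intro mult_right_mono) auto
    also have "\<dots> = 2" by (simp add: exp_minus)
    finally show ?thesis .
  qed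
  with True show ?thesis
    by (simp add: bump_def abs_mult power2_eq_square)
qed (simp add: bump_def)

lemma bump_one_bounds: "0 \<le> bump 1 x" "bump 1 x \<le> exp (- 1)" if "x \<le> 1"
  using that by (auto simp: bump_def field_simps)

lemma bump_measurable [measurable]: "bump p \<in> borel_measurable borel"
  unfolding bump_def poly_altdef by measurable

text \<open>A class of functions closed under partial differentiation, hence consisting of smooth functions.\<close>

inductive_set elementary :: "real \<Rightarrow> (real^'n::finite \<Rightarrow> real) set" for R where
  const: "(\<lambda>v. c) \<in> elementary R"
| coord: "(\<lambda>v. v $ i) \<in> elementary R"
| cosine: "(\<lambda>v. cos (\<xi> \<bullet> v + c)) \<in> elementary R"
| bump: "(\<lambda>v. bump p (1 - (norm v)\<^sup>2 / R\<^sup>2)) \<in> elementary R"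
| add: "f \<in> elementary R \<Longrightarrow> h \<in> elementary R \<Longrightarrow> (\<lambda>v. f v + h v) \<in> elementary R"
| mult: "f \<in> elementary R \<Longrightarrow> h \<in> elementary R \<Longrightarrow> (\<lambda>v. f v * h v) \<in> elementary R"

lemma elementary_derivative:
  fixes f :: "real^'n::finite \<Rightarrow> real"
  assumes "f \<in> elementary R"
  shows "\<exists>f'. (\<forall>v. (f has_derivative f' v) (at v)) \<and> (\<forall>i. (\<lambda>v. f' v (axis i 1)) \<in> elementary R)"
  using assms
proof induction
  case (const c)
  show ?case
    by (rule exI[of _ "\<lambda>v h. 0"]) (auto intro: elementary.const)
next
  case (coord j)
  show ?case
    by (rule exI[of _ "\<lambda>v h. h $ j"])
       (auto intro: elementary.const bounded_linear_imp_has_derivative bounded_linear_vec_nth)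
next
  case (cosine \<xi> c)
  \<comment> \<open>The derivative is written as a cosine with its phase advanced by pi/2, so the
    class needs no sine generator.\<close>
  have "((\<lambda>v. cos (\<xi> \<bullet> v + c)) has_derivative (\<lambda>h. (\<xi> \<bullet> h) * cos (\<xi> \<bullet> v + (c + pi / 2)))) (at v)" for v
    by (auto intro!: derivative_eq_intros simp: cos_add sin_add algebra_simps)
  moreover have "(\<lambda>v. (\<xi> \<bullet> axis i 1) * cos (\<xi> \<bullet> v + (c + pi / 2))) \<in> elementary R" for i
    by (intro elementary.intros)
  ultimately show ?case
    by (intro exI[of _ "\<lambda>v h. (\<xi> \<bullet> h) * cos (\<xi> \<bullet> v + (c + pi / 2))"]) auto
next
  case (bump p)
  let ?q = "[:0, 0, 1:] * (p - pderiv p)"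
  have "((\<lambda>v. bump p (1 - (norm v)\<^sup>2 / R\<^sup>2)) has_derivative
      (\<lambda>h. bump ?q (1 - (norm v)\<^sup>2 / R\<^sup>2) * ((- 2 / R\<^sup>2) * (v \<bullet> h)))) (at v)" for v :: "real^'n"
  proof -
    have "((\<lambda>v. 1 - (norm v)\<^sup>2 / R\<^sup>2) has_derivative (\<lambda>h. (- 2 / R\<^sup>2) * (v \<bullet> h))) (at v)"
      unfolding power2_norm_eq_inner
      by (auto intro!: derivative_eq_intros simp: inner_commute divide_inverse)
    from has_derivative_compose[OF this
        bump_has_real_derivative[OF DERIV_ident, unfolded has_field_derivative_def]]
    show ?thesis by (simp add: o_def)
  qed
  moreover have "(\<lambda>v. bump ?q (1 - (norm v)\<^sup>2 / R\<^sup>2) * ((- 2 / R\<^sup>2) * (v \<bullet> axis i 1))) \<in> elementary R"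
    for i :: 'n
  proof -
    have "(\<lambda>v. bump ?q (1 - (norm v)\<^sup>2 / R\<^sup>2) * ((- 2 / R\<^sup>2) * v $ i)) \<in> elementary R"
      by (intro elementary.intros)
    then show ?thesis by (simp only: inner_axis inner_real_def mult_1_right)
  qed
  ultimately show ?case
    by (intro exI[of _ "\<lambda>v h. bump ?q (1 - (norm v)\<^sup>2 / R\<^sup>2) * ((- 2 / R\<^sup>2) * (v \<bullet> h))"]) auto
next
  case (add f h)
  then obtain f' h' where "\<And>v. (f has_derivative f' v) (at v)" "\<And>i. (\<lambda>v. f' v (axis i 1)) \<in> elementary R"
     "\<And>v. (h has_derivative h' v) (at v)" "\<And>i. (\<lambda>v. h' v (axis i 1)) \<in> elementary R" by metis
  then show ?case
    by (intro exI[of _ "\<lambda>v x. f' v x + h' v x"]) (auto intro: elementary.add has_derivative_add)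
next
  case (mult f h)
  then obtain f' h' where "\<And>v. (f has_derivative f' v) (at v)" "\<And>i. (\<lambda>v. f' v (axis i 1)) \<in> elementary R"
     "\<And>v. (h has_derivative h' v) (at v)" "\<And>i. (\<lambda>v. h' v (axis i 1)) \<in> elementary R" by metis
  with mult.hyps show ?case
    by (intro exI[of _ "\<lambda>v x. f v * h' v x + f' v x * h v"])
       (auto intro!: elementary.add elementary.mult has_derivative_mult)
qed

lemma elementary_partials: "f \<in> elementary R \<Longrightarrow> partials I f \<in> elementary R"
proof (induction I)
  case (Cons i I)
  then obtain f' where f': "\<And>v. (partials I f has_derivative f' v) (at v)"
      "\<And>i. (\<lambda>v. f' v (axis i 1)) \<in> elementary R"
    using elementary_derivative by metis
  have "frechet_derivative (partials I f) (at v) = f' v" for v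
    using frechet_derivative_at[OF f'(1)] by simp
  with f'(2) show ?case by simp
qed simp

lemma elementary_smooth: "f \<in> elementary R \<Longrightarrow> smooth f"
  unfolding smooth_def differentiable_on_def differentiable_def
  using elementary_partials elementary_derivative has_derivative_at_withinI by metis

text \<open>The factor \<open>exp 1\<close> normalizes the value at the origin to 1, so that the
  cutoffs tend to 1 as the radius grows.\<close>

definition cutoff :: "real \<Rightarrow> real^'n::finite \<Rightarrow> real" where
  "cutoff R v = exp 1 * bump 1 (1 - (norm v)\<^sup>2 / R\<^sup>2)"

lemma cutoff_bounds: "0 \<le> cutoff R v" "cutoff R v \<le> 1"
  using bump_one_bounds[of "1 - (norm v)\<^sup>2 / R\<^sup>2"] mult_left_mono[of _ "exp (- 1)" "exp (1::real)"]
  by (auto simp: cutoff_def simp flip: exp_add)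

lemma cutoff_measurable [measurable]: "cutoff R \<in> borel_measurable borel"
  unfolding cutoff_def by measurable

lemma cutoff_tendsto_1: "(\<lambda>n. cutoff (real n + 1) v) \<longlonglongrightarrow> 1"
proof -
  have "isCont (bump 1) 1"
    by (rule DERIV_isCont[OF bump_has_real_derivative[OF DERIV_ident]])
  moreover have "(\<lambda>n. 1 - (norm v)\<^sup>2 / (real n + 1)\<^sup>2) \<longlonglongrightarrow> 1"
  proof -
    have "(\<lambda>n. 1 - (norm v)\<^sup>2 * (inverse (real (Suc n)))\<^sup>2) \<longlonglongrightarrow> 1 - (norm v)\<^sup>2 * 0\<^sup>2"
      by (intro tendsto_intros LIMSEQ_inverse_real_of_nat)
    moreover have "(norm v)\<^sup>2 * (inverse (real (Suc n)))\<^sup>2 = (norm v)\<^sup>2 / (real n + 1)\<^sup>2" for n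
    proof -
      have "inverse (real (Suc n)) = 1 / (real n + 1)"
        by (simp add: inverse_eq_divide add.commute)
      then show ?thesis by (simp only: power_divide times_divide_eq_right power_one mult_1_right)
    qed
    ultimately show ?thesis by (simp only: power_zero_numeral mult_zero_right diff_zero)
  qed
  ultimately have "(\<lambda>n. bump 1 (1 - (norm v)\<^sup>2 / (real n + 1)\<^sup>2)) \<longlonglongrightarrow> bump 1 1"
    by (rule isCont_tendsto_compose)
  from tendsto_mult[OF tendsto_const[of "exp 1"] this] show ?thesis
    by (simp add: cutoff_def bump_def exp_minus)
qed

text \<open>The point is that the constant is independent of R: the collision integral of a test
  function is bounded through its Lipschitz constant alone, so a uniform constant gives domination
  as R tends to infinity.\<close>

lemma cutoff_lipschitz:
  assumes "R \<ge> 1"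
  shows "\<bar>cutoff R v - cutoff R w\<bar> \<le> 12 * norm (v - w)"
proof -
  have *: "\<bar>bump 1 (1 - x\<^sup>2 / R\<^sup>2) - bump 1 (1 - y\<^sup>2 / R\<^sup>2)\<bar> \<le> 4 * \<bar>x - y\<bar>" for x y :: real
  proof -
    \<comment> \<open>The final 12 is 3 * 4: \<open>exp 1 \<le> 3\<close>, and the slope is at most
      2 * 2, where the second 2 uses |x| <= R <= R^2. Beyond radius R the derivative
      vanishes.\<close>
    let ?f' = "\<lambda>x. bump [:0, 0, 1:] (1 - x\<^sup>2 / R\<^sup>2) * (- 2 * x / R\<^sup>2)"
    have d: "((\<lambda>x. bump 1 (1 - x\<^sup>2 / R\<^sup>2)) has_real_derivative ?f' x) (at x)" for x
    proof -
      have "((\<lambda>x. 1 - x\<^sup>2 / R\<^sup>2) has_real_derivative - 2 * x / R\<^sup>2) (at x)"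
        unfolding divide_inverse by (auto intro!: derivative_eq_intros)
      from bump_has_real_derivative[OF this, of 1] show ?thesis by simp
    qed
    have "\<bar>?f' x\<bar> \<le> 4" for x
    proof (cases "\<bar>x\<bar> < R")
      case True
      have "\<bar>x\<bar> \<le> R\<^sup>2"
        using True assms by (smt (verit) power2_eq_square mult_le_cancel_left1)
      then have "\<bar>- 2 * x / R\<^sup>2\<bar> \<le> 2"
        using assms by (simp add: abs_mult field_simps)
      from mult_mono[OF abs_bump_square_le this] show ?thesis by (simp add: abs_mult)
    next
      case False
      then have "R\<^sup>2 \<le> x\<^sup>2" using assms abs_le_square_iff[of R x] by linarith
      then have "\<not> 1 - x\<^sup>2 / R\<^sup>2 > 0" using assms by (simp add: field_simps)
      then show ?thesis by (simp add: bump_def)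
    qed
    then show ?thesis
      using field_differentiable_bound[of UNIV "\<lambda>x. bump 1 (1 - x\<^sup>2 / R\<^sup>2)" ?f' 4 x y] d by auto
  qed
  have "\<bar>cutoff R v - cutoff R w\<bar> = exp 1 * \<bar>bump 1 (1 - (norm v)\<^sup>2 / R\<^sup>2) - bump 1 (1 - (norm w)\<^sup>2 / R\<^sup>2)\<bar>"
    by (simp add: cutoff_def abs_mult flip: right_diff_distrib)
  also have "\<dots> \<le> 3 * (4 * \<bar>norm v - norm w\<bar>)"
    using exp_le by (intro mult_mono *) auto
  also have "\<dots> \<le> 12 * norm (v - w)"
    using norm_triangle_ineq3[of v w] by simp
  finally show ?thesis .
qed

definition cutoff_wave :: "real^'n::finite \<Rightarrow> real \<Rightarrow> real^'n \<Rightarrow> real" where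
  "cutoff_wave \<xi> R v = cutoff R v * cos (\<xi> \<bullet> v)"

lemma cutoff_wave_test: 
  assumes "R > 0" 
  shows "cutoff_wave \<xi> R \<in> test_functions"
proof -
  have "(\<lambda>v. exp 1 * bump 1 (1 - (norm v)\<^sup>2 / R\<^sup>2) * cos (\<xi> \<bullet> v + 0)) \<in> elementary R"
    by (intro elementary.intros)
  then have "smooth (cutoff_wave \<xi> R)"
    using elementary_smooth by (simp add: cutoff_wave_def[abs_def] cutoff_def)
  moreover have "{v. cutoff_wave \<xi> R v \<noteq> 0} \<subseteq> cball 0 R"
  proof
    fix v assume "v \<in> {v. cutoff_wave \<xi> R v \<noteq> 0}"
    then have "1 - (norm v)\<^sup>2 / R\<^sup>2 > 0"
      by (auto simp: cutoff_wave_def cutoff_def bump_def split: if_splits)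
    then have "(norm v)\<^sup>2 < R\<^sup>2" using assms by (simp add: field_simps)
    then have "norm v < R" by (rule power2_less_imp_less) (use assms in simp)
    then show "v \<in> cball 0 R" by simp
  qed
  ultimately show ?thesis
    unfolding test_functions_def
    using bounded_subset[OF bounded_cball] compact_closure by blast
qed

lemma abs_cos_diff_le: "\<bar>cos x - cos y\<bar> \<le> \<bar>x - y\<bar>" for x y :: real
  using field_differentiable_bound[of UNIV cos "\<lambda>x. - sin x" 1 x y]
  by (auto intro!: derivative_eq_intros)

lemma wave_lipschitz: "\<bar>cos (\<xi> \<bullet> v) - cos (\<xi> \<bullet> w)\<bar> \<le> norm \<xi> * norm (v - w)" for \<xi> v w :: "'a::real_inner"
  using abs_cos_diff_le[of "\<xi> \<bullet> v" "\<xi> \<bullet> w"] Cauchy_Schwarz_ineq2[of \<xi> "v - w"] by (simp add: inner_diff_right)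

lemma cutoff_wave_lipschitz:
  assumes "R \<ge> 1"
  shows "\<bar>cutoff_wave \<xi> R v - cutoff_wave \<xi> R w\<bar> \<le> (12 + norm \<xi>) * norm (v - w)"
proof -
  have "cutoff_wave \<xi> R v - cutoff_wave \<xi> R w =
      (cutoff R v - cutoff R w) * cos (\<xi> \<bullet> v) + cutoff R w * (cos (\<xi> \<bullet> v) - cos (\<xi> \<bullet> w))"
    by (simp add: cutoff_wave_def algebra_simps)
  also have "\<bar>\<dots>\<bar> \<le> \<bar>cutoff R v - cutoff R w\<bar> * \<bar>cos (\<xi> \<bullet> v)\<bar> + \<bar>cutoff R w\<bar> * \<bar>cos (\<xi> \<bullet> v) - cos (\<xi> \<bullet> w)\<bar>"
    using abs_triangle_ineq by (simp only: flip: abs_mult)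
  also have "\<dots> \<le> (12 * norm (v - w)) * 1 + 1 * (norm \<xi> * norm (v - w))"
    by (intro add_mono mult_mono cutoff_lipschitz[OF assms] wave_lipschitz) (simp_all add: cutoff_bounds)
  finally show ?thesis by (simp add: algebra_simps)
qed

section \<open>The sphere measure\<close>

lemma orthogonal_transformation_measurable:
  fixes T :: "'a::euclidean_space \<Rightarrow> 'a"
  assumes "orthogonal_transformation T"
  shows "T \<in> borel_measurable borel"
  using orthogonal_transformation_linear[OF assms]
  by (intro borel_measurable_continuous_onI linear_continuous_on) (simp add: linear_conv_bounded_linear)

lemma lborel_distr_orthogonal:
  fixes T :: "real^'n::{finite,wellorder} \<Rightarrow> real^'n::_"
  assumes "orthogonal_transformation T"
  shows "distr lborel borel T = lborel"
proof (rule lborel_eqI[symmetric])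
  note orthogonal_transformation_measurable[OF assms, measurable]
  show "sets (distr lborel borel T) = sets borel" by simp
  fix l u :: "real^'n::_" assume lu: "\<And>b. b \<in> Basis \<Longrightarrow> l \<bullet> b \<le> u \<bullet> b"
  have bij: "bij T" using assms by (rule orthogonal_transformation_bij)
  have inv: "orthogonal_transformation (inv T)"
    using assms orthogonal_transformation_inv by blast
  have eq: "T -` box l u = inv T ` box l u"
    by (rule bij_vimage_eq_inv_image[OF bij])
  have m: "inv T ` box l u \<in> lmeasurable" and "measure lebesgue (inv T ` box l u) = measure lebesgue (box l u)"
    using measurable_orthogonal_image[OF inv lmeasurable_box] measure_orthogonal_image[OF inv lmeasurable_box] by auto
  moreover have "emeasure lborel (T -` box l u) = emeasure lebesgue (T -` box l u)"
    using measurable_sets_borel[of T borel "box l u"] by (simp add: emeasure_completion)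
  ultimately have "emeasure lborel (T -` box l u) = ennreal (measure lebesgue (box l u))"
    by (simp add: eq emeasure_eq_measure2)
  also have "\<dots> = emeasure lborel (box l u)"
    using emeasure_lborel_box_finite[of l u] by (simp add: emeasure_eq_ennreal_measure)
  finally show "emeasure (distr lborel borel T) (box l u) = (\<Prod>b\<in>Basis. (u - l) \<bullet> b)"
    using lu by (simp add: emeasure_distr emeasure_lborel_box)
qed

lemma normalize_measurable [measurable]:
  "(\<lambda>x. x /\<^sub>R norm x) \<in> restrict_space lborel (cball 0 1 - {0}) \<rightarrow>\<^sub>M restrict_space borel (sphere 0 (1::real))"
  by (intro measurable_restrict_space2 measurable_restrict_space1)
     (auto simp: space_restrict_space)

lemma space_sphere_measure [simp]: "space sphere_measure = sphere (0::'a::euclidean_space) 1"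
  by (simp add: sphere_measure_def space_restrict_space space_scale_measure)

lemma sets_sphere_measure [measurable_cong]:
  "sets sphere_measure = sets (restrict_space borel (sphere (0::'a::euclidean_space) 1))"
  by (simp add: sphere_measure_def)

lemma nn_integral_sphere_measure:
  fixes f :: "'a::euclidean_space \<Rightarrow> ennreal"
  assumes [measurable]: "f \<in> borel_measurable sphere_measure"
  shows "(\<integral>\<^sup>+\<sigma>. f \<sigma> \<partial>sphere_measure) =
    of_nat DIM('a) * (\<integral>\<^sup>+x. f (x /\<^sub>R norm x) * indicator (cball 0 1 - {0}) x \<partial>lborel)"
proof -
  have [measurable]: "f \<in> borel_measurable (restrict_space borel (sphere 0 1))"
    using assms measurable_cong_sets[OF sets_sphere_measure refl] by blast
  show ?thesis
    unfolding sphere_measure_def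
    by (subst nn_integral_scale_measure) (auto simp: nn_integral_distr nn_integral_restrict_space)
qed

lemma emeasure_sphere_measure:
  fixes A :: "'a::euclidean_space set"
  assumes "A \<in> sets borel"
  shows "emeasure sphere_measure (A \<inter> sphere 0 1) =
    of_nat DIM('a) * emeasure lborel {x \<in> cball 0 1 - {0}. x /\<^sub>R norm x \<in> A}"
proof -
  have A: "A \<inter> sphere 0 1 \<in> sets sphere_measure"
    using assms by (auto simp: sets_sphere_measure sets_restrict_space)
  have [measurable]: "A \<in> sets borel" by fact
  have "emeasure sphere_measure (A \<inter> sphere 0 1) = (\<integral>\<^sup>+\<sigma>. indicator (A \<inter> sphere 0 1) \<sigma> \<partial>sphere_measure)"
    using A by simp
  also have "\<dots> = of_nat DIM('a) * (\<integral>\<^sup>+x. indicator (A \<inter> sphere 0 1) (x /\<^sub>R norm x) * indicator (cball 0 1 - {0}) x \<partial>lborel)"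
    using A by (intro nn_integral_sphere_measure) auto
  also have "(\<integral>\<^sup>+x. indicator (A \<inter> sphere 0 1) (x /\<^sub>R norm x) * indicator (cball 0 1 - {0}) x \<partial>lborel)
     = (\<integral>\<^sup>+x. indicator {x \<in> cball 0 1 - {0}. x /\<^sub>R norm x \<in> A} x \<partial>(lborel::'a measure))"
    by (intro nn_integral_cong) (auto simp: indicator_def)
  also have "\<dots> = emeasure lborel {x \<in> cball 0 1 - {0}. x /\<^sub>R norm x \<in> A}"
  proof (rule nn_integral_indicator)
    have "{x \<in> cball 0 1 - {0}. x /\<^sub>R norm x \<in> A} = (cball 0 1 - {0}) \<inter> ((\<lambda>x. x /\<^sub>R norm x) -` A \<inter> space borel)"
      by auto
    also have "\<dots> \<in> sets borel" by measurable
    finally show "{x \<in> cball 0 1 - {0}. x /\<^sub>R norm x \<in> A} \<in> sets lborel" by simp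
  qed
  finally show ?thesis .
qed

lemma finite_sphere_measure: "finite_measure (sphere_measure :: 'a::euclidean_space measure)"
proof
  let ?D = "{x \<in> cball 0 1 - {0}. x /\<^sub>R norm x \<in> (UNIV::'a set)}"
  have "emeasure lborel ?D \<le> emeasure lborel (cball (0::'a) 1)"
    by (intro emeasure_mono) auto
  also have "\<dots> < \<infinity>" by (simp add: emeasure_cball)
  finally have "of_nat DIM('a) * emeasure lborel ?D < top"
    by (simp add: ennreal_mult_less_top of_nat_less_top)
  moreover have "emeasure (sphere_measure::'a measure) (space sphere_measure) = of_nat DIM('a) * emeasure lborel ?D"
    using emeasure_sphere_measure[of "UNIV::'a set"] by simp
  ultimately show "emeasure (sphere_measure::'a measure) (space sphere_measure) \<noteq> \<infinity>"
    by (simp only: infinity_ennreal_def less_top)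
qed

interpretation sphere: finite_measure "sphere_measure :: 'a::euclidean_space measure"
  by (rule finite_sphere_measure)

text \<open>An orthogonal map commutes with x / |x| and preserves both the punctured unit ball and
  \<open>lborel\<close>; hence it preserves the volume of the cone over a set.\<close>

lemma distr_sphere_measure:
  fixes T :: "real^'n::{finite,wellorder} \<Rightarrow> real^'n::_"
  assumes "orthogonal_transformation T"
  shows "distr sphere_measure sphere_measure T = sphere_measure"
    and "T \<in> sphere_measure \<rightarrow>\<^sub>M sphere_measure"
proof -
  have lin: "linear T" and n: "\<And>x. norm (T x) = norm x"
    using assms by (auto simp: orthogonal_transformation)
  note T [measurable] = orthogonal_transformation_measurable[OF assms]
  show TS [measurable]: "T \<in> sphere_measure \<rightarrow>\<^sub>M sphere_measure"
    unfolding measurable_cong_sets[OF sets_sphere_measure sets_sphere_measure]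
    by (intro measurable_restrict_space2 measurable_restrict_space1 T) (auto simp: space_restrict_space n)
  show "distr sphere_measure sphere_measure T = sphere_measure"
  proof (rule measure_eqI)
    fix X assume X: "X \<in> sets (distr sphere_measure sphere_measure T)"
    then have "X \<in> sets (restrict_space borel (sphere 0 1))" by (simp add: sets_sphere_measure)
    then obtain A where A: "A \<in> sets borel" "X = A \<inter> sphere 0 1"
      by (auto simp: sets_restrict_space)
    have [measurable]: "A \<in> sets borel" by fact
    let ?D = "\<lambda>A. {x \<in> cball 0 1 - {0}. x /\<^sub>R norm x \<in> A}"
    have D: "?D A \<in> sets borel"
    proof -
      have "?D A = (cball 0 1 - {0}) \<inter> ((\<lambda>x. x /\<^sub>R norm x) -` A \<inter> space borel)" by auto
      also have "\<dots> \<in> sets borel" by measurable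
      finally show ?thesis .
    qed
    have "emeasure (distr sphere_measure sphere_measure T) X = emeasure sphere_measure ((T -` A) \<inter> sphere 0 1)"
      using X by (subst emeasure_distr) (auto simp: A n intro!: arg_cong[where f = "emeasure sphere_measure"])
    also have "\<dots> = of_nat DIM(real^'n::_) * emeasure lborel (?D (T -` A))"
      using measurable_sets_borel[OF T A(1)] by (intro emeasure_sphere_measure) simp
    also have "?D (T -` A) = T -` ?D A"
    proof -
      have z: "T x = 0 \<longleftrightarrow> x = 0" for x using n by (metis norm_eq_zero)
      show ?thesis by (auto simp: n z linear_cmul[OF lin])
    qed
    also have "emeasure lborel (T -` ?D A) = emeasure (distr lborel borel T) (?D A)"
      using D by (simp add: emeasure_distr)
    also have "\<dots> = emeasure lborel (?D A)"
      by (simp add: lborel_distr_orthogonal[OF assms])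
    also have "of_nat DIM(real^'n::_) * \<dots> = emeasure sphere_measure X"
      using emeasure_sphere_measure[OF A(1)] A(2) by simp
    finally show "emeasure (distr sphere_measure sphere_measure T) X = emeasure sphere_measure X" .
  qed simp
qed

text \<open>The Householder reflection along d = m - n. Equal norms give 2 (m . d) = d . d and 2 (n
  . d) = - (d . d), so the two vectors are exchanged.\<close>

lemma orthogonal_exchange:
  fixes m n :: "real^'n::finite"
  assumes "norm m = norm n"
  obtains T where "orthogonal_transformation T" "T m = n" "T n = m"
proof (cases "m = n")
  case True
  show ?thesis
    by (rule that[of "\<lambda>x. x"]) (simp_all only: True orthogonal_transformation_id)
next
  case False
  obtain d where d_def: "d = m - n" by simp
  define T where "T x = x - (2 * (x \<bullet> d) / (d \<bullet> d)) *\<^sub>R d" for x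
  have d: "d \<bullet> d \<noteq> 0" using False d_def by simp
  have e: "m \<bullet> m = n \<bullet> n" using assms by (simp add: norm_eq)
  have "linear T"
    unfolding T_def by (intro linearI) (auto simp: algebra_simps add_divide_distrib inner_add_left)
  moreover have "T x \<bullet> T y = x \<bullet> y" for x y
  proof -
    have "T x \<bullet> T y = x \<bullet> y - 2 * (2 * (x \<bullet> d) / (d \<bullet> d)) * (y \<bullet> d)
        + (2 * (x \<bullet> d) / (d \<bullet> d)) * ((2 * (y \<bullet> d) / (d \<bullet> d)) * (d \<bullet> d))"
      by (simp add: T_def inner_diff_left inner_diff_right inner_commute)
    also have "(2 * (y \<bullet> d) / (d \<bullet> d)) * (d \<bullet> d) = 2 * (y \<bullet> d)" using d by simp
    finally show ?thesis by simp
  qed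
  moreover have "2 * (m \<bullet> d) = d \<bullet> d" "2 * (n \<bullet> d) = - (d \<bullet> d)"
    using e by (auto simp: d_def inner_diff_left inner_diff_right inner_commute)
  then have "T m = m - (d \<bullet> d / (d \<bullet> d)) *\<^sub>R d" "T n = n - (- (d \<bullet> d) / (d \<bullet> d)) *\<^sub>R d"
    unfolding T_def by (simp_all only:)
  then have "T m = n" "T n = m"
    using d by (auto simp: d_def)
  ultimately show ?thesis using that by (auto simp: orthogonal_transformation_def)
qed

text \<open>A reflection exchanging \<open>m\<close> and \<open>n\<close> leaves the surface measure
  invariant. In the application the two arguments of \<open>f\<close> are the cosine seen by the
  kernel and the cosine seen by the phase of a wave.\<close>

lemma sphere_integral_swap:
  fixes m n :: "real^'n::{finite,wellorder}" and f :: "real \<Rightarrow> real \<Rightarrow> real"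
  assumes "norm m = norm n"
    and [measurable]: "(\<lambda>\<sigma>. f (m \<bullet> \<sigma>) (n \<bullet> \<sigma>)) \<in> borel_measurable sphere_measure"
  shows "(LINT \<sigma>|sphere_measure. f (n \<bullet> \<sigma>) (m \<bullet> \<sigma>)) = (LINT \<sigma>|sphere_measure. f (m \<bullet> \<sigma>) (n \<bullet> \<sigma>))"
proof -
  obtain T where T: "orthogonal_transformation T" "T m = n" "T n = m"
    using orthogonal_exchange[OF assms(1)] by blast
  have "m \<bullet> T \<sigma> = n \<bullet> \<sigma>" "n \<bullet> T \<sigma> = m \<bullet> \<sigma>" for \<sigma>
    using T by (metis orthogonal_transformation_def)+
  then have "(LINT \<sigma>|sphere_measure. f (n \<bullet> \<sigma>) (m \<bullet> \<sigma>)) = (LINT \<sigma>|sphere_measure. f (m \<bullet> T \<sigma>) (n \<bullet> T \<sigma>))"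
    by simp
  also have "\<dots> = (LINT \<sigma>|distr sphere_measure sphere_measure T. f (m \<bullet> \<sigma>) (n \<bullet> \<sigma>))"
    using distr_sphere_measure(2)[OF T(1)] by (simp add: integral_distr)
  finally show ?thesis by (simp add: distr_sphere_measure(1)[OF T(1)])
qed

section \<open>Slicing coordinates and zonal integrals on the sphere\<close>

lemma emeasure_lborel_Times:
  fixes A :: "'a::euclidean_space set" and B :: "'b::euclidean_space set"
  assumes "A \<in> sets borel" "B \<in> sets borel"
  shows "emeasure lborel (A \<times> B) = emeasure lborel A * emeasure lborel B"
  using assms by (simp add: lborel_prod[symmetric] lborel.emeasure_pair_measure_Times)

text \<open>The grouping real x (real x real) leaves, at a fixed first coordinate, a plane with its
  Euclidean norm, where the slices of balls and cones are discs.\<close>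

definition vec3 :: "real \<times> real \<times> real \<Rightarrow> real^3" where
  "vec3 p = vector [fst p, fst (snd p), snd (snd p)]"

lemma vec3_nth [simp]: "vec3 p $ 1 = fst p" "vec3 p $ 2 = fst (snd p)" "vec3 p $ 3 = snd (snd p)"
  by (simp_all add: vec3_def)

lemma vec3_measurable [measurable]: "vec3 \<in> borel_measurable borel"
proof -
  have "vec3 = (\<lambda>p. \<chi> i. if i = 1 then fst p else if i = 2 then fst (snd p) else snd (snd p))"
    by (auto simp: vec_eq_iff forall_3)
  also have "\<dots> \<in> borel_measurable borel"
  proof (intro borel_measurable_continuous_onI continuous_on_vec_lambda)
    fix i :: 3
    show "continuous_on UNIV (\<lambda>p::real \<times> real \<times> real. if i = 1 then fst p else if i = 2 then fst (snd p) else snd (snd p))"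
      by (cases "i = 1"; cases "i = 2") (auto intro!: continuous_intros)
  qed
  finally show ?thesis .
qed

lemma norm_vec3: "(norm (vec3 (z, p)))\<^sup>2 = z\<^sup>2 + (norm p)\<^sup>2"
  unfolding power2_norm_eq_inner
  by (cases p) (simp add: inner_vec_def sum_3 inner_real_def power2_eq_square)

lemma lborel_distr_vec3: "distr lborel borel vec3 = lborel"
proof (rule lborel_eqI[symmetric])
  fix l u :: "real^3" assume *: "\<And>b. b \<in> Basis \<Longrightarrow> l \<bullet> b \<le> u \<bullet> b"
  have lu: "l $ i \<le> u $ i" for i
    using *[of "axis i 1"] by (simp add: axis_in_Basis_iff inner_axis)
  have eq: "vec3 -` box l u = box (l $ 1) (u $ 1) \<times> (box (l $ 2) (u $ 2) \<times> box (l $ 3) (u $ 3))"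
    by (auto simp: mem_box_cart forall_3 box_real)
  have "emeasure (distr lborel borel vec3) (box l u) = emeasure lborel (vec3 -` box l u)"
    by (subst emeasure_distr) auto
  also have "\<dots> = ennreal (u $ 1 - l $ 1) * (ennreal (u $ 2 - l $ 2) * ennreal (u $ 3 - l $ 3))"
    unfolding eq by (simp add: emeasure_lborel_Times lu box_real borel_Times)
  also have "\<dots> = (\<Prod>b\<in>Basis. (u - l) \<bullet> b)"
  proof -
    have B: "Basis = (\<lambda>i::3. axis i (1::real)) ` UNIV" by (auto simp: Basis_vec_def)
    have "(\<Prod>b\<in>Basis. (u - l) \<bullet> b) = (\<Prod>i\<in>UNIV. u $ i - l $ i)"
      unfolding B by (subst prod.reindex) (auto simp: inj_on_def axis_eq_axis inner_axis)
    also have "\<dots> = (u $ 1 - l $ 1) * ((u $ 2 - l $ 2) * (u $ 3 - l $ 3))"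
      unfolding UNIV_3 by simp
    finally show ?thesis by (simp add: ennreal_mult lu)
  qed
  finally show "emeasure (distr lborel borel vec3) (box l u) = (\<Prod>b\<in>Basis. (u - l) \<bullet> b)" .
qed simp

text \<open>Archimedes' hat-box theorem, by slicing the cone orthogonally to \<open>m\<close>.\<close>

lemma emeasure_sphere_cap:
  fixes m :: "real^3"
  assumes m: "norm m = 1" and c: "0 \<le> c" "c \<le> 1"
  shows "emeasure sphere_measure {\<sigma> \<in> sphere 0 1. c < m \<bullet> \<sigma>} = ennreal (2 * pi * (1 - c))"
proof -
  let ?e = "axis 1 1 :: real^3"
  have "norm m = norm ?e" using m by (simp add: norm_axis_1)
  then obtain T where T: "orthogonal_transformation T" "T m = ?e" "T ?e = m"
    by (rule orthogonal_exchange)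
  let ?C = "{\<sigma>::real^3. c < ?e \<bullet> \<sigma>}"
  let ?A = "{x \<in> cball 0 1 - {0}. x /\<^sub>R norm x \<in> ?C}"
  have C [measurable]: "?C \<in> sets borel" by measurable
  have TS: "T \<in> sphere_measure \<rightarrow>\<^sub>M sphere_measure" and D: "distr sphere_measure sphere_measure T = sphere_measure"
    using distr_sphere_measure[OF T(1)] by auto
  have "T m \<bullet> T \<sigma> = m \<bullet> \<sigma>" for \<sigma>
    using T(1) by (simp add: orthogonal_transformation_def)
  then have mT: "m \<bullet> \<sigma> = ?e \<bullet> T \<sigma>" "norm (T \<sigma>) = norm \<sigma>" for \<sigma>
    using T(1) by (simp_all only: T(2) orthogonal_transformation)
  have "emeasure sphere_measure {\<sigma> \<in> sphere 0 1. c < m \<bullet> \<sigma>} = emeasure sphere_measure (T -` (?C \<inter> sphere 0 1) \<inter> space sphere_measure)"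
    by (intro arg_cong[where f = "emeasure sphere_measure"]) (auto simp: mT)
  also have "\<dots> = emeasure (distr sphere_measure sphere_measure T) (?C \<inter> sphere 0 1)"
  proof -
    have "?C \<inter> sphere 0 1 \<in> sets sphere_measure"
      unfolding sets_sphere_measure sets_restrict_space using C by blast
    from emeasure_distr[OF TS this] show ?thesis by simp
  qed
  also have "\<dots> = of_nat DIM(real^3) * emeasure lborel ?A"
    unfolding D by (rule emeasure_sphere_measure[OF C])
  also have "emeasure lborel ?A = emeasure (distr lborel borel vec3) ?A"
    by (simp add: lborel_distr_vec3)
  also have "\<dots> = emeasure lborel (vec3 -` ?A)"
  proof -
    have "?A = (cball 0 1 - {0}) \<inter> ((\<lambda>x. x /\<^sub>R norm x) -` ?C \<inter> space borel)" by auto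
    also have "\<dots> \<in> sets borel" by measurable
    finally show ?thesis by (subst emeasure_distr) auto
  qed
  \<comment> \<open>The cone condition c |x| < z is squared to avoid roots; z > 0 is kept because
    squaring forgets the sign.\<close>
  also have "vec3 -` ?A = {(z, p). z\<^sup>2 + (norm p)\<^sup>2 \<le> 1 \<and> 0 < z \<and> c\<^sup>2 * (z\<^sup>2 + (norm p)\<^sup>2) < z\<^sup>2}" (is "_ = ?B")
  proof (intro set_eqI, clarify)
    fix z x y :: real
    let ?p = "(x, y)"
    let ?v = "vec3 (z, ?p)"
    have n: "(norm ?v)\<^sup>2 = z\<^sup>2 + (norm ?p)\<^sup>2" by (rule norm_vec3)
    have z: "?e \<bullet> ?v = z" by (simp add: inner_axis' )
    have 1: "norm ?v \<le> 1 \<longleftrightarrow> z\<^sup>2 + (norm ?p)\<^sup>2 \<le> 1"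
      unfolding n[symmetric] by (simp add: abs_square_le_1)
    have 2: "c * norm ?v < z \<longleftrightarrow> 0 < z \<and> c\<^sup>2 * (z\<^sup>2 + (norm ?p)\<^sup>2) < z\<^sup>2"
    proof -
      have "0 \<le> c * norm ?v" using c by simp
      then have "c * norm ?v < z \<longleftrightarrow> 0 < z \<and> (c * norm ?v)\<^sup>2 < z\<^sup>2"
        by (smt (verit) power2_less_imp_less power_strict_mono zero_less_numeral)
      then show ?thesis by (simp add: power_mult_distrib n)
    qed
    have 3: "z > 0 \<Longrightarrow> ?v \<noteq> 0" using n by (metis add_pos_nonneg norm_zero power_zero_numeral zero_le_power2 zero_less_power order_less_irrefl)
    have "?v \<in> ?A \<longleftrightarrow> norm ?v \<le> 1 \<and> ?v \<noteq> 0 \<and> c * norm ?v < z"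
      using z by (auto simp: field_simps)
    also have "\<dots> \<longleftrightarrow> (z, ?p) \<in> ?B" using 1 2 3 by auto
    finally show "(z, x, y) \<in> vec3 -` ?A \<longleftrightarrow> (z, x, y) \<in> ?B" by simp
  qed
  also have "emeasure lborel ?B = (\<integral>\<^sup>+z. emeasure lborel (Pair z -` ?B) \<partial>lborel)"
  proof -
    have "?B = {p \<in> space borel. (fst p)\<^sup>2 + (norm (snd p))\<^sup>2 \<le> 1 \<and> 0 < fst p \<and> c\<^sup>2 * ((fst p)\<^sup>2 + (norm (snd p))\<^sup>2) < (fst p)\<^sup>2}"
      by auto
    also have "\<dots> = {p. (fst p)\<^sup>2 + (norm (snd p))\<^sup>2 \<le> 1} \<inter> ({p. 0 < fst p} \<inter> {p. c\<^sup>2 * ((fst p)\<^sup>2 + (norm (snd p))\<^sup>2) < (fst p)\<^sup>2})"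
      by auto
    also have "\<dots> \<in> sets borel"
      by (intro sets.Int borel_closed borel_open closed_Collect_le open_Collect_less continuous_intros)
    finally have "?B \<in> sets (lborel \<Otimes>\<^sub>M (lborel :: (real \<times> real) measure))" by (simp only: lborel_prod sets_lborel)
    from lborel.emeasure_pair_measure_alt[OF this] show ?thesis by (simp only: lborel_prod)
  qed
  \<comment> \<open>Two regimes of slices: for z < c the cone is the active constraint and the slice
    is a disc of squared radius z^2 (1 - c^2) / c^2; for z > c it is the ball, with squared radius 1
    - z^2. For c = 0 the first range is a single point, so the value of the division by 0 is
    harmless.\<close>
  also have "\<dots> = (\<integral>\<^sup>+z. ennreal (pi * (1 - z\<^sup>2)) * indicator {c..1} z + ennreal (pi * (z\<^sup>2 * ((1 - c\<^sup>2) / c\<^sup>2))) * indicator {0..c} z \<partial>lborel)"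
  proof (rule nn_integral_cong_AE)
    have area: "emeasure lborel (cball (0::real \<times> real) r) = ennreal (pi * r\<^sup>2)"
      "emeasure lborel (ball (0::real \<times> real) r) = ennreal (pi * r\<^sup>2)" if "r \<ge> 0" for r
      using that by (simp_all add: emeasure_cball emeasure_ball unit_ball_vol_2 power2_eq_square)
    have "AE z in lborel. z \<noteq> c \<and> z \<noteq> 0 \<and> z \<noteq> 1"
      using AE_lborel_singleton[of c] AE_lborel_singleton[of "0::real"] AE_lborel_singleton[of "1::real"] by auto
    then show "AE z in lborel. emeasure lborel (Pair z -` ?B) = ennreal (pi * (1 - z\<^sup>2)) * indicator {c..1} z + ennreal (pi * (z\<^sup>2 * ((1 - c\<^sup>2) / c\<^sup>2))) * indicator {0..c} z"
    proof (rule AE_mp, intro AE_I2 impI)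
      fix z :: real assume z: "z \<noteq> c \<and> z \<noteq> 0 \<and> z \<noteq> 1"
      consider "z < 0" | "1 < z" | "0 < z" "z < c" | "0 < z" "c < z" "z < 1" using z by linarith
      then show "emeasure lborel (Pair z -` ?B) = ennreal (pi * (1 - z\<^sup>2)) * indicator {c..1} z + ennreal (pi * (z\<^sup>2 * ((1 - c\<^sup>2) / c\<^sup>2))) * indicator {0..c} z"
      proof cases
        case 1
        then have "Pair z -` ?B = {}" by auto
        then show ?thesis using 1 c by simp
      next
        case 2
        then have "1 < z\<^sup>2" by simp
        then have "Pair z -` ?B = {}" by (auto simp: not_le intro: add_strict_increasing2 dest: order.strict_trans2)
          (smt (verit) zero_le_power2)
        then have "emeasure lborel (Pair z -` ?B) = 0" by (simp only: emeasure_empty)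
        then show ?thesis using 2 c by simp
      next
        case 3
        then have c0: "0 < c\<^sup>2" "z\<^sup>2 < c\<^sup>2" by (auto intro: power_strict_mono)
        have c1: "c\<^sup>2 \<le> 1" using c by (simp add: abs_square_le_1)
        let ?r = "sqrt (z\<^sup>2 * ((1 - c\<^sup>2) / c\<^sup>2))"
        have r: "?r\<^sup>2 = z\<^sup>2 * ((1 - c\<^sup>2) / c\<^sup>2)" "?r \<ge> 0"
          using c1 by auto
        have "Pair z -` ?B = ball 0 ?r"
        proof (intro set_eqI)
          fix p :: "real \<times> real"
          have "z\<^sup>2 * (1 - c\<^sup>2) / c\<^sup>2 \<le> 1 - z\<^sup>2" using c0 by (simp add: field_simps)
          moreover have "norm p < ?r \<longleftrightarrow> (norm p)\<^sup>2 < ?r\<^sup>2"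
            using r(2) by (metis norm_ge_zero power2_less_imp_less power_strict_mono zero_less_numeral)
          moreover have "c\<^sup>2 * (z\<^sup>2 + (norm p)\<^sup>2) < z\<^sup>2 \<longleftrightarrow> (norm p)\<^sup>2 < z\<^sup>2 * ((1 - c\<^sup>2) / c\<^sup>2)"
            using c0 by (simp add: field_simps)
          ultimately show "p \<in> Pair z -` ?B \<longleftrightarrow> p \<in> ball 0 ?r"
            using 3 r(1) by auto
        qed
        then show ?thesis using 3 area(2)[OF r(2)] r(1) c by simp
      next
        case 4
        then have z1: "z\<^sup>2 < 1" "c\<^sup>2 < z\<^sup>2" using c by (auto simp: abs_square_less_1 intro: power_strict_mono)
        let ?r = "sqrt (1 - z\<^sup>2)"
        have r: "?r\<^sup>2 = 1 - z\<^sup>2" "?r \<ge> 0" using z1 by auto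
        have "Pair z -` ?B = cball 0 ?r"
        proof (intro set_eqI)
          fix p :: "real \<times> real"
          have "c\<^sup>2 * (z\<^sup>2 + (norm p)\<^sup>2) < z\<^sup>2" if "z\<^sup>2 + (norm p)\<^sup>2 \<le> 1"
            using mult_left_mono[OF that, of "c\<^sup>2"] z1 by simp
          moreover have "norm p \<le> ?r \<longleftrightarrow> (norm p)\<^sup>2 \<le> ?r\<^sup>2"
            using r(2) by (metis norm_ge_zero power2_le_imp_le power_mono)
          ultimately show "p \<in> Pair z -` ?B \<longleftrightarrow> p \<in> cball 0 ?r"
            using 4 r(1) by auto
        qed
        then show ?thesis using 4 area(1)[OF r(2)] r(1) c by simp
      qed
    qed
  qed
  also have "\<dots> = (\<integral>\<^sup>+z. ennreal (pi * (1 - z\<^sup>2)) * indicator {c..1} z \<partial>lborel) + (\<integral>\<^sup>+z. ennreal (pi * (z\<^sup>2 * ((1 - c\<^sup>2) / c\<^sup>2))) * indicator {0..c} z \<partial>lborel)"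
    by (intro nn_integral_add) auto
  also have "(\<integral>\<^sup>+z. ennreal (pi * (1 - z\<^sup>2)) * indicator {c..1} z \<partial>lborel) = ennreal (pi * (1 - 1 ^ 3 / 3) - pi * (c - c ^ 3 / 3))"
  proof (rule nn_integral_FTC_Icc[where F = "\<lambda>z. pi * (z - z ^ 3 / 3)"])
    show "((\<lambda>z. pi * (z - z ^ 3 / 3)) has_real_derivative pi * (1 - x\<^sup>2)) (at x)" for x
      by (auto intro!: derivative_eq_intros)
    show "0 \<le> pi * (1 - x\<^sup>2)" if "x \<in> {c..1}" for x
      using that c by (simp add: abs_square_le_1)
  qed (use c in auto)
  also have "(\<integral>\<^sup>+z. ennreal (pi * (z\<^sup>2 * ((1 - c\<^sup>2) / c\<^sup>2))) * indicator {0..c} z \<partial>lborel) =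
      ennreal (pi * (c ^ 3 / 3 * ((1 - c\<^sup>2) / c\<^sup>2)) - pi * (0 ^ 3 / 3 * ((1 - c\<^sup>2) / c\<^sup>2)))"
  proof (rule nn_integral_FTC_Icc[where F = "\<lambda>z. pi * (z ^ 3 / 3 * ((1 - c\<^sup>2) / c\<^sup>2))"])
    show "((\<lambda>z. pi * (z ^ 3 / 3 * ((1 - c\<^sup>2) / c\<^sup>2))) has_real_derivative pi * (x\<^sup>2 * ((1 - c\<^sup>2) / c\<^sup>2))) (at x)" for x
    proof -
      have "((\<lambda>z. pi * (z ^ 3 / 3 * k)) has_real_derivative pi * (x\<^sup>2 * k)) (at x)" for k :: real
        by (auto intro!: derivative_eq_intros)
      then show ?thesis .
    qed
    show "0 \<le> pi * (x\<^sup>2 * ((1 - c\<^sup>2) / c\<^sup>2))" for x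
      using c by (simp add: abs_square_le_1)
  qed (use c in auto)
  also have "of_nat DIM(real^3) * (ennreal (pi * (1 - 1 ^ 3 / 3) - pi * (c - c ^ 3 / 3)) + ennreal (pi * (c ^ 3 / 3 * ((1 - c\<^sup>2) / c\<^sup>2)) - pi * (0 ^ 3 / 3 * ((1 - c\<^sup>2) / c\<^sup>2))))
      = ennreal (3 * ((pi * (1 - 1 ^ 3 / 3) - pi * (c - c ^ 3 / 3)) + (pi * (c ^ 3 / 3 * ((1 - c\<^sup>2) / c\<^sup>2)))))"
  proof -
    have "c ^ 3 \<ge> 0" using c by simp
    moreover have "c - c ^ 3 / 3 \<le> 1 - 1 / 3"
    proof -
      have "1 - 1/3 - (c - c ^ 3 / 3) = (1 - c)\<^sup>2 * (c + 2) / 3"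
        by (simp add: power2_eq_square power3_eq_cube algebra_simps)
      also have "\<dots> \<ge> 0" using c by simp
      finally show ?thesis by simp
    qed
    moreover have "1 - c\<^sup>2 \<ge> 0" using c by (simp add: abs_square_le_1)
    ultimately have nn: "0 \<le> pi * (1 - 1 ^ 3 / 3) - pi * (c - c ^ 3 / 3)" "0 \<le> pi * (c ^ 3 / 3 * ((1 - c\<^sup>2) / c\<^sup>2))"
      by (simp_all add: mult_left_mono flip: right_diff_distrib)
    have "of_nat DIM(real^3) * (ennreal x + ennreal y) = ennreal (3 * (x + y))" if "0 \<le> x" "0 \<le> y" for x y
      unfolding ennreal_plus[OF that, symmetric] using that by (simp add: ennreal_mult')
    from this[OF nn] show ?thesis by simp
  qed
  also have "3 * ((pi * (1 - 1 ^ 3 / 3) - pi * (c - c ^ 3 / 3)) + (pi * (c ^ 3 / 3 * ((1 - c\<^sup>2) / c\<^sup>2)))) = 2 * pi * (1 - c)"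
  proof (cases "c = 0")
    case False
    then have e: "c ^ 3 / 3 * ((1 - c\<^sup>2) / c\<^sup>2) = c * (1 - c\<^sup>2) / 3" by (simp add: power2_eq_square power3_eq_cube)
    show ?thesis unfolding e by (simp add: power2_eq_square power3_eq_cube field_simps)
  qed simp
  finally show ?thesis .
qed

lemma inner_sphere_measurable [measurable]: "(\<lambda>\<sigma>. m \<bullet> \<sigma>) \<in> borel_measurable sphere_measure"
  unfolding measurable_cong_sets[OF sets_sphere_measure refl] by (intro measurable_restrict_space1) measurable

text \<open>The height is uniformly distributed with density 2 pi. The two finite measures are
  compared on half-lines, where the cap formula applies once the endpoint is clamped to [0, 1].
  Positive heights suffice because \<open>b\<close> lives on cos \<theta> >= 0.\<close>

lemma nn_integral_sphere_zonal:
  fixes m :: "real^3" and F :: "real \<Rightarrow> ennreal"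
  assumes m: "norm m = 1" and [measurable]: "F \<in> borel_measurable borel"
  shows "(\<integral>\<^sup>+\<sigma>. F (m \<bullet> \<sigma>) * indicator {0<..} (m \<bullet> \<sigma>) \<partial>sphere_measure) =
    ennreal (2 * pi) * (\<integral>\<^sup>+z. F z * indicator {0<..1} z \<partial>lborel)"
proof -
  let ?D = "distr (density sphere_measure (\<lambda>\<sigma>. indicator {0<..} (m \<bullet> \<sigma>))) borel (\<lambda>\<sigma>. m \<bullet> \<sigma>)"
  let ?N = "density lborel (\<lambda>z. ennreal (2 * pi) * indicator {0<..1::real} z)"
  have D: "emeasure ?D {x<..} = ennreal (2 * pi * (1 - min 1 (max 0 x)))" for x
  proof -
    have "emeasure ?D {x<..} = (\<integral>\<^sup>+\<sigma>. indicator {0<..} (m \<bullet> \<sigma>) * indicator ((\<lambda>\<sigma>. m \<bullet> \<sigma>) -` {x<..} \<inter> sphere 0 1) \<sigma> \<partial>sphere_measure)"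
    proof -
      have "emeasure ?D {x<..} = emeasure (density sphere_measure (\<lambda>\<sigma>. indicator {0<..} (m \<bullet> \<sigma>))) ((\<lambda>\<sigma>. m \<bullet> \<sigma>) -` {x<..} \<inter> sphere 0 1)"
        by (subst emeasure_distr) auto
      also have "(\<lambda>\<sigma>. m \<bullet> \<sigma>) -` {x<..} \<inter> space sphere_measure \<in> sets sphere_measure"
        by (rule measurable_sets[OF inner_sphere_measurable]) simp
      then have "emeasure (density sphere_measure (\<lambda>\<sigma>. indicator {0<..} (m \<bullet> \<sigma>))) ((\<lambda>\<sigma>. m \<bullet> \<sigma>) -` {x<..} \<inter> sphere 0 1)
         = (\<integral>\<^sup>+\<sigma>. indicator {0<..} (m \<bullet> \<sigma>) * indicator ((\<lambda>\<sigma>. m \<bullet> \<sigma>) -` {x<..} \<inter> sphere 0 1) \<sigma> \<partial>sphere_measure)"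
        by (intro emeasure_density) (simp_all add: Int_commute)
      finally show ?thesis .
    qed
    also have "\<dots> = (\<integral>\<^sup>+\<sigma>. indicator {\<sigma> \<in> space sphere_measure. min 1 (max 0 x) < m \<bullet> \<sigma>} \<sigma> \<partial>sphere_measure)"
    proof (rule nn_integral_cong)
      fix \<sigma> :: "real^3" assume "\<sigma> \<in> space sphere_measure"
      then have "m \<bullet> \<sigma> \<le> 1" using norm_cauchy_schwarz[of m \<sigma>] m by simp
      with \<open>\<sigma> \<in> space sphere_measure\<close> show "indicator {0<..} (m \<bullet> \<sigma>) * indicator ((\<lambda>\<sigma>. m \<bullet> \<sigma>) -` {x<..} \<inter> sphere 0 1) \<sigma>
          = (indicator {\<sigma> \<in> space sphere_measure. min 1 (max 0 x) < m \<bullet> \<sigma>} \<sigma> :: ennreal)"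
        by (auto simp: indicator_def)
    qed
    also have "\<dots> = emeasure sphere_measure {\<sigma> \<in> sphere 0 1. min 1 (max 0 x) < m \<bullet> \<sigma>}"
    proof (subst nn_integral_indicator)
      show "{\<sigma> \<in> space sphere_measure. min 1 (max 0 x) < m \<bullet> \<sigma>} \<in> sets sphere_measure" by measurable
    qed simp
    finally show ?thesis
      using emeasure_sphere_cap[OF m, of "min 1 (max 0 x)"] by simp
  qed
  have N: "emeasure ?N {x<..} = ennreal (2 * pi * (1 - min 1 (max 0 x)))" for x
  proof -
    have "emeasure ?N {x<..} = (\<integral>\<^sup>+z. ennreal (2 * pi) * indicator {min 1 (max 0 x)<..1} z \<partial>lborel)"
      by (subst emeasure_density) (auto intro!: nn_integral_cong simp: indicator_def)
    then show ?thesis by (simp add: nn_integral_cmult ennreal_mult)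
  qed
  have eq: "?D = ?N"
    by (rule measure_eqI_lessThan) (simp_all add: D N)
  have "(\<integral>\<^sup>+\<sigma>. F (m \<bullet> \<sigma>) * indicator {0<..} (m \<bullet> \<sigma>) \<partial>sphere_measure) = (\<integral>\<^sup>+z. F z \<partial>?D)"
    by (simp add: nn_integral_distr nn_integral_density mult.commute)
  also have "\<dots> = ennreal (2 * pi) * (\<integral>\<^sup>+z. F z * indicator {0<..1} z \<partial>lborel)"
    unfolding eq by (subst nn_integral_density) (simp_all add: nn_integral_cmult[symmetric] mult_ac)
  finally show ?thesis .
qed

lemma nn_integral_sphere_angle:
  fixes m :: "real^3" and F :: "real \<Rightarrow> real"
  assumes m: "norm m = 1" and F [measurable]: "F \<in> borel_measurable borel"
  shows "(\<integral>\<^sup>+\<sigma>. ennreal (F (m \<bullet> \<sigma>)) * indicator {0<..} (m \<bullet> \<sigma>) \<partial>sphere_measure) =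
    ennreal (2 * pi) * (\<integral>\<^sup>+\<theta>. ennreal (F (cos \<theta>) * sin \<theta>) * indicator {0..pi/2} \<theta> \<partial>lborel)"
proof -
  \<comment> \<open>The reflection z -> -z makes the substitution increasing: -cos has the
    derivative sin, which is non-negative on [0, pi/2].\<close>
  have "(\<integral>\<^sup>+z. ennreal (F z) * indicator {0<..1} z \<partial>lborel) = (\<integral>\<^sup>+z. ennreal (F (- z)) * indicator {- cos 0..- cos (pi/2)} z \<partial>lborel)"
  proof -
    have "(\<integral>\<^sup>+z. ennreal (F z) * indicator {0<..1} z \<partial>lborel) = (\<integral>\<^sup>+z. ennreal (F z) * indicator {0<..1} z \<partial>distr lborel borel uminus)"
      by (simp add: lborel_distr_uminus)
    also have "\<dots> = (\<integral>\<^sup>+z. ennreal (F (- z)) * indicator {0<..1} (- z) \<partial>lborel)"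
      by (rule nn_integral_distr) auto
    also have "\<dots> = (\<integral>\<^sup>+z. ennreal (F (- z)) * indicator {- cos 0..- cos (pi/2)} z \<partial>lborel)"
      by (rule nn_integral_cong_AE) (use AE_lborel_singleton[of "0::real"] in \<open>eventually_elim, auto simp: indicator_def\<close>)
    finally show ?thesis .
  qed
  also have "\<dots> = (\<integral>\<^sup>+\<theta>. ennreal (F (- (- cos \<theta>)) * sin \<theta>) * indicator {0..pi/2} \<theta> \<partial>lborel)"
  proof (rule trans[OF _ trans[OF nn_integral_substitution[where f = "\<lambda>z. F (- z)" and g = "\<lambda>\<theta>. - cos \<theta>" and g' = sin and a = 0 and b = "pi/2"]]])
    show "((\<lambda>\<theta>. - cos \<theta>) has_real_derivative sin x) (at x)" for x
      by (auto intro!: derivative_eq_intros)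
    show "set_borel_measurable borel {- cos 0..- cos (pi / 2)} (\<lambda>z. F (- z))"
      unfolding set_borel_measurable_def by measurable
    show "0 \<le> sin x" if "x \<in> {0..pi/2}" for x
      using that by (intro sin_ge_zero) auto
  qed (auto intro!: nn_integral_cong continuous_intros simp: indicator_def)
  finally show ?thesis
    by (subst nn_integral_sphere_zonal[OF m]) auto
qed

text \<open>The cone over an equator lies in a hyperplane. This disposes of the height 0, where
  \<open>b\<close> may be positive but which the zonal formula leaves out.\<close>

lemma AE_sphere_inner_nonzero:
  fixes m :: "real^3"
  assumes m: "norm m = 1"
  shows "AE \<sigma> in sphere_measure. m \<bullet> \<sigma> \<noteq> 0"
proof -
  let ?A = "{x. m \<bullet> x = 0}"
  have A: "?A \<in> sets borel" by measurable
  have m0: "m \<noteq> 0" using m by auto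
  have "emeasure sphere_measure (?A \<inter> sphere 0 1) = of_nat DIM(real^3) * emeasure lborel {x \<in> cball 0 1 - {0}. x /\<^sub>R norm x \<in> ?A}"
    by (rule emeasure_sphere_measure[OF A])
  also have "emeasure lborel {x \<in> cball 0 1 - {0}. x /\<^sub>R norm x \<in> ?A} \<le> emeasure lborel ?A"
    using A by (intro emeasure_mono) auto
  also have "emeasure lborel ?A = 0"
    using negligible_hyperplane[of m 0] m0 A
    by (simp add: negligible_iff_null_sets null_sets_completion_iff null_sets_def)
  finally have "emeasure sphere_measure (?A \<inter> sphere 0 1) = 0"
    by (simp add: mult_left_mono)
  moreover have "?A \<inter> sphere 0 1 \<in> sets sphere_measure"
    unfolding sets_sphere_measure sets_restrict_space using A by blast
  ultimately show ?thesis
    by (intro AE_I[where N = "?A \<inter> sphere 0 1"]) auto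
qed

section \<open>The collision kernel\<close>

lemma sin_ge_half: "x / 2 \<le> sin x" if "0 \<le> x" "x \<le> 1" for x :: real
proof -
  have "(\<lambda>x. sin x - x / 2) 0 \<le> (\<lambda>x. sin x - x / 2) x"
  proof (rule DERIV_nonneg_imp_nondecreasing[where f = "\<lambda>x. sin x - x / 2"])
    fix y assume y: "0 \<le> y" "y \<le> x"
    have "cos (pi / 3) \<le> cos y"
      using y that pi_gt3 by (intro cos_monotone_0_pi_le) auto
    then show "\<exists>d. ((\<lambda>x. sin x - x / 2) has_real_derivative d) (at y) \<and> 0 \<le> d"
      by (intro exI[of _ "cos y - 1 / 2"]) (auto intro!: derivative_eq_intros simp: cos_60)
  qed fact
  then show ?thesis by simp
qed

lemma angular_kernel_measurable:
  assumes "angular_kernel b" "h \<in> borel_measurable M" "\<And>x. x \<in> space M \<Longrightarrow> \<bar>h x\<bar> \<le> 1"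
  shows "(\<lambda>x. b (h x)) \<in> borel_measurable M"
proof (rule measurable_compose[of h M "restrict_space borel {-1..1}" b])
  show "h \<in> M \<rightarrow>\<^sub>M restrict_space borel {-1..1}"
    using assms(2,3) by (intro measurable_restrict_space2) (force simp: abs_le_iff)+
qed (use assms(1) in \<open>simp add: angular_kernel_def\<close>)

lemma angular_kernel_nonneg: "angular_kernel b \<Longrightarrow> \<bar>x\<bar> \<le> 1 \<Longrightarrow> 0 \<le> b x"
  by (force simp: angular_kernel_def abs_le_iff)

lemma abs_inner_sphere_le: "norm m \<le> 1 \<Longrightarrow> \<sigma> \<in> sphere 0 1 \<Longrightarrow> \<bar>m \<bullet> \<sigma>\<bar> \<le> 1"
  using Cauchy_Schwarz_ineq2[of m \<sigma>] by simp

lemma nn_integral_angular_kernel: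
  fixes m :: "real^3" and h :: "real \<Rightarrow> real"
  assumes b: "angular_kernel b" and m: "norm m = 1"
    and [measurable]: "h \<in> borel_measurable borel" and h: "\<And>x. 0 \<le> h x"
  shows "(\<integral>\<^sup>+\<sigma>. ennreal (b (m \<bullet> \<sigma>) * h (m \<bullet> \<sigma>)) \<partial>sphere_measure) =
    ennreal (2 * pi) * (\<integral>\<^sup>+\<theta>. ennreal (sin \<theta> * b (cos \<theta>) * h (cos \<theta>)) * indicator {0..pi/2} \<theta> \<partial>lborel)"
proof -
  \<comment> \<open>\<open>b\<close> is measurable only on [-1, 1] and arbitrary elsewhere, whereas
    the zonal formula needs a Borel function on the line; hence the extension by zero.\<close>
  let ?F = "\<lambda>x. indicator {0<..1} x * (indicator {-1..1} x *\<^sub>R b x) * h x"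
  have "(\<lambda>x. indicator {-1..1} x *\<^sub>R b x) \<in> borel_measurable borel"
    using b by (simp add: angular_kernel_def borel_measurable_restrict_space_iff)
  then have F: "?F \<in> borel_measurable borel" by measurable
  have "(\<integral>\<^sup>+\<sigma>. ennreal (b (m \<bullet> \<sigma>) * h (m \<bullet> \<sigma>)) \<partial>sphere_measure) =
      (\<integral>\<^sup>+\<sigma>. ennreal (?F (m \<bullet> \<sigma>)) * indicator {0<..} (m \<bullet> \<sigma>) \<partial>sphere_measure)"
  proof (rule nn_integral_cong_AE, use AE_sphere_inner_nonzero[OF m] AE_space in eventually_elim)
    fix \<sigma> assume s: "m \<bullet> \<sigma> \<noteq> 0" "\<sigma> \<in> space sphere_measure"
    then have "\<bar>m \<bullet> \<sigma>\<bar> \<le> 1" using abs_inner_sphere_le[of m \<sigma>] m by simp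
    moreover have "b (m \<bullet> \<sigma>) = 0" if "m \<bullet> \<sigma> < 0"
      using that b \<open>\<bar>m \<bullet> \<sigma>\<bar> \<le> 1\<close> by (auto simp: angular_kernel_def)
    ultimately show "ennreal (b (m \<bullet> \<sigma>) * h (m \<bullet> \<sigma>)) = ennreal (?F (m \<bullet> \<sigma>)) * indicator {0<..} (m \<bullet> \<sigma>)"
      using s by (cases "m \<bullet> \<sigma>" "0::real" rule: linorder_cases) (auto simp: indicator_def)
  qed
  also have "\<dots> = ennreal (2 * pi) * (\<integral>\<^sup>+\<theta>. ennreal (?F (cos \<theta>) * sin \<theta>) * indicator {0..pi/2} \<theta> \<partial>lborel)"
    by (rule nn_integral_sphere_angle[OF m F])
  also have "(\<integral>\<^sup>+\<theta>. ennreal (?F (cos \<theta>) * sin \<theta>) * indicator {0..pi/2} \<theta> \<partial>lborel) =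
     (\<integral>\<^sup>+\<theta>. ennreal (sin \<theta> * b (cos \<theta>) * h (cos \<theta>)) * indicator {0..pi/2} \<theta> \<partial>lborel)"
  proof (rule nn_integral_cong_AE, use AE_lborel_singleton[of "pi/2"] in eventually_elim)
    fix \<theta> :: real assume "\<theta> \<noteq> pi / 2"
    then have "0 < cos \<theta>" "cos \<theta> \<in> {-1..1}" if "\<theta> \<in> {0..pi/2}"
      using that by (auto intro: cos_gt_zero_pi)
    then show "ennreal (?F (cos \<theta>) * sin \<theta>) * indicator {0..pi/2} \<theta> =
        ennreal (sin \<theta> * b (cos \<theta>) * h (cos \<theta>)) * indicator {0..pi/2} \<theta>"
      by (auto simp: indicator_def mult_ac)
  qed
  finally show ?thesis .
qed

locale singular_kernel =
  fixes b :: "real \<Rightarrow> real" and s K :: real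
  assumes s: "0 < s" "s < 1/2" and b: "angular_kernel b" and K: "K > 0"
    and lim: "((\<lambda>\<theta>. \<theta> powr (1 + 2 * s) * (sin \<theta> * b (cos \<theta>))) \<longlongrightarrow> K) (at_right 0)"
begin

lemma near_singularity:
  obtains \<theta>\<^sub>0 where "0 < \<theta>\<^sub>0" "\<theta>\<^sub>0 \<le> 1"
    "\<And>\<theta>. 0 < \<theta> \<Longrightarrow> \<theta> \<le> \<theta>\<^sub>0 \<Longrightarrow> K / 2 * \<theta> powr (- 1 - 2 * s) \<le> sin \<theta> * b (cos \<theta>)"
    "\<And>\<theta>. 0 < \<theta> \<Longrightarrow> \<theta> \<le> \<theta>\<^sub>0 \<Longrightarrow> sin \<theta> * b (cos \<theta>) \<le> 2 * K * \<theta> powr (- 1 - 2 * s)"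
proof -
  have "\<forall>\<^sub>F \<theta> in at_right 0. K / 2 < \<theta> powr (1 + 2 * s) * (sin \<theta> * b (cos \<theta>)) \<and>
      \<theta> powr (1 + 2 * s) * (sin \<theta> * b (cos \<theta>)) < 2 * K"
    using K by (intro eventually_conj order_tendstoD[OF lim]) auto
  then obtain d where d: "d > 0" "\<And>\<theta>. 0 < \<theta> \<Longrightarrow> \<theta> < d \<Longrightarrow> K / 2 < \<theta> powr (1 + 2 * s) * (sin \<theta> * b (cos \<theta>)) \<and>
      \<theta> powr (1 + 2 * s) * (sin \<theta> * b (cos \<theta>)) < 2 * K"
    unfolding eventually_at_right_field by blast
  have p: "x = \<theta> powr (- 1 - 2 * s) * (\<theta> powr (1 + 2 * s) * x)" if "\<theta> > 0" for \<theta> x :: real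
    using that by (simp add: mult.assoc[symmetric] powr_add[symmetric])
  show ?thesis
  proof (rule that[of "min 1 (d / 2)"])
    fix \<theta> :: real assume t: "0 < \<theta>" "\<theta> \<le> min 1 (d / 2)"
    then have "\<theta> < d" by auto
    note bnd = d(2)[OF t(1) this]
    show "K / 2 * \<theta> powr (- 1 - 2 * s) \<le> sin \<theta> * b (cos \<theta>)"
      by (subst p[OF t(1), of "sin \<theta> * b (cos \<theta>)"], subst mult.commute, rule mult_left_mono) (use bnd in auto)
    show "sin \<theta> * b (cos \<theta>) \<le> 2 * K * \<theta> powr (- 1 - 2 * s)"
      by (subst p[OF t(1), of "sin \<theta> * b (cos \<theta>)"], subst mult.commute[of "2 * K"], rule mult_left_mono) (use bnd in auto)
  qed (use d in auto)
qed

lemma half_angle_sine: "sqrt ((1 - cos \<theta>) / 2) = sin (\<theta> / 2)" if "\<theta> \<in> {0..pi/2}" for \<theta> :: real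
proof -
  have "(1 - cos \<theta>) / 2 = (sin (\<theta> / 2))\<^sup>2"
    using cos_double_sin[of "\<theta> / 2"] by simp
  moreover have "0 \<le> sin (\<theta> / 2)" using that by (intro sin_ge_zero) auto
  ultimately show ?thesis by simp
qed

text \<open>The weight is sin (\<theta>/2) <= \<theta>/2, which lowers the singularity
  \<theta>^(-1-2s) to \<theta>^(-2s). By the zonal formula the integral depends on \<open>m\<close>
  only through its norm, hence one constant for all directions.\<close>

lemma momentum_transfer:
  "\<exists>C\<ge>0. \<forall>m::real^3. norm m = 1 \<longrightarrow>
     integrable sphere_measure (\<lambda>\<sigma>. b (m \<bullet> \<sigma>) * sqrt ((1 - m \<bullet> \<sigma>) / 2)) \<and>
     (LINT \<sigma>|sphere_measure. b (m \<bullet> \<sigma>) * sqrt ((1 - m \<bullet> \<sigma>) / 2)) = C"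
proof -
  obtain \<theta>\<^sub>0 where t0: "0 < \<theta>\<^sub>0" "\<theta>\<^sub>0 \<le> 1"
    "\<And>\<theta>. 0 < \<theta> \<Longrightarrow> \<theta> \<le> \<theta>\<^sub>0 \<Longrightarrow> sin \<theta> * b (cos \<theta>) \<le> 2 * K * \<theta> powr (- 1 - 2 * s)"
    using near_singularity by metis
  \<comment> \<open>\<open>min 1 x\<close> only keeps the weight non-negative on the whole line; on
    the sphere the cosine never exceeds 1.\<close>
  let ?h = "\<lambda>x::real. sqrt ((1 - min 1 x) / 2)"
  let ?I = "ennreal (2 * pi) * (\<integral>\<^sup>+\<theta>. ennreal (sin \<theta> * b (cos \<theta>) * ?h (cos \<theta>)) * indicator {0..pi/2} \<theta> \<partial>lborel)"
  have sb: "set_integrable lborel {\<theta>\<^sub>0..pi/2} (\<lambda>\<theta>. sin \<theta> * b (cos \<theta>))"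
    using b t0(1) by (simp add: angular_kernel_def)
  have "(\<integral>\<^sup>+\<theta>. ennreal (sin \<theta> * b (cos \<theta>) * ?h (cos \<theta>)) * indicator {0..pi/2} \<theta> \<partial>lborel) \<le>
     (\<integral>\<^sup>+\<theta>. ennreal (indicator {0..\<theta>\<^sub>0} \<theta> * (K * \<theta> powr (- 2 * s))) + ennreal (norm (indicator {\<theta>\<^sub>0..pi/2} \<theta> *\<^sub>R (sin \<theta> * b (cos \<theta>)))) \<partial>lborel)"
  proof (rule nn_integral_mono)
    fix \<theta> :: real
    show "ennreal (sin \<theta> * b (cos \<theta>) * ?h (cos \<theta>)) * indicator {0..pi/2} \<theta> \<le>
      ennreal (indicator {0..\<theta>\<^sub>0} \<theta> * (K * \<theta> powr (- 2 * s))) + ennreal (norm (indicator {\<theta>\<^sub>0..pi/2} \<theta> *\<^sub>R (sin \<theta> * b (cos \<theta>))))"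
    proof (cases "\<theta> \<in> {0..pi/2}")
      case True
      have h: "?h (cos \<theta>) = sin (\<theta> / 2)"
        using half_angle_sine[OF True] by simp
      have sb0: "0 \<le> sin \<theta> * b (cos \<theta>)"
        using True angular_kernel_nonneg[OF b, of "cos \<theta>"] by (intro mult_nonneg_nonneg sin_ge_zero) auto
      consider "\<theta> = 0" | "0 < \<theta>" "\<theta> \<le> \<theta>\<^sub>0" | "\<theta>\<^sub>0 < \<theta>" using True by fastforce
      then show ?thesis
      proof cases
        case 2
        have "sin \<theta> * b (cos \<theta>) * sin (\<theta> / 2) \<le> (2 * K * \<theta> powr (- 1 - 2 * s)) * (\<theta> / 2)"
        proof (rule mult_mono)
          show "sin (\<theta> / 2) \<le> \<theta> / 2" using 2 by (intro sin_x_le_x) auto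
          show "0 \<le> sin (\<theta> / 2)" using 2 True by (intro sin_ge_zero) auto
        qed (use 2 t0(3) K in auto)
        also have "\<dots> = K * (\<theta> powr (- 1 - 2 * s) * \<theta> powr 1)"
          using 2 by simp
        also have "\<dots> = K * \<theta> powr (- 2 * s)"
          by (subst powr_add[symmetric]) simp
        finally have "ennreal (sin \<theta> * b (cos \<theta>) * ?h (cos \<theta>)) \<le> ennreal (K * \<theta> powr (- 2 * s)) +
            ennreal (norm (indicator {\<theta>\<^sub>0..pi/2} \<theta> *\<^sub>R (sin \<theta> * b (cos \<theta>))))"
          unfolding h by (intro add_increasing2 ennreal_leI) auto
        then show ?thesis
          using 2 True by simp
      next
        case 3
        have "sin \<theta> * b (cos \<theta>) * sin (\<theta> / 2) \<le> (sin \<theta> * b (cos \<theta>)) * 1"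
          using sb0 by (intro mult_left_mono) auto
        then have "ennreal (sin \<theta> * b (cos \<theta>) * ?h (cos \<theta>)) \<le> ennreal (sin \<theta> * b (cos \<theta>))"
          unfolding h by (intro ennreal_leI) auto
        then show ?thesis
          using 3 True sb0 t0 by simp
      qed simp
    qed simp
  qed
  also have "\<dots> = (\<integral>\<^sup>+\<theta>. ennreal (indicator {0..\<theta>\<^sub>0} \<theta> * (K * \<theta> powr (- 2 * s))) \<partial>lborel) +
      (\<integral>\<^sup>+\<theta>. ennreal (norm (indicator {\<theta>\<^sub>0..pi/2} \<theta> *\<^sub>R (sin \<theta> * b (cos \<theta>)))) \<partial>lborel)"
    using borel_measurable_integrable[OF sb[unfolded set_integrable_def]] by (intro nn_integral_add) auto
  also have "\<dots> < \<infinity>"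
  proof -
    have "((\<lambda>\<theta>. K * \<theta> powr (- 2 * s)) has_integral (K * (\<theta>\<^sub>0 powr (- 2 * s + 1) / (- 2 * s + 1)))) {0..\<theta>\<^sub>0}"
      using s t0 by (intro has_integral_mult_right has_integral_powr_from_0) auto
    from nn_integral_has_integral_lebesgue[OF _ this] K
    have "(\<integral>\<^sup>+\<theta>. ennreal (indicator {0..\<theta>\<^sub>0} \<theta> * (K * \<theta> powr (- 2 * s))) \<partial>lborel) = ennreal (K * (\<theta>\<^sub>0 powr (- 2 * s + 1) / (- 2 * s + 1)))"
      by simp
    moreover have "(\<integral>\<^sup>+\<theta>. ennreal (norm (indicator {\<theta>\<^sub>0..pi/2} \<theta> *\<^sub>R (sin \<theta> * b (cos \<theta>)))) \<partial>lborel) < \<infinity>"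
      using sb unfolding set_integrable_def integrable_iff_bounded by simp
    ultimately show ?thesis by simp
  qed
  finally have fin: "?I < \<infinity>"
    by (simp add: ennreal_mult_less_top)
  have "integrable sphere_measure (\<lambda>\<sigma>. b (m \<bullet> \<sigma>) * sqrt ((1 - m \<bullet> \<sigma>) / 2)) \<and>
     (LINT \<sigma>|sphere_measure. b (m \<bullet> \<sigma>) * sqrt ((1 - m \<bullet> \<sigma>) / 2)) = enn2real ?I" if m: "norm m = 1" for m :: "real^3"
  proof -
    have bd: "\<bar>m \<bullet> \<sigma>\<bar> \<le> 1" if "\<sigma> \<in> space sphere_measure" for \<sigma>
      using that m by (simp add: abs_inner_sphere_le)
    have meas: "(\<lambda>\<sigma>. b (m \<bullet> \<sigma>)) \<in> borel_measurable sphere_measure"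
      using bd by (intro angular_kernel_measurable[OF b]) auto
    then have meas': "(\<lambda>\<sigma>. b (m \<bullet> \<sigma>) * sqrt ((1 - m \<bullet> \<sigma>) / 2)) \<in> borel_measurable sphere_measure"
      by measurable
    have nn: "AE \<sigma> in sphere_measure. 0 \<le> b (m \<bullet> \<sigma>) * sqrt ((1 - m \<bullet> \<sigma>) / 2)"
      using bd angular_kernel_nonneg[OF b] by (intro AE_I2 mult_nonneg_nonneg) (auto simp: abs_le_iff)
    have "(\<integral>\<^sup>+\<sigma>. ennreal (b (m \<bullet> \<sigma>) * sqrt ((1 - m \<bullet> \<sigma>) / 2)) \<partial>sphere_measure) =
        (\<integral>\<^sup>+\<sigma>. ennreal (b (m \<bullet> \<sigma>) * ?h (m \<bullet> \<sigma>)) \<partial>sphere_measure)"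
      using bd by (intro nn_integral_cong) (simp add: abs_le_iff min_absorb2)
    also have "\<dots> = ?I"
      by (rule nn_integral_angular_kernel[OF b m]) auto
    finally have eq: "(\<integral>\<^sup>+\<sigma>. ennreal (b (m \<bullet> \<sigma>) * sqrt ((1 - m \<bullet> \<sigma>) / 2)) \<partial>sphere_measure) = ?I" .
    show ?thesis
      using integrableI_nonneg[OF meas' nn] integral_eq_nn_integral[OF meas' nn] fin eq by simp
  qed
  then show ?thesis
    by (intro exI[of _ "enn2real ?I"]) simp
qed

text \<open>The weight sin^2 (\<theta>/2), of order \<theta>^2, integrated against \<theta>^(-1-2s)
  up to \<theta> of order sqrt \<rho>, scales like \<rho>^(1-s). This is where the exponent s of the
  regularization arises: at \<rho> = 1/x one has x \<rho>^(1-s) = x^s.\<close>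

lemma energy_transfer_lower_bound:
  "\<exists>c>0. \<forall>m::real^3. \<forall>\<rho>. norm m = 1 \<longrightarrow> 0 < \<rho> \<longrightarrow> \<rho> \<le> 1 \<longrightarrow>
     c * \<rho> powr (1 - s) \<le>
       (LINT \<sigma>|sphere_measure. b (m \<bullet> \<sigma>) * ((1 - m \<bullet> \<sigma>) / 2 * indicator {..\<rho>} ((1 - m \<bullet> \<sigma>) / 2)))"
proof -
  obtain \<theta>\<^sub>0 where t0: "0 < \<theta>\<^sub>0" "\<theta>\<^sub>0 \<le> 1"
    "\<And>\<theta>. 0 < \<theta> \<Longrightarrow> \<theta> \<le> \<theta>\<^sub>0 \<Longrightarrow> K / 2 * \<theta> powr (- 1 - 2 * s) \<le> sin \<theta> * b (cos \<theta>)"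
    using near_singularity by metis
  \<comment> \<open>2 pi comes from the zonal formula, K/2 from the kernel, 1/64 from the bound
    (a/8)^2 and the last 1/2 from the length a/2 of the range of angles retained below.\<close>
  define c where "c = 2 * pi * (K / 2 * (1 / 64) * \<theta>\<^sub>0 powr (2 - 2 * s) / 2)"
  have c: "c > 0" using K t0 by (simp add: c_def)
  have "c * \<rho> powr (1 - s) \<le>
       (LINT \<sigma>|sphere_measure. b (m \<bullet> \<sigma>) * ((1 - m \<bullet> \<sigma>) / 2 * indicator {..\<rho>} ((1 - m \<bullet> \<sigma>) / 2)))"
    if m: "norm m = 1" and \<rho>: "0 < \<rho>" "\<rho> \<le> 1" for m :: "real^3" and \<rho>
  proof -
    let ?h = "\<lambda>x::real. (1 - min 1 x) / 2 * indicator {..\<rho>} ((1 - min 1 x) / 2)"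
    \<comment> \<open>Only angles in [a/2, a] are retained: a <= \<open>\<theta>\<^sub>0\<close>
      keeps them where the kernel is controlled, and a <= sqrt \<rho> keeps sin^2 (\<theta>/2) below
      the threshold \<rho>.\<close>
    define a where "a = \<theta>\<^sub>0 * sqrt \<rho>"
    have a: "0 < a" "a \<le> \<theta>\<^sub>0" "a \<le> sqrt \<rho>"
      using t0 \<rho> by (auto simp: a_def mult_le_cancel_left1 mult_le_cancel_right1)
    have bd: "\<bar>m \<bullet> \<sigma>\<bar> \<le> 1" if "\<sigma> \<in> space sphere_measure" for \<sigma>
      using that m by (simp add: abs_inner_sphere_le)
    have meas: "(\<lambda>\<sigma>. b (m \<bullet> \<sigma>)) \<in> borel_measurable sphere_measure"
      using bd by (intro angular_kernel_measurable[OF b]) auto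
    let ?f = "\<lambda>\<sigma>. b (m \<bullet> \<sigma>) * ((1 - m \<bullet> \<sigma>) / 2 * indicator {..\<rho>} ((1 - m \<bullet> \<sigma>) / 2))"
    have meas': "?f \<in> borel_measurable sphere_measure"
      using meas by measurable
    have "integrable sphere_measure ?f"
    proof (rule Bochner_Integration.integrable_bound)
      show "integrable sphere_measure (\<lambda>\<sigma>. b (m \<bullet> \<sigma>) * sqrt ((1 - m \<bullet> \<sigma>) / 2))"
        using momentum_transfer m by blast
      show "AE \<sigma> in sphere_measure. norm (?f \<sigma>) \<le> norm (b (m \<bullet> \<sigma>) * sqrt ((1 - m \<bullet> \<sigma>) / 2))"
      proof (rule AE_I2)
        fix \<sigma> :: "real^3" assume "\<sigma> \<in> space sphere_measure"
        define y where "y = (1 - m \<bullet> \<sigma>) / 2"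
        have y: "0 \<le> y" "y \<le> 1" using bd[OF \<open>\<sigma> \<in> _\<close>] by (auto simp: y_def abs_le_iff)
        then have "y \<le> sqrt y" by (intro real_le_rsqrt) (simp add: power2_eq_square mult_left_le)
        then show "norm (?f \<sigma>) \<le> norm (b (m \<bullet> \<sigma>) * sqrt ((1 - m \<bullet> \<sigma>) / 2))"
          using y unfolding y_def[symmetric] by (auto simp: abs_mult indicator_def intro!: mult_left_mono)
      qed
    qed (rule meas')
    moreover have nn: "AE \<sigma> in sphere_measure. 0 \<le> ?f \<sigma>"
      using bd angular_kernel_nonneg[OF b] by (intro AE_I2 mult_nonneg_nonneg) (auto simp: abs_le_iff)
    ultimately have "ennreal (LINT \<sigma>|sphere_measure. ?f \<sigma>) = (\<integral>\<^sup>+\<sigma>. ennreal (?f \<sigma>) \<partial>sphere_measure)"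
      by (simp add: nn_integral_eq_integral)
    also have "\<dots> = (\<integral>\<^sup>+\<sigma>. ennreal (b (m \<bullet> \<sigma>) * ?h (m \<bullet> \<sigma>)) \<partial>sphere_measure)"
      using bd by (intro nn_integral_cong) (simp add: abs_le_iff min_absorb2)
    also have "\<dots> = ennreal (2 * pi) * (\<integral>\<^sup>+\<theta>. ennreal (sin \<theta> * b (cos \<theta>) * ?h (cos \<theta>)) * indicator {0..pi/2} \<theta> \<partial>lborel)"
      by (rule nn_integral_angular_kernel[OF b m]) auto
    also have "\<dots> \<ge> ennreal (2 * pi) * (\<integral>\<^sup>+\<theta>. ennreal (K / 2 * a powr (- 1 - 2 * s) * (a / 8)\<^sup>2) * indicator {a/2..a} \<theta> \<partial>lborel)"
    proof (intro mult_left_mono nn_integral_mono)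
      fix \<theta> :: real
      show "ennreal (K / 2 * a powr (- 1 - 2 * s) * (a / 8)\<^sup>2) * indicator {a/2..a} \<theta> \<le>
          ennreal (sin \<theta> * b (cos \<theta>) * ?h (cos \<theta>)) * indicator {0..pi/2} \<theta>"
      proof (cases "\<theta> \<in> {a/2..a}")
        case True
        then have t: "0 < \<theta>" "\<theta> \<le> \<theta>\<^sub>0" "\<theta> \<le> 1" "\<theta> \<in> {0..pi/2}"
          using a t0 pi_gt3 by auto
        have "(1 - cos \<theta>) / 2 = (sin (\<theta> / 2))\<^sup>2"
          using cos_double_sin[of "\<theta> / 2"] by simp
        moreover have "a / 8 \<le> sin (\<theta> / 2)" "sin (\<theta> / 2) \<le> sqrt \<rho>"
          using sin_ge_half[of "\<theta> / 2"] sin_x_le_x[of "\<theta> / 2"] t True a by auto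
        ultimately have h: "(a / 8)\<^sup>2 \<le> ?h (cos \<theta>)"
          using a(1) \<rho> by (auto simp: power_mono sqrt_le_D indicator_def) (smt (verit) power_mono real_sqrt_pow2 a(1))
        have "K / 2 * a powr (- 1 - 2 * s) \<le> K / 2 * \<theta> powr (- 1 - 2 * s)"
          using True K t s by (intro mult_left_mono powr_mono2') auto
        also have "\<dots> \<le> sin \<theta> * b (cos \<theta>)" using t0(3) t by blast
        finally have *: "K / 2 * a powr (- 1 - 2 * s) \<le> sin \<theta> * b (cos \<theta>)" .
        moreover have "0 \<le> K / 2 * a powr (- 1 - 2 * s)" using K by simp
        ultimately have "K / 2 * a powr (- 1 - 2 * s) * (a / 8)\<^sup>2 \<le> sin \<theta> * b (cos \<theta>) * ?h (cos \<theta>)"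
          by (intro mult_mono[OF * h]) simp_all
        then show ?thesis using True t by (simp add: ennreal_leI)
      qed simp
    qed simp
    also have "ennreal (2 * pi) * (\<integral>\<^sup>+\<theta>. ennreal (K / 2 * a powr (- 1 - 2 * s) * (a / 8)\<^sup>2) * indicator {a/2..a} \<theta> \<partial>lborel) =
        ennreal (2 * pi * (K / 2 * a powr (- 1 - 2 * s) * (a / 8)\<^sup>2 * (a / 2)))"
    proof -
      have "ennreal (2 * pi * (C * r)) = ennreal (2 * pi) * (ennreal C * ennreal r)" if "0 \<le> C" "0 \<le> r" for C r
        by (subst ennreal_mult, simp, use that in simp, subst ennreal_mult) (use that in simp_all)
      from this[of "K / 2 * a powr (- 1 - 2 * s) * (a / 8)\<^sup>2" "a / 2"] show ?thesis
        using a K by (simp add: nn_integral_cmult_indicator)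
    qed
    also have "2 * pi * (K / 2 * a powr (- 1 - 2 * s) * (a / 8)\<^sup>2 * (a / 2)) = c * \<rho> powr (1 - s)"
    proof -
      have "a powr (- 1 - 2 * s) * a ^ 3 = a powr (2 - 2 * s)"
        using a(1) by (simp add: powr_add[symmetric] flip: powr_numeral)
      also have "\<dots> = \<theta>\<^sub>0 powr (2 - 2 * s) * \<rho> powr (1 - s)"
        using t0 \<rho> by (simp add: a_def powr_mult powr_powr powr_half_sqrt[symmetric] algebra_simps)
      finally have "a powr (- 1 - 2 * s) * a ^ 3 = \<theta>\<^sub>0 powr (2 - 2 * s) * \<rho> powr (1 - s)" .
      moreover have "2 * pi * (K / 2 * a powr (- 1 - 2 * s) * (a / 8)\<^sup>2 * (a / 2)) =
         2 * pi * (K / 2 * (1 / 64) * (a powr (- 1 - 2 * s) * a ^ 3) / 2)"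
        by (simp add: power2_eq_square power3_eq_cube)
      ultimately show ?thesis by (simp only: c_def mult.assoc times_divide_eq_left)
    qed
    finally have "ennreal (c * \<rho> powr (1 - s)) \<le> ennreal (LINT \<sigma>|sphere_measure. ?f \<sigma>)" .
    then show ?thesis
      using c \<rho> integral_nonneg_AE[OF nn] by (subst (asm) ennreal_le_iff) auto
  qed
  with c show ?thesis by blast
qed

end

section \<open>The comparison principle\<close>

text \<open>The exponent of the barrier: equal to \<open>x\<close> for \<open>x \<le> 1\<close> and to \<open>1 + \<tau> (x powr p - 1)\<close> for \<open>x \<ge> 1\<close>.\<close>

definition profile :: "real \<Rightarrow> real \<Rightarrow> real \<Rightarrow> real" where
  "profile p \<tau> x = min x 1 + \<tau> * (max 1 x powr p - 1)"

text \<open>This is concavity combined with the value 0 at 0. While x y is in the linear range only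
  h(x) <= x matters; beyond it, y <= y^p handles the power and y <= 1 the constant 1 -
  \<tau>.\<close>

lemma profile_scale:
  assumes p: "0 < p" "p \<le> 1 / 2" and t: "0 \<le> \<tau>" "\<tau> \<le> 1" and x: "0 \<le> x" and y: "0 \<le> y" "y \<le> 1"
  shows "y * profile p \<tau> x \<le> profile p \<tau> (x * y)"
proof -
  have le: "profile p \<tau> x \<le> x"
  proof (cases "x \<le> 1")
    case False
    then have "x powr p \<le> x powr 1" using p by (intro powr_mono) auto
    then have "\<tau> * (x powr p - 1) \<le> 1 * (x - 1)"
      using t False ge_one_powr_ge_zero[of x p] p by (intro mult_mono) auto
    then show ?thesis using False by (simp add: profile_def)
  qed (simp add: profile_def)
  show ?thesis
  proof (cases "x * y \<le> 1")
    case True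
    then have "profile p \<tau> (x * y) = x * y" by (simp add: profile_def)
    then show ?thesis using mult_left_mono[OF le y(1)] by (simp add: mult.commute)
  next
    case False
    then have y0: "y > 0" using y x by (cases "y = 0") auto
    have x1: "x > 1" using False y x mult_left_le[of y x] by linarith
    have "y \<le> y powr p" using y0 y p powr_mono'[of p 1 y] by auto
    then have "\<tau> * (y * x powr p) \<le> \<tau> * (x powr p * y powr p)"
      using t mult_left_mono[of y "y powr p" "x powr p"] by (intro mult_left_mono) (auto simp: mult.commute)
    moreover have "y * (1 - \<tau>) \<le> 1 * (1 - \<tau>)"
      using y t by (intro mult_right_mono) auto
    ultimately show ?thesis
      using False x1 x y by (simp add: profile_def powr_mult algebra_simps)
  qed
qed

text \<open>x y and x (1 - y) are the squared lengths of \<open>neg_part\<close> and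
  \<open>pos_part\<close>; thus the product of the barriers at the two Bobylev frequencies is at
  most the barrier at \<xi>.\<close>

lemma profile_subadditive:
  assumes "0 < p" "p \<le> 1 / 2" "0 \<le> \<tau>" "\<tau> \<le> 1" "0 \<le> x" "0 \<le> y" "y \<le> 1"
  shows "profile p \<tau> x \<le> profile p \<tau> (x * y) + profile p \<tau> (x * (1 - y))"
  using profile_scale[OF assms] profile_scale[OF assms(1-5), of "1 - y"] assms(6,7)
  by (simp add: algebra_simps)

text \<open>For z >= 1 the slope p z^(p-1) is at most 1/2, against slope 1 in the linear range of
  the profile. The gap between the two slopes is the source of the dissipation.\<close>

lemma powr_increment_le:
  fixes p :: real
  assumes p: "0 < p" "p \<le> 1 / 2" and u: "1 \<le> u" "u \<le> x"
  shows "x powr p - u powr p \<le> (x - u) / 2"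
proof -
  have "(\<lambda>z. z / 2 - z powr p) u \<le> (\<lambda>z. z / 2 - z powr p) x"
  proof (rule DERIV_nonneg_imp_nondecreasing[where f = "\<lambda>z. z / 2 - z powr p"])
    fix z assume z: "u \<le> z" "z \<le> x"
    have "z powr (p - 1) \<le> 1" using z u p powr_mono[of "p - 1" 0 z] by auto
    then have "p * z powr (p - 1) \<le> 1 / 2 * 1" using p by (intro mult_mono) auto
    moreover have "((\<lambda>z. z / 2 - z powr p) has_real_derivative 1 / 2 - p * z powr (p - 1)) (at z)"
      using z u by (auto intro!: derivative_eq_intros simp: has_real_derivative_powr)
    ultimately show "\<exists>d. ((\<lambda>z. z / 2 - z powr p) has_real_derivative d) (at z) \<and> 0 \<le> d"
      by (intro exI conjI) auto
  qed fact
  then show ?thesis by simp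
qed

text \<open>The bound on y says that x y <= 1 and x (1 - y) >= 1. The low frequency then contributes
  its full x y, while the step from x down to x (1 - y) costs at most half of it.\<close>

lemma profile_excess:
  assumes p: "0 < p" "p \<le> 1 / 2" and t: "0 \<le> \<tau>" "\<tau> \<le> 1" and x: "1 < x"
    and y: "0 \<le> y" "y \<le> min (1 / x) (1 - 1 / x)"
  shows "profile p \<tau> x + x * y / 2 \<le> profile p \<tau> (x * y) + profile p \<tau> (x * (1 - y))"
proof -
  have xy: "x * y \<le> 1" "1 \<le> x * (1 - y)" "x * (1 - y) \<le> x"
    using x y by (auto simp: field_simps)
  have "\<tau> * (x powr p - (x * (1 - y)) powr p) \<le> 1 * ((x - x * (1 - y)) / 2)"
    using t xy powr_increment_le[OF p xy(2,3)] powr_mono2[of p "x * (1 - y)" x] p by (intro mult_mono) auto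
  moreover have "profile p \<tau> (x * y) = x * y" using xy by (simp add: profile_def)
  moreover have "profile p \<tau> (x * (1 - y)) = 1 + \<tau> * ((x * (1 - y)) powr p - 1)"
    using xy by (simp add: profile_def max_absorb2 min_absorb2)
  moreover have "profile p \<tau> x = 1 + \<tau> * (x powr p - 1)"
    using x by (simp add: profile_def max_absorb2 min_absorb2)
  ultimately show ?thesis by (simp add: algebra_simps)
qed

lemma exp_minus_le: "exp (- z) \<le> 1 - z / 2" if "0 \<le> z" "z \<le> 1" for z :: real
proof -
  have "(1 + z) * (1 - z / 2) \<ge> 1"
    using that mult_left_le[of z z] by (simp add: algebra_simps)
  moreover have "1 + z \<le> exp z" by (rule exp_ge_add_one_self)
  ultimately have "1 \<le> exp z * (1 - z / 2)"
    using that by (smt (verit) mult_right_mono divide_le_eq_1 field_sum_of_halves)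
  then show ?thesis by (simp add: exp_minus field_simps)
qed

text \<open>Bobylev's frequencies \<open>\<xi>\<^sup>+\<close> and \<open>\<xi>\<^sup>-\<close>; below, \<open>deviation \<xi> \<sigma>\<close> is \<open>sin\<^sup>2 (\<theta>/2)\<close>.\<close>

definition pos_part :: "real^3 \<Rightarrow> real^3 \<Rightarrow> real^3" where
  "pos_part \<xi> \<sigma> = (\<xi> + norm \<xi> *\<^sub>R \<sigma>) /\<^sub>R 2"

definition neg_part :: "real^3 \<Rightarrow> real^3 \<Rightarrow> real^3" where
  "neg_part \<xi> \<sigma> = (\<xi> - norm \<xi> *\<^sub>R \<sigma>) /\<^sub>R 2"

definition deviation :: "real^3 \<Rightarrow> real^3 \<Rightarrow> real" where
  "deviation \<xi> \<sigma> = (1 - (\<xi> /\<^sub>R norm \<xi>) \<bullet> \<sigma>) / 2"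

lemma deviation_bounds: "0 \<le> deviation \<xi> \<sigma>" "deviation \<xi> \<sigma> \<le> 1" if "norm \<sigma> = 1"
proof -
  have "norm (\<xi> /\<^sub>R norm \<xi>) \<le> 1" by (cases "\<xi> = 0") auto
  from abs_inner_sphere_le[OF this, of \<sigma>] that
  show "0 \<le> deviation \<xi> \<sigma>" "deviation \<xi> \<sigma> \<le> 1" by (auto simp: deviation_def abs_le_iff)
qed

lemma norm_parts:
  assumes "norm \<sigma> = 1"
  shows "(norm (neg_part \<xi> \<sigma>))\<^sup>2 = (norm \<xi>)\<^sup>2 * deviation \<xi> \<sigma>"
    and "(norm (pos_part \<xi> \<sigma>))\<^sup>2 = (norm \<xi>)\<^sup>2 * (1 - deviation \<xi> \<sigma>)"
    and "norm (neg_part \<xi> \<sigma>) = norm \<xi> * sqrt (deviation \<xi> \<sigma>)"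
    and "norm (pos_part \<xi> \<sigma>) \<le> norm \<xi>"
proof -
  have ss: "\<sigma> \<bullet> \<sigma> = 1" using assms by (simp add: norm_eq_1)
  have xx: "\<xi> \<bullet> \<xi> = norm \<xi> * norm \<xi>" by (metis power2_norm_eq_inner power2_eq_square)
  obtain q where q: "(\<xi> /\<^sub>R norm \<xi>) \<bullet> \<sigma> = q" by blast
  have d: "\<xi> \<bullet> \<sigma> = norm \<xi> * q" by (cases "\<xi> = 0") (auto simp flip: q)
  show n: "(norm (neg_part \<xi> \<sigma>))\<^sup>2 = (norm \<xi>)\<^sup>2 * deviation \<xi> \<sigma>"
  proof -
    have "(norm (neg_part \<xi> \<sigma>))\<^sup>2 = (norm \<xi> * norm \<xi> - norm \<xi> * (\<xi> \<bullet> \<sigma>)) / 2"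
      unfolding power2_norm_eq_inner neg_part_def
      by (simp add: inner_diff_left inner_diff_right ss xx inner_commute algebra_simps)
    also have "\<dots> = (norm \<xi>)\<^sup>2 * deviation \<xi> \<sigma>"
      unfolding d deviation_def q by (simp add: power2_eq_square field_simps)
    finally show ?thesis .
  qed
  show p: "(norm (pos_part \<xi> \<sigma>))\<^sup>2 = (norm \<xi>)\<^sup>2 * (1 - deviation \<xi> \<sigma>)"
  proof -
    have "(norm (pos_part \<xi> \<sigma>))\<^sup>2 = (norm \<xi> * norm \<xi> + norm \<xi> * (\<xi> \<bullet> \<sigma>)) / 2"
      unfolding power2_norm_eq_inner pos_part_def
      by (simp add: inner_add_left inner_add_right ss xx inner_commute algebra_simps)
    also have "\<dots> = (norm \<xi>)\<^sup>2 * (1 - deviation \<xi> \<sigma>)"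
      unfolding d deviation_def q by (simp add: power2_eq_square field_simps)
    finally show ?thesis .
  qed
  show "norm (neg_part \<xi> \<sigma>) = norm \<xi> * sqrt (deviation \<xi> \<sigma>)"
    using n by (metis norm_ge_zero real_sqrt_abs real_sqrt_mult abs_of_nonneg)
  have "(norm (pos_part \<xi> \<sigma>))\<^sup>2 \<le> (norm \<xi>)\<^sup>2"
    unfolding p using deviation_bounds[OF assms] by (intro mult_left_le) auto
  then show "norm (pos_part \<xi> \<sigma>) \<le> norm \<xi>" by (rule power2_le_imp_le) simp
qed

context singular_kernel
begin

text \<open>The loss factor \<mu> is the mass, that is, the value of the mode at frequency 0; as a
  parameter it covers both the modes and their normalization. One integral holds gain and loss
  because in general neither converges alone.\<close>

definition collision_rate :: "(real^3 \<Rightarrow> real) \<Rightarrow> real \<Rightarrow> real^3 \<Rightarrow> real" where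
  "collision_rate f \<mu> \<xi> = (LINT \<sigma>|sphere_measure. b ((\<xi> /\<^sub>R norm \<xi>) \<bullet> \<sigma>) *
     (f (pos_part \<xi> \<sigma>) * f (neg_part \<xi> \<sigma>) - \<mu> * f \<xi>))"

text \<open>A function touching the barrier \<open>exp (- \<kappa> h(|\<xi>|\<^sup>2)) + G|\<xi>|\<close> from below at \<open>\<xi>\<close> has a
  very negative collision rate there: concavity of the profile \<open>h\<close> yields the loss,
  and the linear term costs only the momentum transfer.\<close>

lemma collision_rate_at_barrier:
  fixes f :: "real^3 \<Rightarrow> real" and \<xi> :: "real^3"
  assumes C: "\<And>m::real^3. norm m = 1 \<Longrightarrow> integrable sphere_measure (\<lambda>\<sigma>. b (m \<bullet> \<sigma>) * sqrt ((1 - m \<bullet> \<sigma>) / 2))"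
      "\<And>m::real^3. norm m = 1 \<Longrightarrow> (LINT \<sigma>|sphere_measure. b (m \<bullet> \<sigma>) * sqrt ((1 - m \<bullet> \<sigma>) / 2)) = C"
    and c: "c > 0" "\<And>(m::real^3) \<rho>. norm m = 1 \<Longrightarrow> 0 < \<rho> \<Longrightarrow> \<rho> \<le> 1 \<Longrightarrow>
     c * \<rho> powr (1 - s) \<le>
       (LINT \<sigma>|sphere_measure. b (m \<bullet> \<sigma>) * ((1 - m \<bullet> \<sigma>) / 2 * indicator {..\<rho>} ((1 - m \<bullet> \<sigma>) / 2)))"
    and p: "0 < p" "p \<le> s" and t: "0 \<le> \<tau>" "\<tau> \<le> 1" and \<kappa>: "0 < \<kappa>" "\<kappa> \<le> 1"
    and G: "0 \<le> G" and sg: "\<bar>sg\<bar> = 1" and \<xi>: "\<xi> \<noteq> 0"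
    and f1: "\<And>\<xi>. \<bar>f \<xi>\<bar> \<le> 1"
    and fB: "\<And>\<xi>. \<bar>f \<xi>\<bar> \<le> exp (- \<kappa> * profile p \<tau> ((norm \<xi>)\<^sup>2)) + G * norm \<xi>"
    and eq: "sg * f \<xi> = exp (- \<kappa> * profile p \<tau> ((norm \<xi>)\<^sup>2)) + G * norm \<xi>"
    and int: "integrable sphere_measure (\<lambda>\<sigma>. b ((\<xi> /\<^sub>R norm \<xi>) \<bullet> \<sigma>) *
     (f (pos_part \<xi> \<sigma>) * f (neg_part \<xi> \<sigma>) - 1 * f \<xi>))"
  shows "sg * collision_rate f 1 \<xi> \<le> C * (G * norm \<xi>) -
    c / 4 * (\<kappa> * exp (- \<kappa> * profile p \<tau> ((norm \<xi>)\<^sup>2)) * (max 1 ((norm \<xi>)\<^sup>2) powr p - 1))"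
proof -
  define m where "m = \<xi> /\<^sub>R norm \<xi>"
  have m: "norm m = 1" using \<xi> by (simp add: m_def)
  define x where "x = (norm \<xi>)\<^sup>2"
  define E where "E = exp (- \<kappa> * profile p \<tau> x)"
  define H where "H = G * norm \<xi>"
  have H: "0 \<le> H" using G by (simp add: H_def)
  have x0: "0 < x" using \<xi> by (simp add: x_def)
  have p2: "p \<le> 1 / 2" using p s by simp
  \<comment> \<open>\<open>\<rho>\<close> is the largest deviation for which
    \<open>profile_excess\<close> applies, and \<open>A\<close> below is the relative amount by
    which the product of barriers then falls short of \<open>E\<close>: \<kappa> x y / 2 from the
    excess, halved again by \<open>exp_minus_le\<close>.\<close>
  define \<rho> where "\<rho> = min (1 / x) (1 - 1 / x)"
  define A where "A = (\<lambda>\<sigma>. if 1 < x then \<kappa> * x / 4 * ((1 - m \<bullet> \<sigma>) / 2 * indicator {..\<rho>} ((1 - m \<bullet> \<sigma>) / 2)) else 0)"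
  have bn: "0 \<le> b (m \<bullet> \<sigma>)" if "\<sigma> \<in> space sphere_measure" for \<sigma>
    using that m by (intro angular_kernel_nonneg[OF b] abs_inner_sphere_le) auto
  have pw: "b (m \<bullet> \<sigma>) * (sg * (f (pos_part \<xi> \<sigma>) * f (neg_part \<xi> \<sigma>) - 1 * f \<xi>)) \<le>
      b (m \<bullet> \<sigma>) * (H * sqrt ((1 - m \<bullet> \<sigma>) / 2) - E * A \<sigma>)" if \<sigma>: "\<sigma> \<in> space sphere_measure" for \<sigma>
  proof (rule mult_left_mono[OF _ bn[OF \<sigma>]])
    have s1: "norm \<sigma> = 1" using \<sigma> by simp
    define y where "y = deviation \<xi> \<sigma>"
    have yd: "(1 - m \<bullet> \<sigma>) / 2 = y" by (simp add: y_def deviation_def m_def)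
    have y: "0 \<le> y" "y \<le> 1" using deviation_bounds[OF s1] by (auto simp: y_def)
    define u where "u = exp (- \<kappa> * profile p \<tau> (x * (1 - y)))"
    define v where "v = exp (- \<kappa> * profile p \<tau> (x * y))"
    have k0: "0 \<le> profile p \<tau> z" if "0 \<le> z" for z
      using that t p by (simp add: profile_def ge_one_powr_ge_zero)
    have uv: "0 \<le> u" "u \<le> 1" "0 \<le> v" "v \<le> 1"
      using k0 x0 y \<kappa> by (auto simp: u_def v_def)
    have fu: "\<bar>f (pos_part \<xi> \<sigma>)\<bar> \<le> u + H"
      using fB[of "pos_part \<xi> \<sigma>"] norm_parts(2,4)[OF s1, of \<xi>] mult_left_mono[OF _ G, of "norm (pos_part \<xi> \<sigma>)" "norm \<xi>"]
      by (simp add: u_def H_def x_def y_def)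
    have fv: "\<bar>f (neg_part \<xi> \<sigma>)\<bar> \<le> v + H * sqrt y"
      using fB[of "neg_part \<xi> \<sigma>"] norm_parts(1,3)[OF s1, of \<xi>]
      by (simp add: v_def H_def x_def y_def)
    have "sg * (f (pos_part \<xi> \<sigma>) * f (neg_part \<xi> \<sigma>)) \<le> \<bar>f (pos_part \<xi> \<sigma>)\<bar> * \<bar>f (neg_part \<xi> \<sigma>)\<bar>"
      using sg abs_ge_self[of "sg * (f (pos_part \<xi> \<sigma>) * f (neg_part \<xi> \<sigma>))"] by (simp add: abs_mult)
    \<comment> \<open>The product is expanded asymmetrically. The error at \<open>neg_part\<close>
      carries sqrt y and so is integrable against \<open>b\<close>; putting |f| <= 1 in front of it
      avoids a term quadratic in H. The error H at \<open>pos_part\<close> has no such factor, but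
      cancels exactly against the H contained in \<open>sg * f \<xi>\<close>.\<close>
    also have "\<dots> \<le> \<bar>f (pos_part \<xi> \<sigma>)\<bar> * (v + H * sqrt y)"
      using fv by (intro mult_left_mono) auto
    also have "\<dots> \<le> \<bar>f (pos_part \<xi> \<sigma>)\<bar> * v + 1 * (H * sqrt y)"
      unfolding distrib_left using f1 H y by (intro add_left_mono mult_right_mono) auto
    also have "\<dots> \<le> (u + H) * v + H * sqrt y"
      using mult_right_mono[OF fu uv(3)] by simp
    also have "\<dots> \<le> u * v + H + H * sqrt y"
      using mult_left_mono[OF uv(4) H] by (simp add: algebra_simps)
    also have "u * v \<le> E * (1 - A \<sigma>)"
    proof (cases "1 < x \<and> y \<le> \<rho>")
      case True
      then have "x * y \<le> 1" using x0 by (auto simp: \<rho>_def field_simps)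
      then have "\<kappa> * (x * y) \<le> 1" using \<kappa> mult_mono[of \<kappa> 1 "x * y" 1] x0 y by simp
      have "u * v = exp (- (\<kappa> * (profile p \<tau> (x * y) + profile p \<tau> (x * (1 - y)))))"
        by (simp add: u_def v_def algebra_simps flip: exp_add)
      also have "\<dots> \<le> exp (- (\<kappa> * (profile p \<tau> x + x * y / 2)))"
        using True profile_excess[OF p(1) p2 t, of x y] y \<kappa> by (auto simp: \<rho>_def intro!: mult_left_mono)
      also have "\<dots> = E * exp (- (\<kappa> * (x * y) / 2))"
        by (simp add: E_def algebra_simps flip: exp_add)
      also have "\<dots> \<le> E * (1 - \<kappa> * (x * y) / 2 / 2)"
        using \<open>\<kappa> * (x * y) \<le> 1\<close> \<kappa> x0 y by (intro mult_left_mono exp_minus_le) (auto simp: E_def)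
      finally show ?thesis using True unfolding A_def yd by (simp add: mult.assoc)
    next
      case False
      then have "A \<sigma> = 0" by (auto simp: A_def yd)
      moreover have "u * v = exp (- (\<kappa> * (profile p \<tau> (x * y) + profile p \<tau> (x * (1 - y)))))"
        by (simp add: u_def v_def algebra_simps flip: exp_add)
      moreover have "\<dots> \<le> E"
        unfolding E_def using profile_subadditive[OF p(1) p2 t less_imp_le[OF x0] y] \<kappa> by (auto intro: mult_left_mono)
      ultimately show ?thesis by simp
    qed
    finally show "sg * (f (pos_part \<xi> \<sigma>) * f (neg_part \<xi> \<sigma>) - 1 * f \<xi>) \<le> H * sqrt ((1 - m \<bullet> \<sigma>) / 2) - E * A \<sigma>"
      using eq unfolding yd by (simp add: right_diff_distrib E_def x_def H_def)
  qed
  have intA: "integrable sphere_measure (\<lambda>\<sigma>. b (m \<bullet> \<sigma>) * A \<sigma>)"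
  proof (rule Bochner_Integration.integrable_bound)
    show "integrable sphere_measure (\<lambda>\<sigma>. \<kappa> * x / 4 * (b (m \<bullet> \<sigma>) * sqrt ((1 - m \<bullet> \<sigma>) / 2)))"
      by (intro integrable_mult_right C(1) m)
    have "(\<lambda>\<sigma>. b (m \<bullet> \<sigma>)) \<in> borel_measurable sphere_measure"
      using m by (intro angular_kernel_measurable[OF b]) (auto intro!: abs_inner_sphere_le)
    then show "(\<lambda>\<sigma>. b (m \<bullet> \<sigma>) * A \<sigma>) \<in> borel_measurable sphere_measure"
      unfolding A_def by measurable
    show "AE \<sigma> in sphere_measure. norm (b (m \<bullet> \<sigma>) * A \<sigma>) \<le> norm (\<kappa> * x / 4 * (b (m \<bullet> \<sigma>) * sqrt ((1 - m \<bullet> \<sigma>) / 2)))"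
    proof (rule AE_I2)
      fix \<sigma> :: "real^3" assume \<sigma>: "\<sigma> \<in> space sphere_measure"
      define y where "y = (1 - m \<bullet> \<sigma>) / 2"
      have y: "0 \<le> y" "y \<le> 1" using \<sigma> m abs_inner_sphere_le[of m \<sigma>] by (auto simp: y_def abs_le_iff)
      then have "y \<le> sqrt y" by (intro real_le_rsqrt) (simp add: power2_eq_square mult_left_le)
      then have "\<bar>A \<sigma>\<bar> \<le> \<kappa> * x / 4 * sqrt y"
        using y \<kappa> x0 unfolding A_def y_def[symmetric] by (auto simp: abs_mult indicator_def intro!: mult_left_mono)
      then have "\<bar>b (m \<bullet> \<sigma>)\<bar> * \<bar>A \<sigma>\<bar> \<le> \<bar>b (m \<bullet> \<sigma>)\<bar> * (\<kappa> * x / 4 * sqrt y)"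
        by (intro mult_left_mono) auto
      then show "norm (b (m \<bullet> \<sigma>) * A \<sigma>) \<le> norm (\<kappa> * x / 4 * (b (m \<bullet> \<sigma>) * sqrt ((1 - m \<bullet> \<sigma>) / 2)))"
        using y \<kappa> x0 unfolding y_def[symmetric] by (simp add: abs_mult mult_ac)
    qed
  qed
  have "sg * collision_rate f 1 \<xi> = (LINT \<sigma>|sphere_measure. b (m \<bullet> \<sigma>) * (sg * (f (pos_part \<xi> \<sigma>) * f (neg_part \<xi> \<sigma>) - 1 * f \<xi>)))"
    unfolding collision_rate_def m_def[symmetric]
    by (subst integral_mult_right_zero[symmetric]) (simp add: mult_ac)
  also have "\<dots> \<le> (LINT \<sigma>|sphere_measure. b (m \<bullet> \<sigma>) * (H * sqrt ((1 - m \<bullet> \<sigma>) / 2) - E * A \<sigma>))"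
  proof (rule integral_mono)
    show "integrable sphere_measure (\<lambda>\<sigma>. b (m \<bullet> \<sigma>) * (sg * (f (pos_part \<xi> \<sigma>) * f (neg_part \<xi> \<sigma>) - 1 * f \<xi>)))"
      using integrable_mult_right[OF int, of sg] unfolding m_def[symmetric] by (simp only: mult.left_commute)
    have "integrable sphere_measure (\<lambda>\<sigma>. H * (b (m \<bullet> \<sigma>) * sqrt ((1 - m \<bullet> \<sigma>) / 2)) - E * (b (m \<bullet> \<sigma>) * A \<sigma>))"
      by (intro Bochner_Integration.integrable_diff integrable_mult_right C(1) m intA)
    then show "integrable sphere_measure (\<lambda>\<sigma>. b (m \<bullet> \<sigma>) * (H * sqrt ((1 - m \<bullet> \<sigma>) / 2) - E * A \<sigma>))"
      by (simp add: algebra_simps)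
  qed (rule pw)
  also have "\<dots> = (LINT \<sigma>|sphere_measure. H * (b (m \<bullet> \<sigma>) * sqrt ((1 - m \<bullet> \<sigma>) / 2)) - E * (b (m \<bullet> \<sigma>) * A \<sigma>))"
    by (intro Bochner_Integration.integral_cong) (auto simp: algebra_simps)
  also have "\<dots> = H * C - E * (LINT \<sigma>|sphere_measure. b (m \<bullet> \<sigma>) * A \<sigma>)"
    by (subst Bochner_Integration.integral_diff) (auto intro!: C(1) m intA simp: C(2)[OF m])
  also have "\<dots> \<le> H * C - E * (c / 4 * (\<kappa> * (max 1 x powr p - 1)))"
  proof (intro diff_left_mono mult_left_mono)
    show "c / 4 * (\<kappa> * (max 1 x powr p - 1)) \<le> (LINT \<sigma>|sphere_measure. b (m \<bullet> \<sigma>) * A \<sigma>)"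
    proof (cases "1 < x")
      case True
      have \<rho>: "0 < \<rho>" "\<rho> \<le> 1" using True by (auto simp: \<rho>_def min_le_iff_disj field_simps)
      \<comment> \<open>The two expressions in \<open>\<rho>\<close> cross at x = 2. Below, x \<rho>
        = x - 1 and \<rho> <= 1 permits lowering the exponent to 1 - s; above, x \<rho>^(1-s) = x^s,
        which dominates x^p because p <= s.\<close>
      have "max 1 x powr p - 1 \<le> x * \<rho> powr (1 - s)"
      proof (cases "x \<le> 2")
        case le2: True
        then have "\<rho> = 1 - 1 / x" using True by (simp add: \<rho>_def min_def field_simps)
        have "x powr p \<le> x powr 1" using True p s by (intro powr_mono) auto
        then have "max 1 x powr p - 1 \<le> x - 1" using True by simp
        also have "\<dots> = x * \<rho> powr 1" using True \<rho> by (simp add: \<open>\<rho> = 1 - 1 / x\<close> field_simps)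
        also have "\<dots> \<le> x * \<rho> powr (1 - s)"
          using x0 \<rho> s by (intro mult_left_mono powr_mono') auto
        finally show ?thesis .
      next
        case False
        then have "\<rho> = 1 / x" using True by (simp add: \<rho>_def min_def field_simps)
        have "max 1 x powr p - 1 \<le> x powr s"
        proof -
          have "x powr p \<le> x powr s" using True p by (intro powr_mono) auto
          then show ?thesis using True by (simp add: max_absorb2 del: powr_le_cancel_iff)
        qed
        also have "\<dots> = x powr 1 * x powr - (1 - s)" by (subst powr_add[symmetric]) simp
        also have "x powr - (1 - s) = \<rho> powr (1 - s)"
          unfolding \<open>\<rho> = 1 / x\<close> using x0 by (simp add: powr_divide powr_minus_divide del: minus_diff_eq)
        also have "x powr 1 * \<rho> powr (1 - s) = x * \<rho> powr (1 - s)"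
          using x0 by simp
        finally show ?thesis .
      qed
      then have "c / 4 * (\<kappa> * (max 1 x powr p - 1)) \<le> c / 4 * (\<kappa> * (x * \<rho> powr (1 - s)))"
        using c \<kappa> by (intro mult_left_mono) auto
      also have "\<dots> = \<kappa> * x / 4 * (c * \<rho> powr (1 - s))" by simp
      also have "\<dots> \<le> \<kappa> * x / 4 * (LINT \<sigma>|sphere_measure. b (m \<bullet> \<sigma>) * ((1 - m \<bullet> \<sigma>) / 2 * indicator {..\<rho>} ((1 - m \<bullet> \<sigma>) / 2)))"
        using c(2)[OF m \<rho>] \<kappa> x0 by (intro mult_left_mono) auto
      also have "\<dots> = (LINT \<sigma>|sphere_measure. b (m \<bullet> \<sigma>) * A \<sigma>)"
        using True by (subst integral_mult_right_zero[symmetric]) (simp add: A_def mult_ac)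
      finally show ?thesis .
    qed (simp add: A_def)
  qed (simp add: E_def)
  finally show ?thesis by (simp add: E_def x_def H_def mult_ac)
qed

text \<open>At the earliest contact the perturbed barrier minus the signed value of f is 0 after
  having been positive, so its time derivative cannot be positive; the collision estimate shows that
  it is.\<close>

theorem comparison:
  fixes f :: "real \<Rightarrow> real^3 \<Rightarrow> real"
  assumes \<mu>: "\<mu> > 0" and p: "0 < p" "p \<le> s" and \<kappa>: "0 < \<kappa>" "\<kappa> \<le> 1"
    and f1: "\<And>t \<xi>. 0 \<le> t \<Longrightarrow> \<bar>f t \<xi>\<bar> \<le> 1"
    and cont: "continuous_on ({0..} \<times> UNIV) (\<lambda>(t, \<xi>). f t \<xi>)"
    and int: "\<And>t \<xi>. 0 \<le> t \<Longrightarrow> \<xi> \<noteq> 0 \<Longrightarrow> integrable sphere_measure (\<lambda>\<sigma>. b ((\<xi> /\<^sub>R norm \<xi>) \<bullet> \<sigma>) *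
     (f t (pos_part \<xi> \<sigma>) * f t (neg_part \<xi> \<sigma>) - 1 * f t \<xi>))"
    and deriv: "\<And>t \<xi>. 0 < t \<Longrightarrow> \<xi> \<noteq> 0 \<Longrightarrow>
      ((\<lambda>t. f t \<xi>) has_real_derivative \<mu> * collision_rate (f t) 1 \<xi>) (at t)"
    and init: "\<And>\<xi>. \<bar>f 0 \<xi>\<bar> \<le> exp (- \<kappa> * min ((norm \<xi>)\<^sup>2) 1)"
  shows "\<exists>\<epsilon>>0. \<forall>t\<ge>0. \<forall>\<xi>. \<bar>f t \<xi>\<bar> \<le> exp (- \<kappa> * profile p (1 - exp (- \<epsilon> * t)) ((norm \<xi>)\<^sup>2))"
proof -
  obtain C where C0: "C \<ge> 0" and C: "\<And>m::real^3. norm m = 1 \<Longrightarrow> integrable sphere_measure (\<lambda>\<sigma>. b (m \<bullet> \<sigma>) * sqrt ((1 - m \<bullet> \<sigma>) / 2))"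
      "\<And>m::real^3. norm m = 1 \<Longrightarrow> (LINT \<sigma>|sphere_measure. b (m \<bullet> \<sigma>) * sqrt ((1 - m \<bullet> \<sigma>) / 2)) = C"
    using momentum_transfer by blast
  obtain c where c: "c > 0" "\<And>(m::real^3) \<rho>. norm m = 1 \<Longrightarrow> 0 < \<rho> \<Longrightarrow> \<rho> \<le> 1 \<Longrightarrow>
     c * \<rho> powr (1 - s) \<le>
       (LINT \<sigma>|sphere_measure. b (m \<bullet> \<sigma>) * ((1 - m \<bullet> \<sigma>) / 2 * indicator {..\<rho>} ((1 - m \<bullet> \<sigma>) / 2)))"
    using energy_transfer_lower_bound by blast
  \<comment> \<open>\<open>\<epsilon>\<close> is the rate of loss \<mu> c / 4 of
    \<open>collision_rate_at_barrier\<close>, so the barrier sinks no faster than the collisions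
    push f down.\<close>
  define \<epsilon> where "\<epsilon> = \<mu> * c / 4"
  have \<epsilon>: "\<epsilon> > 0" using \<mu> c by (simp add: \<epsilon>_def)
  define \<tau> where "\<tau> = (\<lambda>t::real. 1 - exp (- \<epsilon> * t))"
  have \<tau>: "0 \<le> \<tau> t" "\<tau> t \<le> 1" if "0 \<le> t" for t
    using that \<epsilon> by (auto simp: \<tau>_def)
  define E where "E = (\<lambda>t \<xi>::real^3. exp (- \<kappa> * profile p (\<tau> t) ((norm \<xi>)\<^sup>2)))"
  \<comment> \<open>The linear term costs \<mu> C per unit time; the additional 1 makes the final
    inequality strict.\<close>
  define L where "L = \<mu> * C + 1"
  have strict: "\<bar>f t\<^sub>1 \<xi>\<^sub>1\<bar> < E t\<^sub>1 \<xi>\<^sub>1 + \<delta> * exp (L * t\<^sub>1) * norm \<xi>\<^sub>1"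
    if \<delta>: "\<delta> > 0" and t\<^sub>1: "0 \<le> t\<^sub>1" and \<xi>\<^sub>1: "\<xi>\<^sub>1 \<noteq> 0" for \<delta> t\<^sub>1 \<xi>\<^sub>1
  proof (rule ccontr)
    assume viol: "\<not> ?thesis"
    define B where "B = (\<lambda>t \<xi>. E t \<xi> + \<delta> * exp (L * t) * norm \<xi>)"
    have B0: "0 < B t \<xi>" for t \<xi> using \<delta> by (simp add: B_def E_def add_pos_nonneg)
    have B\<delta>: "E t \<xi> + \<delta> * norm \<xi> \<le> B t \<xi>" if "0 \<le> t" for t \<xi>
    proof -
      have "1 \<le> exp (L * t)" using that C0 \<mu> by (simp add: L_def)
      then have "\<delta> * norm \<xi> * 1 \<le> \<delta> * norm \<xi> * exp (L * t)" using \<delta> by (intro mult_left_mono) auto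
      then show ?thesis by (simp add: B_def mult_ac)
    qed
    \<comment> \<open>Near the origin \<open>E\<close> is at least 1 - \<kappa> r^2 and the linear
      term \<delta> r beats r^2; far out \<delta> |\<xi>| alone exceeds 1. Violations thus live in a
      compact annulus that avoids 0.\<close>
    have range: "min 1 \<delta> \<le> norm \<xi> \<and> norm \<xi> \<le> 1 / \<delta>" if "0 \<le> t" "\<xi> \<noteq> 0" "B t \<xi> \<le> \<bar>f t \<xi>\<bar>" for t \<xi>
    proof (rule ccontr)
      assume "\<not> ?thesis"
      then consider "norm \<xi> < min 1 \<delta>" | "1 / \<delta> < norm \<xi>" by linarith
      then have "1 < E t \<xi> + \<delta> * norm \<xi>"
      proof cases
        case 1
        define r where "r = norm \<xi>"
        have r: "0 < r" "r < 1" "r < \<delta>" using 1 that by (auto simp: r_def)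
        have r2: "r\<^sup>2 \<le> 1" using r by (simp add: abs_square_le_1)
        have "\<kappa> * r\<^sup>2 \<le> r\<^sup>2" using \<kappa> by (intro mult_left_le_one_le) auto
        also have "r\<^sup>2 < \<delta> * r" using r by (simp add: power2_eq_square)
        finally have "1 < 1 + - (\<kappa> * r\<^sup>2) + \<delta> * r" by simp
        also have "1 + - (\<kappa> * r\<^sup>2) \<le> exp (- (\<kappa> * r\<^sup>2))" by (rule exp_ge_add_one_self)
        finally show ?thesis using r2 by (simp add: E_def profile_def r_def)
      next
        case 2
        then have "1 < \<delta> * norm \<xi>" using \<delta> by (simp add: field_simps)
        moreover have "0 < E t \<xi>" by (simp add: E_def)
        ultimately show ?thesis by linarith
      qed
      then show False using B\<delta>[OF that(1), of \<xi>] f1[OF that(1), of \<xi>] that(3) by linarith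
    qed
    define Z where "Z = {z \<in> {0..t\<^sub>1} \<times> (cball 0 (1 / \<delta>) - ball 0 (min 1 \<delta>)). 0 \<le> \<bar>f (fst z) (snd z)\<bar> - B (fst z) (snd z)}"
    have cB: "continuous_on UNIV (\<lambda>z. B (fst z) (snd z))"
    proof -
      show ?thesis
        unfolding B_def E_def \<tau>_def profile_def by (intro continuous_intros) (auto simp: max_def)
    qed
    have cf: "continuous_on ({0..t\<^sub>1} \<times> (cball 0 (1 / \<delta>) - ball 0 (min 1 \<delta>))) (\<lambda>z. f (fst z) (snd z))"
      by (rule continuous_on_subset[OF cont[unfolded case_prod_beta]]) auto
    have cK: "compact ({0..t\<^sub>1} \<times> (cball (0::real^3) (1 / \<delta>) - ball 0 (min 1 \<delta>)))"
      by (intro compact_Times compact_Icc compact_diff compact_cball open_ball)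
    have "compact Z"
    proof -
      have "closed Z" unfolding Z_def
        by (intro continuous_on_closed_Collect_le continuous_on_const continuous_on_diff continuous_on_rabs
            cf continuous_on_subset[OF cB] compact_imp_closed[OF cK] subset_UNIV)
      then have "compact (({0..t\<^sub>1} \<times> (cball 0 (1 / \<delta>) - ball 0 (min 1 \<delta>))) \<inter> Z)"
        by (rule compact_Int_closed[OF cK])
      moreover have "({0..t\<^sub>1} \<times> (cball 0 (1 / \<delta>) - ball 0 (min 1 \<delta>))) \<inter> Z = Z"
        by (auto simp: Z_def)
      ultimately show ?thesis by simp
    qed
    moreover have inZ: "(t, \<xi>) \<in> Z" if "0 \<le> t" "t \<le> t\<^sub>1" "\<xi> \<noteq> 0" "B t \<xi> \<le> \<bar>f t \<xi>\<bar>" for t \<xi>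
      using range[OF that(1,3,4)] that by (auto simp: Z_def not_less min_le_iff_disj)
    moreover have "(t\<^sub>1, \<xi>\<^sub>1) \<in> Z"
      using viol t\<^sub>1 \<xi>\<^sub>1 by (intro inZ) (auto simp: B_def)
    ultimately have "compact Z" "Z \<noteq> {}" by auto
    then obtain z where z: "z \<in> Z" "\<And>y. y \<in> Z \<Longrightarrow> fst z \<le> fst y"
      using continuous_attains_inf[OF _ _ continuous_on_fst[OF continuous_on_id], of Z] by blast
    obtain t \<xi> where zt: "z = (t, \<xi>)" by (cases z)
    have t: "0 \<le> t" "t \<le> t\<^sub>1" and tB: "B t \<xi> \<le> \<bar>f t \<xi>\<bar>" and "min 1 \<delta> \<le> norm \<xi>"
      using z(1) by (auto simp: Z_def zt)
    then have \<xi>: "\<xi> \<noteq> 0" using \<delta> by auto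
    have before: "\<bar>f r \<eta>\<bar> < B r \<eta>" if "0 \<le> r" "r < t" "\<eta> \<noteq> 0" for r \<eta>
      using z(2)[of "(r, \<eta>)"] inZ[of r \<eta>] that t by (fastforce simp: zt not_le)
    have t0: "0 < t"
    proof (rule ccontr)
      assume "\<not> 0 < t"
      then have "t = 0" using t by simp
      have "E 0 \<xi> = exp (- \<kappa> * min ((norm \<xi>)\<^sup>2) 1)" by (simp add: E_def \<tau>_def profile_def)
      moreover have "E 0 \<xi> < B 0 \<xi>" using \<delta> \<xi> by (simp add: B_def)
      ultimately show False using init[of \<xi>] tB \<open>t = 0\<close> by simp
    qed
    \<comment> \<open>The bound is needed at every frequency, since the collision rate at \<xi>
      samples other ones; it is inherited from earlier times by continuity.\<close>
    have at: "\<bar>f t \<eta>\<bar> \<le> B t \<eta>" for \<eta>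
    proof (cases "\<eta> = 0")
      case True
      then show ?thesis using f1[OF t(1), of \<eta>] by (simp add: B_def E_def profile_def)
    next
      case False
      have "((\<lambda>r. \<bar>f r \<eta>\<bar> - B r \<eta>) \<longlongrightarrow> \<bar>f t \<eta>\<bar> - B t \<eta>) (at_left t)"
      proof -
        have "isCont (\<lambda>r. f r \<eta>) t" using deriv[OF t0 False] by (rule DERIV_isCont)
        moreover have "isCont (\<lambda>r. B r \<eta>) t"
          using continuous_on_compose2[OF cB, of UNIV "\<lambda>r. (r, \<eta>)"]
          by (auto simp: continuous_on_eq_continuous_at intro!: continuous_intros)
        ultimately have "isCont (\<lambda>r. \<bar>f r \<eta>\<bar> - B r \<eta>) t" by (intro continuous_intros) auto
        then show ?thesis by (simp add: continuous_at_imp_continuous_at_within continuous_within[symmetric] isCont_def filterlim_at_split)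
      qed
      moreover have "\<forall>\<^sub>F r in at_left t. \<bar>f r \<eta>\<bar> - B r \<eta> \<le> 0"
        unfolding eventually_at_left_field using t0 before[OF _ _ False]
        by (intro exI[of _ 0]) (auto intro: less_imp_le)
      ultimately have "\<bar>f t \<eta>\<bar> - B t \<eta> \<le> 0"
        by (intro tendsto_upperbound[where F = "at_left t"]) auto
      then show ?thesis by simp
    qed
    then have teq: "\<bar>f t \<xi>\<bar> = B t \<xi>" using tB by (simp add: antisym)
    \<comment> \<open>The sign treats contact with the barrier and with its negative at
      once.\<close>
    define sg where "sg = sgn (f t \<xi>)"
    have "f t \<xi> \<noteq> 0" using teq B0[of t \<xi>] by auto
    then have sg: "\<bar>sg\<bar> = 1" "sg * f t \<xi> = B t \<xi>"
      using teq by (auto simp: sg_def abs_sgn_eq mult.commute abs_sgn[symmetric])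
    define G where "G = \<delta> * exp (L * t)"
    define R where "R = max 1 ((norm \<xi>)\<^sup>2) powr p - 1"
    have R: "0 \<le> R" using p by (simp add: R_def ge_one_powr_ge_zero)
    define D where "D = (- \<kappa> * (\<epsilon> * exp (- \<epsilon> * t) * R)) * E t \<xi> + L * (G * norm \<xi>) - sg * (\<mu> * collision_rate (f t) 1 \<xi>)"
    have "((\<lambda>r. B r \<xi> - sg * f r \<xi>) has_real_derivative D) (at t)"
    proof -
      have "((\<lambda>r. B r \<xi>) has_real_derivative (- \<kappa> * (\<epsilon> * exp (- \<epsilon> * t) * R)) * E t \<xi> + L * (G * norm \<xi>)) (at t)"
        unfolding B_def E_def \<tau>_def profile_def R_def G_def
        by (auto intro!: derivative_eq_intros simp: mult_ac)
      then show ?thesis unfolding D_def by (intro DERIV_diff DERIV_cmult deriv t0 \<xi>)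
    qed
    moreover have "0 < D"
    proof -
      have "sg * collision_rate (f t) 1 \<xi> \<le> C * (G * norm \<xi>) - c / 4 * (\<kappa> * exp (- \<kappa> * profile p (\<tau> t) ((norm \<xi>)\<^sup>2)) * (max 1 ((norm \<xi>)\<^sup>2) powr p - 1))"
        using at sg(2) \<delta> by (intro collision_rate_at_barrier[OF C c p \<tau>(1)[OF t(1)] \<tau>(2)[OF t(1)] \<kappa> _ sg(1) \<xi> f1[OF t(1)] _ _ int[OF t(1) \<xi>]])
          (auto simp: G_def B_def E_def)
      then have "sg * collision_rate (f t) 1 \<xi> \<le> C * (G * norm \<xi>) - c / 4 * (\<kappa> * E t \<xi> * R)"
        by (simp add: E_def R_def)
      then have "\<mu> * (sg * collision_rate (f t) 1 \<xi>) \<le> \<mu> * (C * (G * norm \<xi>) - c / 4 * (\<kappa> * E t \<xi> * R))"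
        using \<mu> by (intro mult_left_mono) auto
      also have "\<dots> = \<mu> * C * (G * norm \<xi>) - \<epsilon> * (\<kappa> * E t \<xi> * R)"
        by (simp add: \<epsilon>_def algebra_simps)
      finally have 1: "sg * (\<mu> * collision_rate (f t) 1 \<xi>) \<le> \<mu> * C * (G * norm \<xi>) - \<epsilon> * (\<kappa> * E t \<xi> * R)"
        by (simp add: mult_ac)
      have "\<epsilon> * (\<kappa> * E t \<xi> * R) * exp (- \<epsilon> * t) \<le> \<epsilon> * (\<kappa> * E t \<xi> * R) * 1"
        using \<epsilon> \<kappa> R t by (intro mult_left_mono) (auto simp: E_def)
      moreover have "0 < G * norm \<xi>" using \<delta> \<xi> by (simp add: G_def)
      ultimately show ?thesis using 1 by (simp add: D_def L_def algebra_simps)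
    qed
    \<comment> \<open>A positive derivative forces B - sg f below its contact value 0 slightly
      earlier, contradicting \<open>before\<close>.\<close>
    ultimately obtain d where d: "d > 0" "\<And>h. 0 < h \<Longrightarrow> h < d \<Longrightarrow> B (t - h) \<xi> - sg * f (t - h) \<xi> < B t \<xi> - sg * f t \<xi>"
      using DERIV_pos_inc_left by blast
    define h where "h = min (d / 2) (t / 2)"
    have h: "0 < h" "h < d" "0 \<le> t - h" "t - h < t" using d t0 by (auto simp: h_def)
    have "sg * f (t - h) \<xi> \<le> \<bar>f (t - h) \<xi>\<bar>"
      using sg(1) abs_ge_self[of "sg * f (t - h) \<xi>"] by (simp add: abs_mult)
    then show False
      using d(2)[OF h(1,2)] before[OF h(3,4) \<xi>] sg(2) by linarith
  qed
  have "\<bar>f t \<xi>\<bar> \<le> E t \<xi>" if t: "0 \<le> t" for t \<xi>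
  proof (cases "\<xi> = 0")
    case True
    then show ?thesis using f1[OF t] by (simp add: E_def profile_def)
  next
    case False
    show ?thesis
    proof (rule field_le_epsilon)
      fix e :: real assume e: "0 < e"
      define \<delta> where "\<delta> = e / (exp (L * t) * norm \<xi>)"
      have "\<delta> > 0" using e False by (simp add: \<delta>_def)
      from strict[OF this t False] show "\<bar>f t \<xi>\<bar> \<le> E t \<xi> + e"
        using False by (simp add: \<delta>_def)
    qed
  qed
  then show ?thesis
    using \<epsilon> unfolding E_def \<tau>_def by blast
qed

end

section \<open>Gaussian regularization and Gevrey regularity\<close>

lemma integral_lborel_prod:
  fixes f :: "'a::euclidean_space \<Rightarrow> real \<Rightarrow> 'b::{real_normed_field,banach,second_countable_topology}"
  assumes f: "\<And>b. b \<in> Basis \<Longrightarrow> integrable lborel (f b)"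
  shows "integrable lborel (\<lambda>x::'a. \<Prod>b\<in>Basis. f b (x \<bullet> b))" (is ?I)
    and "(LINT x::'a|lborel. (\<Prod>b\<in>Basis. f b (x \<bullet> b))) = (\<Prod>b\<in>Basis. LINT x|lborel. f b x)" (is ?E)
proof -
  interpret finite_product_sigma_finite "\<lambda>_::'a. lborel :: real measure" Basis
    by standard simp
  have [measurable]: "f b \<in> borel_measurable borel" if "b \<in> Basis" for b
    using borel_measurable_integrable[OF f[OF that]] by simp
  have eq: "(\<Prod>b\<in>Basis. f b ((\<Sum>b\<in>Basis. g b *\<^sub>R b) \<bullet> b)) = (\<Prod>b\<in>Basis. f b (g b))" for g :: "'a \<Rightarrow> real"
    by (intro prod.cong) auto
  show ?I
    by (subst lborel_eq, subst integrable_distr_eq) (auto simp: eq intro!: product_integrable_prod f)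
  show ?E
    by (subst lborel_eq, subst integral_distr) (auto simp: eq intro!: product_integral_prod f)
qed

text \<open>Rescaling x by sqrt \<delta> reduces this to the characteristic function of the standard
  normal distribution.\<close>

lemma gaussian_real:
  fixes \<delta> t :: real
  assumes d: "\<delta> > 0"
  shows "integrable lborel (\<lambda>x. complex_of_real (exp (- \<delta> * x\<^sup>2 / 2)) * iexp (t * x))"
    and "(CLINT x|lborel. complex_of_real (exp (- \<delta> * x\<^sup>2 / 2)) * iexp (t * x)) = complex_of_real (sqrt (2 * pi / \<delta>) * exp (- t\<^sup>2 / (2 * \<delta>)))"
proof -
  let ?f = "\<lambda>x. std_normal_density x *\<^sub>R iexp (t / sqrt \<delta> * x)"
  have f: "integrable lborel ?f"
    by (rule Bochner_Integration.integrable_bound[OF integrable_normal_density[of 1 0]]) auto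
  have eq: "?f (0 + sqrt \<delta> * x) = complex_of_real (1 / sqrt (2 * pi)) * (complex_of_real (exp (- \<delta> * x\<^sup>2 / 2)) * iexp (t * x))" for x
    using d by (simp add: std_normal_density_def power_mult_distrib scaleR_conv_of_real mult_ac)
  show "integrable lborel (\<lambda>x. complex_of_real (exp (- \<delta> * x\<^sup>2 / 2)) * iexp (t * x))"
  proof -
    have "complex_integrable lborel (\<lambda>x. complex_of_real (1 / sqrt (2 * pi)) * (complex_of_real (exp (- \<delta> * x\<^sup>2 / 2)) * iexp (t * x)))"
      using lborel_integrable_real_affine[OF f, of "sqrt \<delta>" 0] d unfolding eq by simp
    moreover have "complex_of_real (sqrt (2 * pi)) * (complex_of_real (1 / sqrt (2 * pi)) * z) = z" for z
      by simp
    ultimately show ?thesis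
      using integrable_mult_right[of "complex_of_real (sqrt (2 * pi))" lborel
          "\<lambda>x. complex_of_real (1 / sqrt (2 * pi)) * (complex_of_real (exp (- \<delta> * x\<^sup>2 / 2)) * iexp (t * x))"] by (simp only: )
  qed
  have "complex_of_real (exp (- (t / sqrt \<delta>)\<^sup>2 / 2)) = (CLINT x|lborel. ?f x)"
    using fun_cong[OF char_std_normal_distribution, of "t / sqrt \<delta>"] unfolding char_def
    by (subst (asm) integral_density) auto
  also have "\<dots> = \<bar>sqrt \<delta>\<bar> *\<^sub>R (CLINT x|lborel. ?f (0 + sqrt \<delta> * x))"
    using d by (intro lborel_integral_real_affine) auto
  also have "\<dots> = complex_of_real (sqrt \<delta> / sqrt (2 * pi)) * (CLINT x|lborel. complex_of_real (exp (- \<delta> * x\<^sup>2 / 2)) * iexp (t * x))"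
    unfolding eq using d by (simp add: scaleR_conv_of_real)
  finally have "complex_of_real (exp (- (t / sqrt \<delta>)\<^sup>2 / 2)) =
      complex_of_real (sqrt \<delta> / sqrt (2 * pi)) * (CLINT x|lborel. complex_of_real (exp (- \<delta> * x\<^sup>2 / 2)) * iexp (t * x))" .
  then have "(CLINT x|lborel. complex_of_real (exp (- \<delta> * x\<^sup>2 / 2)) * iexp (t * x)) =
      complex_of_real (exp (- (t / sqrt \<delta>)\<^sup>2 / 2)) / complex_of_real (sqrt \<delta> / sqrt (2 * pi))"
    using d by (simp add: field_simps)
  also have "\<dots> = complex_of_real (exp (- (t / sqrt \<delta>)\<^sup>2 / 2) / (sqrt \<delta> / sqrt (2 * pi)))"
    by (simp only: of_real_divide)
  also have "exp (- (t / sqrt \<delta>)\<^sup>2 / 2) / (sqrt \<delta> / sqrt (2 * pi)) = sqrt (2 * pi / \<delta>) * exp (- t\<^sup>2 / (2 * \<delta>))"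
    using d by (simp add: real_sqrt_divide power_divide mult.commute)
  finally show "(CLINT x|lborel. complex_of_real (exp (- \<delta> * x\<^sup>2 / 2)) * iexp (t * x)) = complex_of_real (sqrt (2 * pi / \<delta>) * exp (- t\<^sup>2 / (2 * \<delta>)))" .
qed

definition gauss :: "real \<Rightarrow> 'a::euclidean_space \<Rightarrow> real" where
  "gauss \<delta> v = exp (- \<delta> * (norm v)\<^sup>2 / 2)"

lemma gauss_measurable [measurable]: "gauss \<delta> \<in> borel_measurable borel"
  unfolding gauss_def by measurable

lemma gauss_bounds: "0 < gauss \<delta> v" "\<delta> \<ge> 0 \<Longrightarrow> gauss \<delta> v \<le> 1"
  by (auto simp: gauss_def)

lemma gaussian_fourier:
  fixes \<zeta> :: "'a::euclidean_space"
  assumes d: "\<delta> > 0"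
  shows "integrable lborel (\<lambda>v::'a. gauss \<delta> v)"
    and "(LINT v|lborel. gauss \<delta> v * cos (v \<bullet> \<zeta>)) = sqrt (2 * pi / \<delta>) ^ DIM('a) * gauss (1 / \<delta>) \<zeta>"
proof -
  have sq: "(norm v)\<^sup>2 = (\<Sum>b\<in>Basis. (v \<bullet> b)\<^sup>2)" for v :: 'a
    unfolding power2_norm_eq_inner by (subst euclidean_inner) (simp add: power2_eq_square)
  have prod: "(\<Prod>b\<in>Basis. complex_of_real (exp (- \<delta> * (v \<bullet> b)\<^sup>2 / 2)) * iexp ((\<zeta> \<bullet> b) * (v \<bullet> b))) = of_real (gauss \<delta> v) * iexp (v \<bullet> \<zeta>)" for v \<zeta> :: 'a
  proof -
    have "(\<Prod>b\<in>Basis. complex_of_real (exp (- \<delta> * (v \<bullet> b)\<^sup>2 / 2))) = of_real (exp (\<Sum>b\<in>Basis. - \<delta> * (v \<bullet> b)\<^sup>2 / 2))"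
      by (simp only: exp_sum[OF finite_Basis] of_real_prod)
    also have "(\<Sum>b\<in>Basis. - \<delta> * (v \<bullet> b)\<^sup>2 / 2) = - \<delta> * (norm v)\<^sup>2 / 2"
      by (simp add: sq sum_distrib_left sum_divide_distrib sum_negf)
    finally have 1: "(\<Prod>b\<in>Basis. complex_of_real (exp (- \<delta> * (v \<bullet> b)\<^sup>2 / 2))) = of_real (gauss \<delta> v)"
      by (simp add: gauss_def)
    have "(\<Prod>b\<in>Basis. iexp ((\<zeta> \<bullet> b) * (v \<bullet> b))) = exp (\<Sum>b\<in>Basis. \<i> * complex_of_real ((\<zeta> \<bullet> b) * (v \<bullet> b)))"
      by (simp only: exp_sum[OF finite_Basis])
    also have "(\<Sum>b\<in>Basis. \<i> * complex_of_real ((\<zeta> \<bullet> b) * (v \<bullet> b))) = \<i> * complex_of_real (v \<bullet> \<zeta>)"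
      by (subst (3) euclidean_inner) (simp add: sum_distrib_left mult_ac)
    finally have 2: "(\<Prod>b\<in>Basis. iexp ((\<zeta> \<bullet> b) * (v \<bullet> b))) = iexp (v \<bullet> \<zeta>)" .
    show ?thesis unfolding prod.distrib 1 2 ..
  qed
  note I = integral_lborel_prod[of "\<lambda>b x. complex_of_real (exp (- \<delta> * x\<^sup>2 / 2)) * iexp ((\<eta> \<bullet> b) * x)" for \<eta> :: 'a, unfolded prod]
  have i: "integrable lborel (\<lambda>v::'a. complex_of_real (gauss \<delta> v) * iexp (v \<bullet> \<eta>))" for \<eta>
    by (rule I(1)[of \<eta>]) (rule gaussian_real(1)[OF d])
  from integrable_Re[OF i[of 0]] show "integrable lborel (\<lambda>v::'a. gauss \<delta> v)"
    by simp
  have "(CLINT v|lborel. complex_of_real (gauss \<delta> v) * iexp (v \<bullet> \<zeta>)) = (\<Prod>b\<in>Basis. complex_of_real (sqrt (2 * pi / \<delta>) * exp (- (\<zeta> \<bullet> b)\<^sup>2 / (2 * \<delta>))))"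
    by (subst I(2)) (simp_all only: gaussian_real[OF d])
  also have "\<dots> = complex_of_real (sqrt (2 * pi / \<delta>) ^ DIM('a) * exp (\<Sum>b\<in>Basis. - (\<zeta> \<bullet> b)\<^sup>2 / (2 * \<delta>)))"
    by (simp only: prod.distrib of_real_prod[symmetric] prod_constant exp_sum[OF finite_Basis])
  also have "(\<Sum>b\<in>Basis. - (\<zeta> \<bullet> b)\<^sup>2 / (2 * \<delta>)) = - (1 / \<delta>) * (norm \<zeta>)\<^sup>2 / 2"
    by (simp add: sq sum_divide_distrib sum_negf mult.commute)
  finally have "Re (CLINT v|lborel. complex_of_real (gauss \<delta> v) * iexp (v \<bullet> \<zeta>)) = sqrt (2 * pi / \<delta>) ^ DIM('a) * gauss (1 / \<delta>) \<zeta>"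
    by (simp add: gauss_def)
  moreover have "Re (CLINT v|lborel. complex_of_real (gauss \<delta> v) * iexp (v \<bullet> \<zeta>)) = (LINT v|lborel. gauss \<delta> v * cos (v \<bullet> \<zeta>))"
    by (subst integral_Re[symmetric, OF i]) (simp add: Re_exp)
  ultimately show "(LINT v|lborel. gauss \<delta> v * cos (v \<bullet> \<zeta>)) = sqrt (2 * pi / \<delta>) ^ DIM('a) * gauss (1 / \<delta>) \<zeta>"
    by simp
qed

lemma gaussian_mass: "\<delta> > 0 \<Longrightarrow> (LINT v::'a::euclidean_space|lborel. gauss \<delta> v) = sqrt (2 * pi / \<delta>) ^ DIM('a)"
  using gaussian_fourier(2)[of \<delta> "0::'a"] by (simp add: gauss_def)

lemma integral_lborel_shift:
  fixes f :: "'a::euclidean_space \<Rightarrow> 'b::{banach, second_countable_topology}"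
  assumes "f \<in> borel_measurable borel"
  shows "(LINT x|lborel. f (c + x)) = (LINT x|lborel. f x)"
proof -
  have "(LINT x|lborel. f x) = (LINT x|distr lborel borel ((+) c). f x)" by (simp add: lborel_distr_plus)
  then show ?thesis using assms by (simp add: integral_distr)
qed

lemma integrable_lborel_shift:
  fixes f :: "'a::euclidean_space \<Rightarrow> 'b::{banach, second_countable_topology}"
  assumes "integrable lborel f"
  shows "integrable lborel (\<lambda>x. f (c + x))"
proof -
  note [measurable] = borel_measurable_integrable[OF assms]
  have "integrable (distr lborel borel ((+) c)) f" using assms by (simp add: lborel_distr_plus)
  then show ?thesis by (simp add: integrable_distr_eq)
qed

lemma (in pair_sigma_finite) product_integral_mult:
  fixes f g :: "_ \<Rightarrow> real"
  assumes f: "integrable M1 f" and g: "integrable M2 g"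
  shows "integrable (M1 \<Otimes>\<^sub>M M2) (\<lambda>z. f (fst z) * g (snd z))"
    and "(LINT z|(M1 \<Otimes>\<^sub>M M2). f (fst z) * g (snd z)) = (LINT x|M1. f x) * (LINT y|M2. g y)"
proof -
  note [measurable] = borel_measurable_integrable[OF f] borel_measurable_integrable[OF g]
  show i: "integrable (M1 \<Otimes>\<^sub>M M2) (\<lambda>z. f (fst z) * g (snd z))"
  proof (rule Fubini_integrable)
    show "integrable M1 (\<lambda>x. LINT y|M2. norm (f (fst (x, y)) * g (snd (x, y))))"
      using f by (simp add: abs_mult)
    show "AE x in M1. integrable M2 (\<lambda>y. f (fst (x, y)) * g (snd (x, y)))"
      using g by simp
  qed measurable
  show "(LINT z|(M1 \<Otimes>\<^sub>M M2). f (fst z) * g (snd z)) = (LINT x|M1. f x) * (LINT y|M2. g y)"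
    using integral_fst'[OF i] by simp
qed

lemma integral_lborel_reflect:
  fixes f :: "'a::euclidean_space \<Rightarrow> 'b::{banach, second_countable_topology}"
  assumes "f \<in> borel_measurable borel"
  shows "(LINT x|lborel. f (c - x)) = (LINT x|lborel. f x)"
proof -
  have "(lborel :: 'a measure) = distr lborel borel (\<lambda>x. c - x)"
    using lborel_affine[of "-1" c] by (simp add: density_1)
  then have "(LINT x|lborel. f x) = (LINT x|distr lborel borel (\<lambda>x. c - x). f x)" by simp
  then show ?thesis using assms by (simp add: integral_distr)
qed

lemma integrable_lborel_reflect:
  fixes f :: "'a::euclidean_space \<Rightarrow> 'b::{banach, second_countable_topology}"
  assumes "integrable lborel f"
  shows "integrable lborel (\<lambda>x. f (c - x))"
proof -
  note [measurable] = borel_measurable_integrable[OF assms]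
  have "(lborel :: 'a measure) = distr lborel borel (\<lambda>x. c - x)"
    using lborel_affine[of "-1" c] by (simp add: density_1)
  then have "integrable (distr lborel borel (\<lambda>x. c - x)) f" using assms by simp
  then show ?thesis by (simp add: integrable_distr_eq)
qed

text \<open>With a Gaussian weight \<open>gauss \<delta>\<close>, the double integral over frequencies
  has the positive kernel \<open>gauss (1/\<delta>) (\<xi> - \<eta>)\<close>, whose marginals do not depend on \<open>\<delta>\<close>, and \<open>F(\<xi>)F(\<eta>)\<close> is estimated by AM-GM.\<close>

lemma plancherel_le:
  fixes F :: "'a::euclidean_space \<Rightarrow> real" and \<alpha> :: real
  assumes F: "integrable lborel F" and F2: "integrable lborel (\<lambda>\<xi>. (F \<xi>)\<^sup>2)"
  defines "W \<equiv> \<lambda>v. LINT \<xi>|lborel. F \<xi> * cos (\<xi> \<bullet> v + \<alpha>)"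
  shows "integrable lborel (\<lambda>v. (W v)\<^sup>2)"
    and "(LINT v|lborel. (W v)\<^sup>2) \<le> (2 * pi) ^ DIM('a) * (LINT \<xi>|lborel. (F \<xi>)\<^sup>2)"
    and "W \<in> borel_measurable borel"
proof -
  have [measurable]: "F \<in> borel_measurable borel" using borel_measurable_integrable[OF F] by simp
  show W [measurable]: "W \<in> borel_measurable borel" unfolding W_def by measurable
  define Fc where "Fc v = (LINT \<xi>|lborel. F \<xi> * cos (\<xi> \<bullet> v))" for v
  define Fs where "Fs v = (LINT \<xi>|lborel. F \<xi> * sin (\<xi> \<bullet> v))" for v
  have ic: "integrable lborel (\<lambda>\<xi>. F \<xi> * cos (\<xi> \<bullet> v))" and isn: "integrable lborel (\<lambda>\<xi>. F \<xi> * sin (\<xi> \<bullet> v))" for v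
    by (rule Bochner_Integration.integrable_bound[OF F]; simp add: abs_mult mult_left_le)+
  have [measurable]: "Fc \<in> borel_measurable borel" "Fs \<in> borel_measurable borel" unfolding Fc_def Fs_def by measurable
  define P where "P v = (Fc v)\<^sup>2 + (Fs v)\<^sup>2" for v
  have [measurable]: "P \<in> borel_measurable borel" unfolding P_def by measurable
  have P0: "0 \<le> P v" for v by (simp add: P_def)
  \<comment> \<open>\<open>W\<close> is one coordinate of (Fc, Fs) after a rotation by \<alpha>, so
    its square is at most P for every phase. The free phase lets the same inequality serve
    derivatives of all orders.\<close>
  have WP: "(W v)\<^sup>2 \<le> P v" for v
  proof -
    have "W v = (LINT \<xi>|lborel. cos \<alpha> * (F \<xi> * cos (\<xi> \<bullet> v)) - sin \<alpha> * (F \<xi> * sin (\<xi> \<bullet> v)))"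
      unfolding W_def by (intro Bochner_Integration.integral_cong) (auto simp: cos_add algebra_simps)
    also have "\<dots> = cos \<alpha> * Fc v - sin \<alpha> * Fs v"
      unfolding Fc_def Fs_def by (subst Bochner_Integration.integral_diff) (auto intro!: ic isn)
    finally have "(W v)\<^sup>2 = (cos \<alpha> * Fc v - sin \<alpha> * Fs v)\<^sup>2" by simp
    also have "\<dots> \<le> (cos \<alpha> * Fc v - sin \<alpha> * Fs v)\<^sup>2 + (sin \<alpha> * Fc v + cos \<alpha> * Fs v)\<^sup>2" by simp
    also have "\<dots> = ((sin \<alpha>)\<^sup>2 + (cos \<alpha>)\<^sup>2) * P v"
      unfolding P_def by (simp add: power2_eq_square algebra_simps
          del: sin_cos_squared_add sin_cos_squared_add2 sin_cos_squared_add3)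
    finally show ?thesis by simp
  qed
  have Q: "integrable (lborel \<Otimes>\<^sub>M lborel) (\<lambda>z. F (fst z) * F (snd z))"
    by (rule lborel_pair.product_integral_mult(1)[OF F F])
  have PQ: "P v = (LINT z|(lborel \<Otimes>\<^sub>M lborel). F (fst z) * F (snd z) * cos (v \<bullet> (fst z - snd z)))" for v
  proof -
    have "P v = (LINT z|(lborel \<Otimes>\<^sub>M lborel). F (fst z) * cos (fst z \<bullet> v) * (F (snd z) * cos (snd z \<bullet> v))) +
        (LINT z|(lborel \<Otimes>\<^sub>M lborel). F (fst z) * sin (fst z \<bullet> v) * (F (snd z) * sin (snd z \<bullet> v)))"
      using lborel_pair.product_integral_mult(2)[OF ic ic, of v v] lborel_pair.product_integral_mult(2)[OF isn isn, of v v]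
      by (simp add: P_def Fc_def Fs_def power2_eq_square)
    also have "\<dots> = (LINT z|(lborel \<Otimes>\<^sub>M lborel). F (fst z) * cos (fst z \<bullet> v) * (F (snd z) * cos (snd z \<bullet> v)) +
        F (fst z) * sin (fst z \<bullet> v) * (F (snd z) * sin (snd z \<bullet> v)))"
      by (rule Bochner_Integration.integral_add[symmetric];
          rule lborel_pair.product_integral_mult(1)[OF ic ic] lborel_pair.product_integral_mult(1)[OF isn isn])
    also have "\<dots> = (LINT z|(lborel \<Otimes>\<^sub>M lborel). F (fst z) * F (snd z) * cos (v \<bullet> (fst z - snd z)))"
      by (intro Bochner_Integration.integral_cong)
         (auto simp: inner_diff_right cos_diff inner_commute algebra_simps)
    finally show ?thesis .
  qed
  have bound: "integrable lborel (\<lambda>v. gauss \<delta> v * P v)"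
     "(LINT v|lborel. gauss \<delta> v * P v) \<le> (2 * pi) ^ DIM('a) * (LINT \<xi>|lborel. (F \<xi>)\<^sup>2)" if d: "\<delta> > 0" for \<delta>
  proof -
    define H where "H z v = gauss \<delta> v * (F (fst z) * F (snd z) * cos (v \<bullet> (fst z - snd z)))" for z :: "'a \<times> 'a" and v
    have H: "integrable (lborel \<Otimes>\<^sub>M lborel) (\<lambda>(z, v). H z v)"
    proof (rule Bochner_Integration.integrable_bound)
      show "integrable (lborel \<Otimes>\<^sub>M lborel) (\<lambda>y::('a \<times> 'a) \<times> 'a. (F (fst (fst y)) * F (snd (fst y))) * gauss \<delta> (snd y))"
        by (rule lborel_pair.product_integral_mult(1)) (use Q gaussian_fourier(1)[OF d] in \<open>simp_all add: lborel_prod\<close>)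
      show "AE y in lborel \<Otimes>\<^sub>M lborel. norm (case y of (z, v) \<Rightarrow> H z v) \<le> norm ((F (fst (fst y)) * F (snd (fst y))) * gauss \<delta> (snd y))"
        by (rule AE_I2) (auto simp: H_def abs_mult mult_ac intro!: mult_left_mono mult_left_le)
      show "(\<lambda>(z, v). H z v) \<in> borel_measurable (lborel \<Otimes>\<^sub>M lborel)"
      proof -
        have "fst \<in> borel_measurable (borel :: ('a \<times> 'a) measure)" "snd \<in> borel_measurable (borel :: ('a \<times> 'a) measure)"
          by (simp_all add: borel_measurable_continuous_onI continuous_on_fst continuous_on_snd)
        note [measurable] = this
        show ?thesis unfolding H_def by measurable
      qed
    qed
    have Pv: "gauss \<delta> v * P v = (LINT z|lborel. H z v)" for v
      by (simp add: PQ H_def lborel_prod)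
    from lborel_pair.integrable_snd[OF H] show "integrable lborel (\<lambda>v. gauss \<delta> v * P v)"
      by (simp add: Pv)
    define g where "g \<zeta> = sqrt (2 * pi / \<delta>) ^ DIM('a) * gauss (1 / \<delta>) \<zeta>" for \<zeta> :: 'a
    have [measurable]: "g \<in> borel_measurable borel" unfolding g_def by measurable
    have g0: "0 \<le> g \<zeta>" for \<zeta> using gauss_bounds(1)[of "1/\<delta>" \<zeta>] d by (simp add: g_def)
    have ig: "integrable lborel g" unfolding g_def using gaussian_fourier(1)[of "1/\<delta>"] d by (intro integrable_mult_right) auto
    \<comment> \<open>The factors sqrt (2 pi / \<delta>) and sqrt (2 pi \<delta>) multiply to 2 pi
      in each dimension: \<delta> cancels, which is why the estimate survives the removal of the
      weight.\<close>
    have Ig: "(LINT \<zeta>|lborel. g \<zeta>) = (2 * pi) ^ DIM('a)"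
    proof -
      have "sqrt (2 * pi / \<delta>) * sqrt (2 * pi / (1 / \<delta>)) = sqrt ((2 * pi)\<^sup>2)"
        using d by (subst real_sqrt_mult[symmetric]) (simp add: power2_eq_square)
      also have "\<dots> = 2 * pi" unfolding real_sqrt_abs by simp
      finally have *: "sqrt (2 * pi / \<delta>) * sqrt (2 * pi / (1 / \<delta>)) = 2 * pi" .
      have "(LINT \<zeta>|lborel. g \<zeta>) = sqrt (2 * pi / \<delta>) ^ DIM('a) * sqrt (2 * pi / (1 / \<delta>)) ^ DIM('a)"
        unfolding g_def integral_mult_right_zero using d by (subst gaussian_mass) auto
      then show ?thesis by (simp only: power_mult_distrib[symmetric] *)
    qed
    have i1: "integrable (lborel \<Otimes>\<^sub>M lborel) (\<lambda>z. (F (fst z))\<^sup>2 * g (fst z - snd z))"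
    proof (rule lborel_pair.Fubini_integrable)
      have "(LINT y|lborel. norm ((F (fst (x, y)))\<^sup>2 * g (fst (x, y) - snd (x, y)))) = (F x)\<^sup>2 * (LINT y|lborel. g y)" for x
        using g0 by (simp add: abs_mult integral_lborel_reflect)
      then show "integrable lborel (\<lambda>x. LINT y|lborel. norm ((F (fst (x, y)))\<^sup>2 * g (fst (x, y) - snd (x, y))))"
        using F2 by simp
    qed (auto intro!: integrable_lborel_reflect ig)
    have I1: "(LINT z|(lborel \<Otimes>\<^sub>M lborel). (F (fst z))\<^sup>2 * g (fst z - snd z)) = (LINT \<xi>|lborel. (F \<xi>)\<^sup>2) * (2 * pi) ^ DIM('a)"
      using lborel_pair.integral_fst'[OF i1] by (simp add: integral_lborel_reflect Ig)
    have gs: "g (x - y) = g (y - x)" for x y by (simp add: g_def gauss_def norm_minus_commute)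
    have i2: "integrable (lborel \<Otimes>\<^sub>M lborel) (\<lambda>z. (F (snd z))\<^sup>2 * g (fst z - snd z))"
      using lborel_pair.integrable_product_swap[OF i1] unfolding case_prod_unfold by (simp add: gs)
    have I2: "(LINT z|(lborel \<Otimes>\<^sub>M lborel). (F (snd z))\<^sup>2 * g (fst z - snd z)) = (LINT \<xi>|lborel. (F \<xi>)\<^sup>2) * (2 * pi) ^ DIM('a)"
      using lborel_pair.integral_product_swap[OF borel_measurable_integrable[OF i1]] I1 unfolding case_prod_unfold by (simp add: gs)
    have "(LINT v|lborel. gauss \<delta> v * P v) = (LINT v|lborel. LINT z|lborel. H z v)" by (simp add: Pv)
    also have "\<dots> = (LINT z|lborel. LINT v|lborel. H z v)"
      by (rule lborel_pair.Fubini_integral[OF H])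
    also have "\<dots> = (LINT z|(lborel \<Otimes>\<^sub>M lborel). F (fst z) * F (snd z) * g (fst z - snd z))"
    proof -
      have "(LINT v|lborel. H z v) = F (fst z) * F (snd z) * g (fst z - snd z)" for z
      proof -
        have "(LINT v|lborel. H z v) = (LINT v|lborel. (F (fst z) * F (snd z)) * (gauss \<delta> v * cos (v \<bullet> (fst z - snd z))))"
          by (simp add: H_def mult_ac)
        then show ?thesis by (simp only: integral_mult_right_zero gaussian_fourier(2)[OF d] g_def)
      qed
      then show ?thesis by (simp add: lborel_prod)
    qed
    also have "\<dots> \<le> (LINT z|(lborel \<Otimes>\<^sub>M lborel). 1 / 2 * ((F (fst z))\<^sup>2 * g (fst z - snd z)) + 1 / 2 * ((F (snd z))\<^sup>2 * g (fst z - snd z)))"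
    proof (rule integral_mono)
      have le: "F x * F y * g (x - y) \<le> 1 / 2 * ((F x)\<^sup>2 * g (x - y)) + 1 / 2 * ((F y)\<^sup>2 * g (x - y))"
         "\<bar>F x * F y * g (x - y)\<bar> \<le> 1 / 2 * ((F x)\<^sup>2 * g (x - y)) + 1 / 2 * ((F y)\<^sup>2 * g (x - y))" for x y
      proof -
        have "\<bar>F x * F y\<bar> \<le> 1 / 2 * (F x)\<^sup>2 + 1 / 2 * (F y)\<^sup>2"
          using sum_squares_bound[of "\<bar>F x\<bar>" "\<bar>F y\<bar>"] by (simp add: abs_mult)
        from mult_right_mono[OF this g0[of "x - y"]]
        show "\<bar>F x * F y * g (x - y)\<bar> \<le> 1 / 2 * ((F x)\<^sup>2 * g (x - y)) + 1 / 2 * ((F y)\<^sup>2 * g (x - y))"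
          using g0[of "x - y"] by (simp add: abs_mult algebra_simps)
        then show "F x * F y * g (x - y) \<le> 1 / 2 * ((F x)\<^sup>2 * g (x - y)) + 1 / 2 * ((F y)\<^sup>2 * g (x - y))"
          by linarith
      qed
      show i: "integrable (lborel \<Otimes>\<^sub>M lborel) (\<lambda>z. 1 / 2 * ((F (fst z))\<^sup>2 * g (fst z - snd z)) + 1 / 2 * ((F (snd z))\<^sup>2 * g (fst z - snd z)))"
        by (intro Bochner_Integration.integrable_add integrable_mult_right i1 i2)
      show "integrable (lborel \<Otimes>\<^sub>M lborel) (\<lambda>z. F (fst z) * F (snd z) * g (fst z - snd z))"
      proof (rule Bochner_Integration.integrable_bound[OF i])
        show "AE z in lborel \<Otimes>\<^sub>M lborel. norm (F (fst z) * F (snd z) * g (fst z - snd z))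
            \<le> norm (1 / 2 * ((F (fst z))\<^sup>2 * g (fst z - snd z)) + 1 / 2 * ((F (snd z))\<^sup>2 * g (fst z - snd z)))"
          using le(2) by (intro AE_I2) (simp only: real_norm_def, rule order.trans[OF _ abs_ge_self], simp)
      qed measurable
      show "F (fst z) * F (snd z) * g (fst z - snd z) \<le> 1 / 2 * ((F (fst z))\<^sup>2 * g (fst z - snd z)) + 1 / 2 * ((F (snd z))\<^sup>2 * g (fst z - snd z))" for z
        by (rule le(1))
    qed
    also have "\<dots> = (2 * pi) ^ DIM('a) * (LINT \<xi>|lborel. (F \<xi>)\<^sup>2)"
      by (subst Bochner_Integration.integral_add) (auto intro!: i1 i2 simp: I1 I2)
    finally show "(LINT v|lborel. gauss \<delta> v * P v) \<le> (2 * pi) ^ DIM('a) * (LINT \<xi>|lborel. (F \<xi>)\<^sup>2)" .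
  qed
  let ?R = "(2 * pi) ^ DIM('a) * (LINT \<xi>|lborel. (F \<xi>)\<^sup>2)"
  \<comment> \<open>Fatou's lemma along \<delta> = 1/(n+1) removes the Gaussian weight and yields
    square integrability as a conclusion.\<close>
  have nnP: "(\<integral>\<^sup>+v. ennreal (P v) \<partial>lborel) \<le> ennreal ?R"
  proof -
    have lim: "(\<lambda>n. ennreal (gauss (1 / real (Suc n)) v * P v)) \<longlonglongrightarrow> ennreal (P v)" for v
    proof -
      have "(\<lambda>n. exp (- (inverse (real (Suc n)) * ((norm v)\<^sup>2 / 2))) * P v) \<longlonglongrightarrow> exp (- (0 * ((norm v)\<^sup>2 / 2))) * P v"
        by (intro tendsto_intros LIMSEQ_inverse_real_of_nat)
      moreover have "exp (- (inverse (real (Suc n)) * ((norm v)\<^sup>2 / 2))) = gauss (1 / real (Suc n)) v" for n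
      proof -
        have "- (a * (b / 2)) = - a * b / 2" for a b :: real by simp
        then show ?thesis unfolding gauss_def inverse_eq_divide by (rule arg_cong)
      qed
      ultimately have "(\<lambda>n. gauss (1 / real (Suc n)) v * P v) \<longlonglongrightarrow> P v"
        by (simp only: mult_zero_left minus_zero exp_zero mult_1_left)
      then show ?thesis by (rule tendsto_ennrealI)
    qed
    have "(\<integral>\<^sup>+v. ennreal (P v) \<partial>lborel) = (\<integral>\<^sup>+v. liminf (\<lambda>n. ennreal (gauss (1 / real (Suc n)) v * P v)) \<partial>lborel)"
      by (intro nn_integral_cong lim_imp_Liminf[symmetric] lim) simp
    also have "\<dots> \<le> liminf (\<lambda>n. \<integral>\<^sup>+v. ennreal (gauss (1 / real (Suc n)) v * P v) \<partial>lborel)"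
      by (rule nn_integral_liminf) measurable
    also have "\<dots> \<le> ennreal ?R"
    proof (rule Liminf_le)
      show "\<forall>\<^sub>F n in sequentially. (\<integral>\<^sup>+v. ennreal (gauss (1 / real (Suc n)) v * P v) \<partial>lborel) \<le> ennreal ?R"
      proof (intro always_eventually allI)
        fix n
        have "(\<integral>\<^sup>+v. ennreal (gauss (1 / real (Suc n)) v * P v) \<partial>lborel) = ennreal (LINT v|lborel. gauss (1 / real (Suc n)) v * P v)"
          by (intro nn_integral_eq_integral bound(1) AE_I2 mult_nonneg_nonneg P0 less_imp_le[OF gauss_bounds(1)]) simp
        also have "\<dots> \<le> ennreal ?R" by (intro ennreal_leI bound(2)) simp
        finally show "(\<integral>\<^sup>+v. ennreal (gauss (1 / real (Suc n)) v * P v) \<partial>lborel) \<le> ennreal ?R" .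
      qed
    qed simp
    finally show ?thesis .
  qed
  have nnW: "(\<integral>\<^sup>+v. ennreal ((W v)\<^sup>2) \<partial>lborel) \<le> ennreal ?R"
    by (rule order.trans[OF _ nnP]) (intro nn_integral_mono ennreal_leI WP)
  show iW: "integrable lborel (\<lambda>v. (W v)\<^sup>2)"
    using nnW by (intro integrableI_nonneg) (auto simp: order.strict_trans1)
  have R0: "0 \<le> ?R" by simp
  show "(LINT v|lborel. (W v)\<^sup>2) \<le> ?R"
    using nnW R0 by (subst (asm) nn_integral_eq_integral[OF iW]) (auto simp: ennreal_le_iff)
qed

section \<open>Integration by parts against test functions\<close>

lemma partials_has_derivative:
  assumes "\<phi> \<in> test_functions"
  shows "(partials I \<phi> has_derivative frechet_derivative (partials I \<phi>) (at x)) (at x)"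
  using assms frechet_derivative_works
  by (fastforce simp: test_functions_def smooth_def differentiable_on_def)

lemma partials_continuous:
  assumes "\<phi> \<in> test_functions"
  shows "continuous_on UNIV (partials I \<phi>)"
  using assms by (auto simp: test_functions_def smooth_def intro: differentiable_imp_continuous_on)

text \<open>One radius serves all orders, because vanishing on the open exterior of a ball passes to
  every derivative.\<close>

lemma test_function_support:
  fixes \<phi> :: "real^'n::finite \<Rightarrow> real"
  assumes "\<phi> \<in> test_functions"
  obtains R where "R > 0" "\<And>I x. R \<le> norm x \<Longrightarrow> partials I \<phi> x = 0"
proof -
  from assms have "bounded (closure {x. \<phi> x \<noteq> 0})"
    by (auto simp: test_functions_def intro: compact_imp_bounded)
  then obtain R where R: "R > 0" "\<And>x. \<phi> x \<noteq> 0 \<Longrightarrow> norm x \<le> R"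
    unfolding bounded_pos using closure_subset[of "{x. \<phi> x \<noteq> 0}"] by auto
  have "partials I \<phi> x = 0" if "R < norm x" for I x
    using that
  proof (induction I arbitrary: x)
    case Nil
    then show ?case using R(2)[of x] by auto
  next
    case (Cons i I)
    have "open {x::real^'n. R < norm x}" by (intro open_Collect_less continuous_intros)
    have "(partials I \<phi> has_derivative (\<lambda>h. 0)) (at x)"
      by (rule has_derivative_transform_within_open[OF has_derivative_const[of 0] \<open>open _\<close>])
         (use Cons in auto)
    from frechet_derivative_at[OF this] show ?case by (metis partials.simps(2))
  qed
  then show ?thesis using that[of "R + 1"] R(1) by auto
qed

lemma integrable_compact_support:
  fixes f :: "'a::euclidean_space \<Rightarrow> real"
  assumes "continuous_on UNIV f" "\<And>x. R \<le> norm x \<Longrightarrow> f x = 0"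
  shows "integrable lborel f"
proof -
  have "compact (cball (0::'a) R)" by simp
  then obtain M where M: "\<And>x. x \<in> cball 0 R \<Longrightarrow> \<bar>f x\<bar> \<le> M"
    using compact_imp_bounded[OF compact_continuous_image[OF continuous_on_subset[OF assms(1) subset_UNIV]]]
    unfolding bounded_iff by (metis imageI real_norm_def)
  have [measurable]: "f \<in> borel_measurable borel" by (rule borel_measurable_continuous_onI[OF assms(1)])
  show ?thesis
    by (rule integrableI_bounded_set[where A = "cball 0 R" and B = M])
       (use M assms(2) emeasure_bounded_finite[OF bounded_cball[of "0::'a" R]] in auto)
qed

text \<open>By translation invariance the difference quotients of f along e have integral 0;
  dominated convergence on an enlarged ball passes this to the derivative, without slicing into
  lines.\<close>

lemma integral_partial_eq_0:
  fixes f :: "'a::euclidean_space \<Rightarrow> real"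
  assumes f: "\<And>x. (f has_derivative f' x) (at x)" and cont: "continuous_on UNIV (\<lambda>x. f' x e)"
    and supp: "\<And>x. R \<le> norm x \<Longrightarrow> f x = 0" and R: "R > 0"
  shows "(LINT x|lborel. f' x e) = 0"
proof -
  define E where "E = norm e"
  have cf: "continuous_on UNIV f" by (intro continuous_at_imp_continuous_on ballI has_derivative_continuous[OF f])
  have [measurable]: "f \<in> borel_measurable borel" by (rule borel_measurable_continuous_onI[OF cf])
  have i: "integrable lborel f" by (rule integrable_compact_support[OF cf supp])
  have "compact (cball (0::'a) (R + 2 * E))" by simp
  then obtain M where M: "\<And>x. x \<in> cball 0 (R + 2 * E) \<Longrightarrow> \<bar>f' x e\<bar> \<le> M"
    using compact_imp_bounded[OF compact_continuous_image[OF continuous_on_subset[OF cont subset_UNIV]]]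
    unfolding bounded_iff by (metis imageI real_norm_def)
  have line: "((\<lambda>t. f (x + t *\<^sub>R e)) has_real_derivative f' (x + t *\<^sub>R e) e) (at t)" for x t
  proof -
    have "((\<lambda>t. x + t *\<^sub>R e) has_derivative (\<lambda>h. h *\<^sub>R e)) (at t)"
      by (auto intro!: derivative_eq_intros)
    from has_derivative_compose[OF this f]
    have "((\<lambda>t. f (x + t *\<^sub>R e)) has_derivative (\<lambda>h. f' (x + t *\<^sub>R e) (h *\<^sub>R e))) (at t)" .
    moreover have "f' (x + t *\<^sub>R e) (h *\<^sub>R e) = f' (x + t *\<^sub>R e) e * h" for h
      using linear_cmul[OF has_derivative_linear[OF f]] by (simp add: mult.commute)
    ultimately show ?thesis by (simp add: has_field_derivative_def)
  qed
  define q where "q n x = real (Suc n) * (f (inverse (real (Suc n)) *\<^sub>R e + x) - f x)" for n x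
  have bnd: "\<bar>q n x\<bar> \<le> M * indicator (cball 0 (R + E)) x" for n x
  proof -
    let ?h = "inverse (real (Suc n))"
    have h: "0 < ?h" "?h \<le> 1" by (auto simp: inverse_le_1_iff)
    show ?thesis
    proof (cases "x \<in> cball 0 (R + E)")
      case True
      obtain z where z: "0 < z" "z < ?h" "f (x + ?h *\<^sub>R e) - f (x + 0 *\<^sub>R e) = (?h - 0) * f' (x + z *\<^sub>R e) e"
        using MVT2[OF h(1), of "\<lambda>t. f (x + t *\<^sub>R e)" "\<lambda>t. f' (x + t *\<^sub>R e) e"] line by auto
      have "norm (x + z *\<^sub>R e) \<le> norm x + norm (z *\<^sub>R e)" by (rule norm_triangle_ineq)
      also have "\<dots> \<le> (R + E) + 1 * E" using z h True unfolding E_def norm_scaleR by (intro add_mono mult_right_mono) auto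
      finally have "\<bar>f' (x + z *\<^sub>R e) e\<bar> \<le> M" by (intro M) simp
      moreover have "q n x = f' (x + z *\<^sub>R e) e"
        using z(3) by (simp add: q_def add.commute)
      ultimately show ?thesis using True by simp
    next
      case False
      then have "R + E < norm x" by auto
      moreover have "norm x \<le> norm (?h *\<^sub>R e + x) + norm (?h *\<^sub>R e)"
        using norm_triangle_ineq4[of "?h *\<^sub>R e + x" "?h *\<^sub>R e"] by simp
      moreover have "norm (?h *\<^sub>R e) \<le> 1 * E" unfolding E_def norm_scaleR using h by (intro mult_right_mono) auto
      ultimately have "R \<le> norm (?h *\<^sub>R e + x)" "R \<le> norm x" using norm_ge_zero[of e] unfolding E_def by linarith+
      then show ?thesis using supp False by (simp add: q_def)
    qed
  qed
  have "(\<lambda>n. LINT x|lborel. q n x) \<longlonglongrightarrow> (LINT x|lborel. f' x e)"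
  proof (rule integral_dominated_convergence[where w = "\<lambda>x. M * indicator (cball 0 (R + E)) x"])
    show "(\<lambda>x. f' x e) \<in> borel_measurable lborel" using borel_measurable_continuous_onI[OF cont] by simp
    show "q n \<in> borel_measurable lborel" for n unfolding q_def by measurable
    show "integrable lborel (\<lambda>x::'a. M * indicator (cball 0 (R + E)) x)"
      using emeasure_bounded_finite[OF bounded_cball[of "0::'a" "R + E"]]
      by (intro integrable_mult_right integrable_real_indicator) auto
    show "AE x in lborel. (\<lambda>n. q n x) \<longlonglongrightarrow> f' x e"
    proof (rule AE_I2)
      fix x
      have "((\<lambda>h. (f (x + (0 + h) *\<^sub>R e) - f (x + 0 *\<^sub>R e)) / h) \<longlongrightarrow> f' (x + 0 *\<^sub>R e) e) (at 0)"
        using line[of x 0] unfolding DERIV_def .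
      moreover have "filterlim (\<lambda>n. inverse (real (Suc n))) (at 0) sequentially"
        using LIMSEQ_inverse_real_of_nat by (simp add: filterlim_at)
      ultimately have "(\<lambda>n. (f (x + (0 + inverse (real (Suc n))) *\<^sub>R e) - f (x + 0 *\<^sub>R e)) / inverse (real (Suc n))) \<longlonglongrightarrow> f' (x + 0 *\<^sub>R e) e"
        by (rule filterlim_compose)
      then show "(\<lambda>n. q n x) \<longlonglongrightarrow> f' x e"
        by (simp add: q_def divide_inverse mult.commute add.commute del: of_nat_Suc)
    qed
    show "AE x in lborel. norm (q n x) \<le> M * indicator (cball 0 (R + E)) x" for n
      using bnd by (intro AE_I2) simp
  qed
  moreover have "(LINT x|lborel. q n x) = 0" for n
    unfolding q_def integral_mult_right_zero
    by (subst Bochner_Integration.integral_diff) (auto intro: integrable_lborel_shift i simp: integral_lborel_shift)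
  ultimately show ?thesis by (simp add: LIMSEQ_const_iff)
qed

text \<open>The symbol of the derivative along \<open>I\<close> without its powers of the imaginary
  unit, which reappear as phases of pi/2.\<close>

definition frequency_monomial :: "'n::finite list \<Rightarrow> real^'n \<Rightarrow> real" where
  "frequency_monomial I \<xi> = prod_list (map (\<lambda>i. \<xi> $ i) I)"

text \<open>Each integration by parts contributes a sign, a component of \<xi> and a phase shift by
  pi/2, the real counterpart of multiplication by i.\<close>

lemma wave_partial_integral:
  fixes \<phi> :: "real^'n::finite \<Rightarrow> real"
  assumes \<phi>: "\<phi> \<in> test_functions"
  shows "(LINT v|lborel. cos (\<xi> \<bullet> v + \<alpha>) * partials I \<phi> v) =
    (- 1) ^ length I * frequency_monomial I \<xi> * (LINT v|lborel. cos (\<xi> \<bullet> v + (\<alpha> + real (length I) * (pi / 2))) * \<phi> v)"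
proof (induction I arbitrary: \<alpha>)
  case Nil
  then show ?case by (simp add: frequency_monomial_def)
next
  case (Cons i I)
  let ?\<psi> = "partials I \<phi>"
  let ?e = "axis i 1 :: real^'n"
  obtain R where R: "R > 0" "\<And>I x. R \<le> norm x \<Longrightarrow> partials I \<phi> x = 0"
    using test_function_support[OF \<phi>] by blast
  let ?f' = "\<lambda>v h. cos (\<xi> \<bullet> v + \<alpha>) * frechet_derivative ?\<psi> (at v) h + ((\<xi> \<bullet> h) * cos (\<xi> \<bullet> v + (\<alpha> + pi / 2))) * ?\<psi> v"
  have ic: "integrable lborel (\<lambda>v. cos (\<xi> \<bullet> v + \<beta>) * partials J \<phi> v)" for J \<beta>
    by (rule integrable_compact_support[where R = R])
       (auto intro!: continuous_intros partials_continuous[OF \<phi>] simp: R(2))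
  have "(LINT v|lborel. ?f' v ?e) = 0"
  proof (rule integral_partial_eq_0[where f' = ?f' and e = ?e and f = "\<lambda>v. cos (\<xi> \<bullet> v + \<alpha>) * ?\<psi> v", OF _ _ _ R(1)])
    show "((\<lambda>v. cos (\<xi> \<bullet> v + \<alpha>) * ?\<psi> v) has_derivative ?f' v) (at v)" for v
    proof (rule has_derivative_mult)
      show "((\<lambda>v. cos (\<xi> \<bullet> v + \<alpha>)) has_derivative (\<lambda>h. (\<xi> \<bullet> h) * cos (\<xi> \<bullet> v + (\<alpha> + pi / 2)))) (at v)"
        by (auto intro!: derivative_eq_intros simp: cos_add sin_add algebra_simps)
    qed (rule partials_has_derivative[OF \<phi>])
    show "continuous_on UNIV (\<lambda>v. ?f' v ?e)"
      using partials_continuous[OF \<phi>, of "i # I"]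
      by (auto intro!: continuous_intros partials_continuous[OF \<phi>])
    show "cos (\<xi> \<bullet> v + \<alpha>) * ?\<psi> v = 0" if "R \<le> norm v" for v
      using R(2)[OF that] by simp
  qed
  moreover have "(LINT v|lborel. ?f' v ?e) = (LINT v|lborel. cos (\<xi> \<bullet> v + \<alpha>) * partials (i # I) \<phi> v) +
      \<xi> $ i * (LINT v|lborel. cos (\<xi> \<bullet> v + (\<alpha> + pi / 2)) * ?\<psi> v)"
    using Bochner_Integration.integral_add[OF ic[of \<alpha> "i # I"] integrable_mult_right[OF ic[of "\<alpha> + pi / 2" I], of "\<xi> $ i"]]
    by (simp add: inner_axis mult_ac)
  ultimately have "(LINT v|lborel. cos (\<xi> \<bullet> v + \<alpha>) * partials (i # I) \<phi> v) =
      - (\<xi> $ i) * (LINT v|lborel. cos (\<xi> \<bullet> v + (\<alpha> + pi / 2)) * ?\<psi> v)"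
    by simp
  also have "\<dots> = (- 1) ^ length (i # I) * frequency_monomial (i # I) \<xi> *
      (LINT v|lborel. cos (\<xi> \<bullet> v + (\<alpha> + real (length (i # I)) * (pi / 2))) * \<phi> v)"
    unfolding Cons.IH by (simp add: frequency_monomial_def algebra_simps add_divide_distrib)
  finally show ?case .
qed

lemma finite_lists_of_length: "finite {I :: 'n::finite list. length I = k}"
  using finite_lists_length_eq[of "UNIV :: 'n set" k] by simp

text \<open>This expands the k-th power of the sum of squares over ordered lists of indices. It
  turns the Euclidean norm of the full derivative tensor into the multiplier |\<xi>|^k without
  combinatorial loss.\<close>

lemma sum_frequency_monomials:
  "(\<Sum>I | length I = k. (frequency_monomial I \<xi>)\<^sup>2) = (norm \<xi>) ^ (2 * k)"
proof (induction k)
  case 0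
  then show ?case by (simp add: frequency_monomial_def)
next
  case (Suc k)
  have eq: "{I :: 'a list. length I = Suc k} = (\<lambda>(i, I). i # I) ` (UNIV \<times> {I. length I = k})"
    by (auto simp: length_Suc_conv image_iff)
  have inj: "inj_on (\<lambda>(i, I). i # I) (UNIV \<times> {I :: 'a list. length I = k})"
    by (auto simp: inj_on_def)
  have "(\<Sum>I | length I = Suc k. (frequency_monomial I \<xi>)\<^sup>2) = (\<Sum>i\<in>UNIV. \<Sum>I | length I = k. (\<xi> $ i)\<^sup>2 * (frequency_monomial I \<xi>)\<^sup>2)"
    unfolding eq by (subst sum.reindex[OF inj])
      (simp add: frequency_monomial_def power_mult_distrib case_prod_unfold o_def sum.cartesian_product)
  also have "\<dots> = (\<Sum>i\<in>UNIV. (\<xi> $ i)\<^sup>2) * (norm \<xi>) ^ (2 * k)"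
    by (simp add: sum_distrib_left[symmetric] Suc.IH sum_distrib_right)
  also have "(\<Sum>i\<in>UNIV. (\<xi> $ i)\<^sup>2) = (norm \<xi>)\<^sup>2"
    by (simp add: norm_vec_def L2_set_def sum_nonneg)
  finally show ?case by (simp add: power_add[symmetric])
qed

text \<open>For functions whose sine integrals vanish this is the whole Fourier transform, so the
  argument can stay within the reals.\<close>

definition cos_transform :: "('a::euclidean_space \<Rightarrow> real) \<Rightarrow> 'a \<Rightarrow> real" where
  "cos_transform u \<xi> = (LINT v|lborel. u v * cos (\<xi> \<bullet> v))"

section \<open>Fourier inversion for non-negative functions\<close>

lemma integral_lborel_scale:
  fixes f :: "'a::euclidean_space \<Rightarrow> real"
  assumes [measurable]: "f \<in> borel_measurable borel" and c: "c > 0"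
  shows "(LINT x|lborel. f x) = c ^ DIM('a) * (LINT x|lborel. f (c *\<^sub>R x))"
proof -
  have "(LINT x|lborel. f x) = (LINT x|density (distr lborel borel (\<lambda>x::'a. 0 + c *\<^sub>R x)) (\<lambda>_. \<bar>c\<bar> ^ DIM('a)). f x)"
    using lborel_affine[of c "0::'a"] c by simp
  also have "\<dots> = (LINT x|distr lborel borel (\<lambda>x::'a. 0 + c *\<^sub>R x). c ^ DIM('a) * f x)"
    using c by (subst integral_density) auto
  also have "\<dots> = c ^ DIM('a) * (LINT x|lborel. f (c *\<^sub>R x))"
    by (subst integral_distr) auto
  finally show ?thesis .
qed

text \<open>Off the frontier the sequence is eventually constant. Since frontiers of boxes are null
  sets, box indicators can play the part of continuous test functions.\<close>

lemma box_indicator_locally_constant: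
  fixes v :: "'a::euclidean_space"
  assumes "v \<notin> frontier (box l r)"
  shows "(\<lambda>n. indicator (box l r) (v + sqrt (1 / real (Suc n)) *\<^sub>R y)) \<longlonglongrightarrow> (indicator (box l r) v :: real)"
proof -
  have "(\<lambda>n. v + sqrt (inverse (real (Suc n))) *\<^sub>R y) \<longlonglongrightarrow> v + sqrt 0 *\<^sub>R y"
    by (intro tendsto_intros LIMSEQ_inverse_real_of_nat)
  then have lim: "(\<lambda>n. v + sqrt (1 / real (Suc n)) *\<^sub>R y) \<longlonglongrightarrow> v" by (simp only: inverse_eq_divide real_sqrt_zero scaleR_zero_left add_0_right)
  consider "v \<in> box l r" | "v \<in> - closure (box l r)"
    using assms by (auto simp: frontier_def interior_open[OF open_box])
  then show ?thesis
  proof cases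
    case 1
    have "\<forall>\<^sub>F n in sequentially. v + sqrt (1 / real (Suc n)) *\<^sub>R y \<in> box l r"
      by (rule topological_tendstoD[OF lim open_box 1])
    then show ?thesis
      by (intro tendsto_eventually) (use 1 in \<open>auto elim: eventually_mono\<close>)
  next
    case 2
    have "\<forall>\<^sub>F n in sequentially. v + sqrt (1 / real (Suc n)) *\<^sub>R y \<in> - closure (box l r)"
      by (rule topological_tendstoD[OF lim _ 2]) (rule open_Compl[OF closed_closure])
    moreover have "x \<notin> box l r" if "x \<in> - closure (box l r)" for x using that closure_subset by blast
    ultimately show ?thesis
      by (intro tendsto_eventually) (use 2 in \<open>auto elim!: eventually_mono\<close>)
  qed
qed

text \<open>\<open>sine\<close> says that the Fourier transform is real, \<open>F\<close> that it is
  integrable. Positivity of u makes it possible to identify u with its inverse transform as an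
  equality of measures.\<close>

locale cosine_inversion =
  fixes u :: "'a::euclidean_space \<Rightarrow> real"
  assumes u: "integrable lborel u" and u0: "AE v in lborel. 0 \<le> u v"
    and sine: "\<And>\<xi>. (LINT v|lborel. u v * sin (\<xi> \<bullet> v)) = 0"
    and F: "integrable lborel (cos_transform u)"
begin

lemma [measurable]: "u \<in> borel_measurable borel" "cos_transform u \<in> borel_measurable borel"
  using borel_measurable_integrable[OF u] borel_measurable_integrable[OF F] by auto

definition inverse_transform :: "'a \<Rightarrow> real" where
  "inverse_transform w = (LINT \<xi>|lborel. cos_transform u \<xi> * cos (\<xi> \<bullet> w)) / (2 * pi) ^ DIM('a)"

text \<open>The Gaussian density of variance \<delta> in each coordinate, (2 pi \<delta>)^(-d/2) exp
  (- |z|^2 / (2 \<delta>)), left in the form in which \<open>gaussian_fourier\<close> delivers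
  it.\<close>

definition heat_kernel :: "real \<Rightarrow> 'a \<Rightarrow> real" where
  "heat_kernel \<delta> z = sqrt (2 * pi / \<delta>) ^ DIM('a) * gauss (1 / \<delta>) z / (2 * pi) ^ DIM('a)"

definition regularized :: "real \<Rightarrow> 'a \<Rightarrow> real" where
  "regularized \<delta> w = (LINT \<xi>|lborel. gauss \<delta> \<xi> * (cos_transform u \<xi> * cos (\<xi> \<bullet> w))) / (2 * pi) ^ DIM('a)"

lemma heat_kernel_measurable [measurable]: "heat_kernel \<delta> \<in> borel_measurable borel"
  unfolding heat_kernel_def by measurable

lemma inverse_transform_measurable [measurable]: "inverse_transform \<in> borel_measurable borel"
  unfolding inverse_transform_def by measurable

lemma regularized_measurable [measurable]: "regularized \<delta> \<in> borel_measurable borel"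
  unfolding regularized_def by measurable

lemma heat_kernel_nonneg: "\<delta> > 0 \<Longrightarrow> 0 \<le> heat_kernel \<delta> z"
  by (simp add: heat_kernel_def less_imp_le[OF gauss_bounds(1)])

lemma heat_kernel_integrable: "\<delta> > 0 \<Longrightarrow> integrable lborel (heat_kernel \<delta>)"
  unfolding heat_kernel_def by (intro integrable_divide integrable_mult_right gaussian_fourier(1)) simp

lemma heat_kernel_scale: "\<delta> > 0 \<Longrightarrow> sqrt \<delta> ^ DIM('a) * heat_kernel \<delta> (sqrt \<delta> *\<^sub>R y) = heat_kernel 1 y"
  by (simp add: heat_kernel_def gauss_def power_mult_distrib real_sqrt_divide power_divide)

lemma heat_kernel_mass: "\<delta> > 0 \<Longrightarrow> (LINT z|lborel. heat_kernel \<delta> z) = 1"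
proof -
  assume d: "\<delta> > 0"
  have "(LINT z|lborel. heat_kernel 1 z) = sqrt (2 * pi / 1) ^ DIM('a) * sqrt (2 * pi / (1 / 1)) ^ DIM('a) / (2 * pi) ^ DIM('a)"
    unfolding heat_kernel_def by (subst integral_divide_zero, subst integral_mult_right_zero, subst gaussian_mass) auto
  also have "sqrt (2 * pi / 1) ^ DIM('a) * sqrt (2 * pi / (1 / 1)) ^ DIM('a) = (sqrt (2 * pi) * sqrt (2 * pi)) ^ DIM('a)"
    by (simp only: power_mult_distrib div_by_1)
  also have "sqrt (2 * pi) * sqrt (2 * pi) = 2 * pi" by (rule real_sqrt_mult_self[THEN trans]) simp
  finally have "(LINT z|lborel. heat_kernel 1 z) = 1" by simp
  moreover have "(LINT z|lborel. heat_kernel \<delta> z) = (LINT z|lborel. heat_kernel 1 z)"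
  proof -
    have "(LINT z|lborel. heat_kernel \<delta> z) = sqrt \<delta> ^ DIM('a) * (LINT y|lborel. heat_kernel \<delta> (sqrt \<delta> *\<^sub>R y))"
      using d by (intro integral_lborel_scale) auto
    also have "\<dots> = (LINT y|lborel. sqrt \<delta> ^ DIM('a) * heat_kernel \<delta> (sqrt \<delta> *\<^sub>R y))"
      by (rule integral_mult_right_zero[symmetric])
    finally show ?thesis by (simp only: heat_kernel_scale[OF d])
  qed
  ultimately show ?thesis by simp
qed

text \<open>The Gaussian makes the double integral absolutely convergent, so Fubini applies.
  Expanding cos (\<xi> . (w - v)) leaves only the product of cosines, because the sine integrals of
  u vanish.\<close>

lemma regularized_convolution:
  assumes d: "\<delta> > 0"
  shows "regularized \<delta> w = (LINT v|lborel. u v * heat_kernel \<delta> (w - v))"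
proof -
  let ?D = "(2 * pi) ^ DIM('a) :: real"
  have bnd: "integrable lborel (\<lambda>v. u v * cos (\<xi> \<bullet> v))" "integrable lborel (\<lambda>v. u v * sin (\<xi> \<bullet> v))" for \<xi>
    by (rule Bochner_Integration.integrable_bound[OF u]; simp add: abs_mult mult_left_le)+
  have c: "(LINT v|lborel. u v * cos (\<xi> \<bullet> (w - v))) = cos_transform u \<xi> * cos (\<xi> \<bullet> w)" for \<xi>
  proof -
    have "(LINT v|lborel. u v * cos (\<xi> \<bullet> (w - v))) = (LINT v|lborel. cos (\<xi> \<bullet> w) * (u v * cos (\<xi> \<bullet> v)) + sin (\<xi> \<bullet> w) * (u v * sin (\<xi> \<bullet> v)))"
      by (intro Bochner_Integration.integral_cong) (auto simp: inner_diff_right cos_diff algebra_simps)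
    also have "\<dots> = cos (\<xi> \<bullet> w) * cos_transform u \<xi> + sin (\<xi> \<bullet> w) * 0"
      by (subst Bochner_Integration.integral_add) (auto intro!: bnd simp: cos_transform_def sine)
    finally show ?thesis by simp
  qed
  define H where "H \<xi> v = gauss \<delta> \<xi> * (u v * cos (\<xi> \<bullet> (w - v)))" for \<xi> v :: 'a
  have H: "integrable (lborel \<Otimes>\<^sub>M lborel) (\<lambda>(\<xi>, v). H \<xi> v)"
  proof (rule Bochner_Integration.integrable_bound[OF lborel_pair.product_integral_mult(1)[OF gaussian_fourier(1)[OF d] u]])
    show "(\<lambda>(\<xi>, v). H \<xi> v) \<in> borel_measurable (lborel \<Otimes>\<^sub>M lborel)" unfolding H_def by measurable
    show "AE z in lborel \<Otimes>\<^sub>M lborel. norm (case z of (\<xi>, v) \<Rightarrow> H \<xi> v) \<le> norm (gauss \<delta> (fst z) * u (snd z))"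
      by (rule AE_I2) (auto simp: H_def abs_mult intro!: mult_left_mono mult_left_le)
  qed
  have "?D * regularized \<delta> w = (LINT \<xi>|lborel. LINT v|lborel. H \<xi> v)"
    by (simp add: regularized_def H_def c)
  also have "\<dots> = (LINT v|lborel. LINT \<xi>|lborel. H \<xi> v)"
    by (rule lborel_pair.Fubini_integral[symmetric, OF H])
  also have "\<dots> = (LINT v|lborel. ?D * (u v * heat_kernel \<delta> (w - v)))"
  proof (rule Bochner_Integration.integral_cong[OF refl])
    fix v
    have "(LINT \<xi>|lborel. H \<xi> v) = (LINT \<xi>|lborel. u v * (gauss \<delta> \<xi> * cos (\<xi> \<bullet> (w - v))))"
      by (simp add: H_def mult_ac)
    also have "\<dots> = ?D * (u v * heat_kernel \<delta> (w - v))"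
      unfolding integral_mult_right_zero gaussian_fourier(2)[OF d] by (simp add: heat_kernel_def)
    finally show "(LINT \<xi>|lborel. H \<xi> v) = ?D * (u v * heat_kernel \<delta> (w - v))" .
  qed
  finally show ?thesis by (simp del: power_mult_distrib)
qed

lemma regularized_tendsto: "(\<lambda>n. regularized (1 / real (Suc n)) w) \<longlonglongrightarrow> inverse_transform w"
  unfolding regularized_def inverse_transform_def
proof (intro tendsto_divide tendsto_const)
  show "(\<lambda>n. LINT \<xi>|lborel. gauss (1 / real (Suc n)) \<xi> * (cos_transform u \<xi> * cos (\<xi> \<bullet> w)))
      \<longlonglongrightarrow> (LINT \<xi>|lborel. cos_transform u \<xi> * cos (\<xi> \<bullet> w))"
  proof (rule integral_dominated_convergence[where w = "\<lambda>\<xi>. \<bar>cos_transform u \<xi>\<bar>"])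
    show "AE \<xi> in lborel. (\<lambda>n. gauss (1 / real (Suc n)) \<xi> * (cos_transform u \<xi> * cos (\<xi> \<bullet> w))) \<longlonglongrightarrow> cos_transform u \<xi> * cos (\<xi> \<bullet> w)"
    proof (rule AE_I2)
      fix \<xi> :: 'a
      have "(\<lambda>n. exp (- (inverse (real (Suc n)) * ((norm \<xi>)\<^sup>2 / 2)))) \<longlonglongrightarrow> exp (- (0 * ((norm \<xi>)\<^sup>2 / 2)))"
        by (intro tendsto_intros LIMSEQ_inverse_real_of_nat)
      moreover have "exp (- (inverse (real (Suc n)) * ((norm \<xi>)\<^sup>2 / 2))) = gauss (1 / real (Suc n)) \<xi>" for n
      proof -
        have "- (a * (b / 2)) = - a * b / 2" for a b :: real by simp
        then show ?thesis unfolding gauss_def inverse_eq_divide by (rule arg_cong)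
      qed
      ultimately have "(\<lambda>n. gauss (1 / real (Suc n)) \<xi>) \<longlonglongrightarrow> 1"
        by (simp only: mult_zero_left minus_zero exp_zero)
      from tendsto_mult[OF this tendsto_const] show "(\<lambda>n. gauss (1 / real (Suc n)) \<xi> * (cos_transform u \<xi> * cos (\<xi> \<bullet> w))) \<longlonglongrightarrow> cos_transform u \<xi> * cos (\<xi> \<bullet> w)"
        by (simp only: mult_1_left)
    qed
    show "AE \<xi> in lborel. norm (gauss (1 / real (Suc n)) \<xi> * (cos_transform u \<xi> * cos (\<xi> \<bullet> w))) \<le> \<bar>cos_transform u \<xi>\<bar>" for n
    proof (rule AE_I2)
      fix \<xi> :: 'a
      have g: "0 < gauss (1 / real (Suc n)) \<xi>" "gauss (1 / real (Suc n)) \<xi> \<le> 1" using gauss_bounds[of "1 / real (Suc n)" \<xi>] by simp_all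
      have "\<bar>gauss (1 / real (Suc n)) \<xi>\<bar> * (\<bar>cos_transform u \<xi>\<bar> * \<bar>cos (\<xi> \<bullet> w)\<bar>) \<le> 1 * (\<bar>cos_transform u \<xi>\<bar> * 1)"
        using g by (intro mult_mono) auto
      then show "norm (gauss (1 / real (Suc n)) \<xi> * (cos_transform u \<xi> * cos (\<xi> \<bullet> w))) \<le> \<bar>cos_transform u \<xi>\<bar>"
        by (simp add: abs_mult)
    qed
  qed (use F in auto)
qed auto

lemma regularized_bound: "\<delta> > 0 \<Longrightarrow> \<bar>regularized \<delta> w\<bar> \<le> (LINT \<xi>|lborel. \<bar>cos_transform u \<xi>\<bar>) / (2 * pi) ^ DIM('a)"
proof -
  assume d: "\<delta> > 0"
  have b: "\<bar>gauss \<delta> \<xi> * (cos_transform u \<xi> * cos (\<xi> \<bullet> w))\<bar> \<le> \<bar>cos_transform u \<xi>\<bar>" for \<xi>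
  proof -
    have "\<bar>gauss \<delta> \<xi>\<bar> * (\<bar>cos_transform u \<xi>\<bar> * \<bar>cos (\<xi> \<bullet> w)\<bar>) \<le> 1 * (\<bar>cos_transform u \<xi>\<bar> * 1)"
      using gauss_bounds[of \<delta> \<xi>] d by (intro mult_mono) auto
    then show ?thesis by (simp add: abs_mult)
  qed
  have "\<bar>LINT \<xi>|lborel. gauss \<delta> \<xi> * (cos_transform u \<xi> * cos (\<xi> \<bullet> w))\<bar> \<le> (LINT \<xi>|lborel. \<bar>gauss \<delta> \<xi> * (cos_transform u \<xi> * cos (\<xi> \<bullet> w))\<bar>)"
    by (rule integral_abs_bound)
  also have "\<dots> \<le> (LINT \<xi>|lborel. \<bar>cos_transform u \<xi>\<bar>)"
  proof (rule integral_mono)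
    show "integrable lborel (\<lambda>\<xi>. \<bar>gauss \<delta> \<xi> * (cos_transform u \<xi> * cos (\<xi> \<bullet> w))\<bar>)"
      by (rule Bochner_Integration.integrable_bound[OF F]) (use b in auto)
  qed (use F b in auto)
  finally show ?thesis by (simp add: regularized_def divide_right_mono)
qed

text \<open>Positivity is visible in the convolution form and survives the limit; it allows the
  inverse transform to serve as a density.\<close>

lemma inverse_transform_nonneg: "0 \<le> inverse_transform w"
proof (rule LIMSEQ_le_const[OF regularized_tendsto])
  have "0 \<le> regularized (1 / real (Suc n)) w" for n
    by (subst regularized_convolution, simp, intro integral_nonneg_AE) (use u0 heat_kernel_nonneg[of "1 / real (Suc n)"] in \<open>auto elim!: eventually_mono\<close>)
  then show "\<exists>N. \<forall>n\<ge>N. 0 \<le> regularized (1 / real (Suc n)) w" by blast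
qed

lemma inverse_transform_bound: "\<bar>inverse_transform w\<bar> \<le> (LINT \<xi>|lborel. \<bar>cos_transform u \<xi>\<bar>) / (2 * pi) ^ DIM('a)"
  by (rule LIMSEQ_le_const2[OF tendsto_rabs[OF regularized_tendsto]], intro exI allI impI, rule regularized_bound) simp

text \<open>The regularization has two limits: the inverse transform pointwise, by its frequency
  form, and u when tested on a box, by its convolution form. The identity equates them.\<close>

lemma integral_box_eq:
  "(LINT w|lborel. indicator (box l r) w * inverse_transform w) = (LINT v|lborel. indicator (box l r) v * u v)"
proof -
  let ?Q = "\<lambda>w. indicator (box l r) w :: real"
  let ?d = "\<lambda>n. 1 / real (Suc n)"
  let ?M = "(LINT \<xi>|lborel. \<bar>cos_transform u \<xi>\<bar>) / (2 * pi) ^ DIM('a)"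
  have iQ: "integrable lborel (?Q :: 'a \<Rightarrow> real)"
    using emeasure_bounded_finite[OF bounded_box[of l r]] by (intro integrable_real_indicator) auto
  have 1: "(\<lambda>n. LINT w|lborel. ?Q w * regularized (?d n) w) \<longlonglongrightarrow> (LINT w|lborel. ?Q w * inverse_transform w)"
  proof (rule integral_dominated_convergence[where w = "\<lambda>w. ?Q w * ?M"])
    show "AE w in lborel. (\<lambda>n. ?Q w * regularized (?d n) w) \<longlonglongrightarrow> ?Q w * inverse_transform w"
      by (intro AE_I2 tendsto_mult tendsto_const regularized_tendsto)
    show "AE w in lborel. norm (?Q w * regularized (?d n) w) \<le> ?Q w * ?M" for n
      using regularized_bound[of "?d n"] by (auto simp: abs_mult indicator_def)
  qed (use iQ in auto)
  have 2: "(LINT w|lborel. ?Q w * regularized \<delta> w) = (LINT v|lborel. u v * (LINT y|lborel. heat_kernel 1 y * ?Q (v + sqrt \<delta> *\<^sub>R y)))"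
    if d: "\<delta> > 0" for \<delta>
  proof -
    define H where "H v w = ?Q w * (u v * heat_kernel \<delta> (w - v))" for v w
    define N where "N = sqrt (2 * pi / \<delta>) ^ DIM('a) / (2 * pi) ^ DIM('a)"
    have N: "\<bar>heat_kernel \<delta> z\<bar> \<le> N" for z
    proof -
      have "heat_kernel \<delta> z \<le> N"
        unfolding heat_kernel_def N_def by (intro divide_right_mono mult_left_le gauss_bounds(2)) (use d in auto)
      then show ?thesis using heat_kernel_nonneg[OF d, of z] by simp
    qed
    have H: "integrable (lborel \<Otimes>\<^sub>M lborel) (\<lambda>(v, w). H v w)"
    proof (rule Bochner_Integration.integrable_bound)
      show "integrable (lborel \<Otimes>\<^sub>M lborel) (\<lambda>z. u (fst z) * (?Q (snd z) * N))"
        by (intro lborel_pair.product_integral_mult(1)[OF u] integrable_mult_left iQ)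
      show "(\<lambda>(v, w). H v w) \<in> borel_measurable (lborel \<Otimes>\<^sub>M lborel)" unfolding H_def by measurable
      show "AE z in lborel \<Otimes>\<^sub>M lborel. norm (case z of (v, w) \<Rightarrow> H v w) \<le> norm (u (fst z) * (?Q (snd z) * N))"
        using order.trans[OF N abs_ge_self] by (intro AE_I2) (auto simp: H_def abs_mult indicator_def intro!: mult_left_mono)
    qed
    have "(LINT w|lborel. ?Q w * regularized \<delta> w) = (LINT w|lborel. LINT v|lborel. H v w)"
      by (simp add: H_def regularized_convolution[OF d])
    also have "\<dots> = (LINT v|lborel. LINT w|lborel. H v w)"
      by (rule lborel_pair.Fubini_integral[OF H])
    also have "\<dots> = (LINT v|lborel. u v * (LINT y|lborel. heat_kernel 1 y * ?Q (v + sqrt \<delta> *\<^sub>R y)))"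
    proof (rule Bochner_Integration.integral_cong[OF refl])
      fix v
      have "(LINT w|lborel. H v w) = u v * (LINT w|lborel. ?Q w * heat_kernel \<delta> (w - v))"
        unfolding H_def by (subst integral_mult_right_zero[symmetric]) (simp add: mult_ac)
      \<comment> \<open>The shift w = v + z and the scaling z = sqrt \<delta> y move the dependence
        on \<delta> from the kernel into the indicator.\<close>
      also have "(LINT w|lborel. ?Q w * heat_kernel \<delta> (w - v)) = (LINT z|lborel. ?Q (v + z) * heat_kernel \<delta> (v + z - v))"
        by (rule integral_lborel_shift[symmetric]) measurable
      also have "\<dots> = sqrt \<delta> ^ DIM('a) * (LINT y|lborel. ?Q (v + sqrt \<delta> *\<^sub>R y) * heat_kernel \<delta> (v + sqrt \<delta> *\<^sub>R y - v))"
        using d by (intro integral_lborel_scale) auto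
      also have "\<dots> = (LINT y|lborel. ?Q (v + sqrt \<delta> *\<^sub>R y) * (sqrt \<delta> ^ DIM('a) * heat_kernel \<delta> (sqrt \<delta> *\<^sub>R y)))"
        by (subst integral_mult_right_zero[symmetric]) (simp add: mult_ac)
      finally show "(LINT w|lborel. H v w) = u v * (LINT y|lborel. heat_kernel 1 y * ?Q (v + sqrt \<delta> *\<^sub>R y))"
        unfolding heat_kernel_scale[OF d] by (simp add: mult.commute)
    qed
    finally show ?thesis .
  qed
  have 3: "(\<lambda>n. LINT v|lborel. u v * (LINT y|lborel. heat_kernel 1 y * ?Q (v + sqrt (?d n) *\<^sub>R y))) \<longlonglongrightarrow> (LINT v|lborel. u v * ?Q v)"
  proof (rule integral_dominated_convergence[where w = "\<lambda>v. \<bar>u v\<bar>"])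
    have fr: "AE v in lborel. v \<notin> frontier (box l r)"
    proof -
      have "frontier (box l r) \<in> null_sets lebesgue"
        using negligible_convex_frontier[OF convex_box(2)[of l r]] by (simp add: negligible_iff_null_sets)
      then have "frontier (box l r) \<in> null_sets lborel"
        by (simp add: null_sets_completion_iff)
      then show ?thesis by (rule AE_not_in)
    qed
    show "AE v in lborel. (\<lambda>n. u v * (LINT y|lborel. heat_kernel 1 y * ?Q (v + sqrt (?d n) *\<^sub>R y))) \<longlonglongrightarrow> u v * ?Q v"
      using fr
    proof eventually_elim
      fix v assume v: "v \<notin> frontier (box l r)"
      have "(\<lambda>n. LINT y|lborel. heat_kernel 1 y * ?Q (v + sqrt (?d n) *\<^sub>R y)) \<longlonglongrightarrow> (LINT y|lborel. heat_kernel 1 y * ?Q v)"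
      proof (rule integral_dominated_convergence[where w = "heat_kernel 1"])
        show "AE y in lborel. (\<lambda>n. heat_kernel 1 y * ?Q (v + sqrt (?d n) *\<^sub>R y)) \<longlonglongrightarrow> heat_kernel 1 y * ?Q v"
          by (intro AE_I2 tendsto_mult tendsto_const box_indicator_locally_constant v)
      qed (use heat_kernel_integrable[of 1] heat_kernel_nonneg[of 1] in \<open>auto simp: indicator_def\<close>)
      then show "(\<lambda>n. u v * (LINT y|lborel. heat_kernel 1 y * ?Q (v + sqrt (?d n) *\<^sub>R y))) \<longlonglongrightarrow> u v * ?Q v"
        by (intro tendsto_mult tendsto_const) (simp add: heat_kernel_mass)
    qed
    show "AE v in lborel. norm (u v * (LINT y|lborel. heat_kernel 1 y * ?Q (v + sqrt (?d n) *\<^sub>R y))) \<le> \<bar>u v\<bar>" for n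
    proof (rule AE_I2)
      fix v
      have i: "integrable lborel (\<lambda>y. heat_kernel 1 y * ?Q (v + sqrt (?d n) *\<^sub>R y))"
        by (rule Bochner_Integration.integrable_bound[OF heat_kernel_integrable[of 1]]) (auto simp: indicator_def)
      have "(LINT y|lborel. heat_kernel 1 y * ?Q (v + sqrt (?d n) *\<^sub>R y)) \<le> (LINT y|lborel. heat_kernel 1 y)"
        using heat_kernel_nonneg[of 1] by (intro integral_mono i heat_kernel_integrable) (auto simp: indicator_def)
      moreover have "0 \<le> (LINT y|lborel. heat_kernel 1 y * ?Q (v + sqrt (?d n) *\<^sub>R y))"
        using heat_kernel_nonneg[of 1] by (intro integral_nonneg_AE AE_I2) auto
      ultimately show "norm (u v * (LINT y|lborel. heat_kernel 1 y * ?Q (v + sqrt (?d n) *\<^sub>R y))) \<le> \<bar>u v\<bar>"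
        by (simp add: abs_mult heat_kernel_mass mult_left_le)
    qed
  qed (use u in auto)
  have "(\<lambda>n. LINT w|lborel. ?Q w * regularized (?d n) w) \<longlonglongrightarrow> (LINT v|lborel. u v * ?Q v)"
    using 3 by (subst 2) auto
  from LIMSEQ_unique[OF 1 this] show ?thesis by (simp add: mult.commute)
qed

text \<open>Boxes are stable under intersection, generate the Borel sets and exhaust the space with
  finite measure; so the two densities define the same measure and agree almost everywhere.\<close>

theorem inversion: "AE v in lborel. u v = inverse_transform v"
proof -
  have eq: "emeasure (density lborel (\<lambda>v. ennreal (f v))) (box l r) = ennreal (LINT v|lborel. indicator (box l r) v * f v)"
    if [measurable]: "f \<in> borel_measurable borel" and f: "AE v in lborel. 0 \<le> f v" and i: "integrable lborel (\<lambda>v. indicator (box l r) v * f v)"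
    for f and l r :: 'a
  proof -
    have "emeasure (density lborel (\<lambda>v. ennreal (f v))) (box l r) = (\<integral>\<^sup>+v. ennreal (indicator (box l r) v * f v) \<partial>lborel)"
      by (subst emeasure_density) (auto intro!: nn_integral_cong simp: indicator_def)
    also have "\<dots> = ennreal (LINT v|lborel. indicator (box l r) v * f v)"
      using f by (intro nn_integral_eq_integral i) (auto elim!: eventually_mono simp: indicator_def)
    finally show ?thesis .
  qed
  have iu: "integrable lborel (\<lambda>v. indicator (box l r) v * u v)" for l r
    by (rule Bochner_Integration.integrable_bound[OF u]) (auto simp: indicator_def)
  have iw: "integrable lborel (\<lambda>v. indicator (box l r) v * inverse_transform v)" for l r
    by (rule integrableI_bounded_set[where A = "box l r"])
       (use inverse_transform_bound emeasure_bounded_finite[OF bounded_box[of l r]] in \<open>auto simp: abs_mult indicator_def\<close>)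
  have "density lborel (\<lambda>v. ennreal (u v)) = density lborel (\<lambda>v. ennreal (inverse_transform v))"
  proof (rule measure_eqI_generator_eq)
    let ?E = "range (\<lambda>(a, b). box a b::'a set)"
    show "Int_stable ?E" by (auto simp: Int_stable_def box_Int_box)
    show "?E \<subseteq> Pow UNIV" "sets (density lborel (\<lambda>v. ennreal (u v))) = sigma_sets UNIV ?E"
      "sets (density lborel (\<lambda>v. ennreal (inverse_transform v))) = sigma_sets UNIV ?E"
      by (simp_all add: borel_eq_box)
    let ?A = "\<lambda>n::nat. box (- (real n *\<^sub>R One)) (real n *\<^sub>R One) :: 'a set"
    show "range ?A \<subseteq> ?E" "(\<Union>i. ?A i) = UNIV" unfolding UN_box_eq_UNIV by auto
    show "emeasure (density lborel (\<lambda>v. ennreal (u v))) (?A i) \<noteq> \<infinity>" for i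
      by (subst eq[OF _ u0 iu]) auto
    show "emeasure (density lborel (\<lambda>v. ennreal (u v))) X = emeasure (density lborel (\<lambda>v. ennreal (inverse_transform v))) X" if X: "X \<in> ?E" for X
    proof -
      obtain a b where "X = box a b" using X by auto
      then show ?thesis
        using inverse_transform_nonneg by (simp add: eq[OF _ u0 iu] eq[OF _ _ iw] integral_box_eq)
    qed
  qed
  then have "AE v in lborel. ennreal (u v) = ennreal (inverse_transform v)"
    by (subst (asm) sigma_finite_measure.density_unique_iff[OF sigma_finite_lborel]) auto
  from this u0 show ?thesis by eventually_elim (simp add: inverse_transform_nonneg ennreal_inj)
qed

end

section \<open>From stretched exponential decay to Gevrey bounds\<close>

lemma power_le_fact_exp: "x ^ k / fact k \<le> exp x" if "0 \<le> x" for x :: real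
proof -
  have "(\<Sum>n\<in>{k}. x ^ n /\<^sub>R fact n) \<le> (\<Sum>n. x ^ n /\<^sub>R fact n)"
    using that by (intro sum_le_suminf summable_exp_generic) auto
  then show ?thesis by (simp add: exp_def divide_inverse mult.commute)
qed

text \<open>Raise y^k / k! <= exp y, with y = (c a / 2) r^a, to the power 2/a: the left side becomes
  a multiple of r^(2k), the exponent becomes c r^a, and the factorial enters with exponent 2/a,
  which the square root in the Gevrey norm halves to 1/a.\<close>

lemma even_power_le_stretched_exp:
  fixes a c r :: real
  assumes a: "a > 0" and c: "c > 0" and r: "r \<ge> 0"
  shows "r ^ (2 * k) \<le> fact k powr (2 / a) * ((2 / (c * a)) powr (2 / a)) ^ k * exp (c * r powr a)"
proof -
  define l where "l = c * a / 2"
  have l0: "l > 0" using a c by (simp add: l_def)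
  have "(l * r powr a) ^ k / fact k \<le> exp (l * r powr a)"
    using l0 by (intro power_le_fact_exp) auto
  then have "(r powr a) ^ k \<le> fact k * (1 / l) ^ k * exp (l * r powr a)"
    using l0 by (simp add: power_mult_distrib field_simps)
  then have 1: "((r powr a) ^ k) powr (2 / a) \<le> (fact k * (1 / l) ^ k * exp (l * r powr a)) powr (2 / a)"
    using a by (intro powr_mono2) auto
  have 2: "(fact k * (1 / l) ^ k * exp (l * r powr a)) powr (2 / a) =
      fact k powr (2 / a) * ((1 / l) ^ k) powr (2 / a) * exp (c * r powr a)"
  proof -
    have "exp (l * r powr a) powr (2 / a) = exp (c * r powr a)"
      using a by (simp add: powr_def l_def field_simps)
    then show ?thesis using l0 by (simp add: powr_mult)
  qed
  have 3: "((1 / l) ^ k) powr (2 / a) = ((2 / (c * a)) powr (2 / a)) ^ k"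
  proof -
    have "(z ^ k) powr q = (z powr q) ^ k" if "z > 0" for z q :: real
      using that by (simp add: powr_realpow[symmetric] powr_powr mult.commute)
    from this[of "1 / l" "2 / a"] show ?thesis using l0 by (simp add: l_def)
  qed
  have "r ^ (2 * k) \<le> ((r powr a) ^ k) powr (2 / a)"
  proof (cases "r = 0")
    case True
    then show ?thesis by (cases k) auto
  next
    case False
    then have "((r powr a) ^ k) powr (2 / a) = r powr (real (2 * k))"
      using r a by (simp add: powr_powr mult.commute flip: powr_realpow)
    moreover have "r powr (real (2 * k)) = r ^ (2 * k)" using False r by (intro powr_realpow) auto
    ultimately show ?thesis by simp
  qed
  with 1 2 3 show ?thesis by simp
qed

text \<open>The previous lemma with k equal to the dimension bounds the function by a multiple of
  the product of 1 / (1 + x_i^2) over the coordinates x_i, which is integrable factor by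
  factor.\<close>

lemma integrable_stretched_exp:
  fixes a c :: real
  assumes a: "a > 0" and c: "c > 0"
  shows "integrable lborel (\<lambda>\<xi>::'a::euclidean_space. exp (- c * norm \<xi> powr a))"
proof -
  define D where "D = DIM('a)"
  define M where "M = fact D powr (2 / a) * ((2 / (c * a)) powr (2 / a)) ^ D"
  have M0: "0 \<le> M" by (simp add: M_def)
  have "set_integrable lborel UNIV (\<lambda>x::real. inverse (1 + x\<^sup>2))"
    using integrable_inverse_1_plus_square by (simp add: einterval_def)
  then have "integrable lborel (\<lambda>x::real. inverse (1 + x\<^sup>2))" by (simp add: set_integrable_def)
  then have "integrable lborel (\<lambda>\<xi>::'a. 2 ^ D * (1 + M) * (\<Prod>b\<in>Basis. inverse (1 + (\<xi> \<bullet> b)\<^sup>2)))"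
    by (intro integrable_mult_right integral_lborel_prod(1))
  then show ?thesis
  proof (rule Bochner_Integration.integrable_bound)
    show "AE \<xi>::'a in lborel. norm (exp (- c * norm \<xi> powr a)) \<le> norm (2 ^ D * (1 + M) * (\<Prod>b\<in>Basis. inverse (1 + (\<xi> \<bullet> b)\<^sup>2)))"
    proof (rule AE_I2)
      fix \<xi> :: 'a
      define r where "r = norm \<xi>"
      have r: "0 \<le> r" by (simp add: r_def)
      have "(\<Prod>b\<in>Basis. 1 + (\<xi> \<bullet> b)\<^sup>2) \<le> (\<Prod>b\<in>(Basis::'a set). 1 + r\<^sup>2)"
      proof (rule prod_mono)
        fix b :: 'a assume b: "b \<in> Basis"
        have "\<bar>\<xi> \<bullet> b\<bar> \<le> r" using Basis_le_norm[OF b] by (simp add: r_def)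
        then have "(\<xi> \<bullet> b)\<^sup>2 \<le> r\<^sup>2" using abs_le_square_iff[of "\<xi> \<bullet> b" r] r by simp
        then show "0 \<le> 1 + (\<xi> \<bullet> b)\<^sup>2 \<and> 1 + (\<xi> \<bullet> b)\<^sup>2 \<le> 1 + r\<^sup>2" by simp
      qed
      also have "\<dots> = (1 + r\<^sup>2) ^ D" by (simp add: D_def)
      also have "\<dots> \<le> (2 * max 1 (r\<^sup>2)) ^ D" by (intro power_mono) auto
      also have "\<dots> = 2 ^ D * max 1 (r\<^sup>2) ^ D" by (simp add: power_mult_distrib)
      also have "max 1 (r\<^sup>2) ^ D \<le> 1 + r ^ (2 * D)"
        by (cases "r\<^sup>2 \<le> 1") (auto simp: max_def power_mult)
      also have "r ^ (2 * D) \<le> M * exp (c * r powr a)"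
        unfolding M_def by (rule even_power_le_stretched_exp[OF a c r])
      also have "1 + M * exp (c * r powr a) \<le> (1 + M) * exp (c * r powr a)"
        using c by (simp add: distrib_right)
      finally have "(\<Prod>b\<in>Basis. 1 + (\<xi> \<bullet> b)\<^sup>2) \<le> 2 ^ D * ((1 + M) * exp (c * r powr a))"
        by simp
      moreover have "0 < (\<Prod>b\<in>Basis. 1 + (\<xi> \<bullet> b)\<^sup>2)" by (intro prod_pos) (auto intro: add_pos_nonneg)
      ultimately have "exp (- c * r powr a) \<le> 2 ^ D * (1 + M) / (\<Prod>b\<in>Basis. 1 + (\<xi> \<bullet> b)\<^sup>2)"
        by (simp add: exp_minus field_simps)
      then show "norm (exp (- c * norm \<xi> powr a)) \<le> norm (2 ^ D * (1 + M) * (\<Prod>b\<in>Basis. inverse (1 + (\<xi> \<bullet> b)\<^sup>2)))"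
        using M0 by (simp add: r_def prod_inversef[symmetric] divide_inverse abs_mult prod_nonneg abs_of_nonneg)
    qed
  qed measurable
qed

lemma wave_integral_swap:
  fixes G \<psi> :: "'a::euclidean_space \<Rightarrow> real"
  assumes G: "integrable lborel G" and \<psi>: "integrable lborel \<psi>"
  shows "(LINT v|lborel. (LINT \<xi>|lborel. G \<xi> * cos (\<xi> \<bullet> v + \<beta>)) * \<psi> v) =
    (LINT \<xi>|lborel. G \<xi> * (LINT v|lborel. cos (\<xi> \<bullet> v + \<beta>) * \<psi> v))"
proof -
  note [measurable] = borel_measurable_integrable[OF G] borel_measurable_integrable[OF \<psi>]
  define H where "H \<xi> v = G \<xi> * cos (\<xi> \<bullet> v + \<beta>) * \<psi> v" for \<xi> v
  have H: "integrable (lborel \<Otimes>\<^sub>M lborel) (\<lambda>(\<xi>, v). H \<xi> v)"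
  proof (rule Bochner_Integration.integrable_bound[OF lborel_pair.product_integral_mult(1)[OF G \<psi>]])
    show "(\<lambda>(\<xi>, v). H \<xi> v) \<in> borel_measurable (lborel \<Otimes>\<^sub>M lborel)" unfolding H_def by measurable
    show "AE z in lborel \<Otimes>\<^sub>M lborel. norm (case z of (\<xi>, v) \<Rightarrow> H \<xi> v) \<le> norm (G (fst z) * \<psi> (snd z))"
      by (rule AE_I2) (auto simp: H_def abs_mult intro!: mult_right_mono mult_left_le)
  qed
  have "(LINT v|lborel. (LINT \<xi>|lborel. G \<xi> * cos (\<xi> \<bullet> v + \<beta>)) * \<psi> v) = (LINT v|lborel. LINT \<xi>|lborel. H \<xi> v)"
    by (simp add: H_def)
  also have "\<dots> = (LINT \<xi>|lborel. LINT v|lborel. H \<xi> v)" by (rule lborel_pair.Fubini_integral[OF H])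
  also have "\<dots> = (LINT \<xi>|lborel. G \<xi> * (LINT v|lborel. cos (\<xi> \<bullet> v + \<beta>) * \<psi> v))"
    by (simp add: H_def mult.assoc)
  finally show ?thesis .
qed

text \<open>The weak derivatives are exhibited explicitly: \<open>W I\<close> is the inverse
  transform of the cosine transform times the monomial of \<open>I\<close>, with phase pi/2 per
  derivative. Plancherel reduces the tensor norm of order k to the weight |\<xi>|^(2k), whose price
  against the decay is (k!)^(2/a).\<close>

theorem gevrey_of_cos_transform_decay:
  fixes u :: "real^'n::finite \<Rightarrow> real"
  assumes u: "integrable lborel u" "AE v in lborel. 0 \<le> u v"
    and sine: "\<And>\<xi>. (LINT v|lborel. u v * sin (\<xi> \<bullet> v)) = 0"
    and a: "a > 0" and c: "c > 0"
    and decay: "\<And>\<xi>. \<bar>cos_transform u \<xi>\<bar> \<le> A * exp (- c * norm \<xi> powr a)"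
  shows "u \<in> gevrey (1 / a)"
proof -
  let ?F = "cos_transform u"
  define P where "P = (2 * pi) ^ DIM(real^'n)"
  have "1 \<le> 2 * pi" using pi_gt3 by linarith
  then have P: "1 \<le> P" unfolding P_def by (rule one_le_power)
  have A: "0 \<le> A" using order.trans[OF abs_ge_zero decay[of 0]] by (simp add: zero_le_mult_iff)
  have [measurable]: "u \<in> borel_measurable borel" using borel_measurable_integrable[OF u(1)] by simp
  have Fm [measurable]: "?F \<in> borel_measurable borel" unfolding cos_transform_def[abs_def] by measurable
  have mm [measurable]: "frequency_monomial I \<in> borel_measurable borel" for I :: "'n list"
  proof -
    have "frequency_monomial I = (\<lambda>\<xi>. prod_list (map (\<lambda>i. \<xi> $ i) I))" by (simp add: frequency_monomial_def[abs_def])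
    also have "\<dots> \<in> borel_measurable borel" by (induction I) simp_all
    finally show ?thesis .
  qed
  have mono: "(frequency_monomial I \<xi>)\<^sup>2 \<le> norm \<xi> ^ (2 * length I)" for I and \<xi> :: "real^'n"
    using member_le_sum[of I "{J. length J = length I}" "\<lambda>J. (frequency_monomial J \<xi>)\<^sup>2"]
    by (simp add: finite_lists_of_length sum_frequency_monomials)
  define Q where "Q k = fact k powr (2 / a) * ((2 / (c * a)) powr (2 / a)) ^ k" for k
  have Q0: "0 \<le> Q k" for k by (simp add: Q_def)
  \<comment> \<open>Squaring the decay gives exp (-2 c |\<xi>|^a): one half pays for the power, the
    other half remains for integrability.\<close>
  have F2: "(?F \<xi>)\<^sup>2 * norm \<xi> ^ (2 * k) \<le> A\<^sup>2 * Q k * exp (- c * norm \<xi> powr a)" for \<xi> k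
  proof -
    have "(?F \<xi>)\<^sup>2 \<le> (A * exp (- c * norm \<xi> powr a))\<^sup>2"
      using decay[of \<xi>] A by (simp add: abs_le_square_iff[symmetric])
    then have "(?F \<xi>)\<^sup>2 * norm \<xi> ^ (2 * k) \<le> (A * exp (- c * norm \<xi> powr a))\<^sup>2 * (Q k * exp (c * norm \<xi> powr a))"
      unfolding Q_def by (intro mult_mono even_power_le_stretched_exp[OF a c]) auto
    also have "\<dots> = A\<^sup>2 * Q k * (exp (- c * norm \<xi> powr a) * exp (- c * norm \<xi> powr a) * exp (c * norm \<xi> powr a))"
      by (simp add: power2_eq_square)
    also have "exp (- c * norm \<xi> powr a) * exp (- c * norm \<xi> powr a) * exp (c * norm \<xi> powr a) = exp (- c * norm \<xi> powr a)"
      by (simp flip: exp_add)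
    finally show ?thesis .
  qed
  define G where "G I \<xi> = ?F \<xi> * frequency_monomial I \<xi>" for I \<xi>
  have Gm [measurable]: "G I \<in> borel_measurable borel" for I unfolding G_def by measurable
  have G2: "(G I \<xi>)\<^sup>2 \<le> A\<^sup>2 * Q (length I) * exp (- c * norm \<xi> powr a)" for I \<xi>
    using order.trans[OF mult_left_mono[OF mono, of "(?F \<xi>)\<^sup>2" I \<xi>] F2] by (simp add: G_def power_mult_distrib)
  have iG2: "integrable lborel (\<lambda>\<xi>. (G I \<xi>)\<^sup>2)" for I
    by (rule Bochner_Integration.integrable_bound[OF integrable_mult_right[OF integrable_stretched_exp[OF a c], of "A\<^sup>2 * Q (length I)"]])
       (use order.trans[OF G2 abs_ge_self] in auto)
  have iG: "integrable lborel (G I)" for I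
  proof (rule Bochner_Integration.integrable_bound)
    show "integrable lborel (\<lambda>\<xi>::real^'n. A * sqrt (Q (length I)) * exp (- (c / 2) * norm \<xi> powr a))"
      using c by (intro integrable_mult_right integrable_stretched_exp[OF a]) simp
    show "AE \<xi> in lborel. norm (G I \<xi>) \<le> norm (A * sqrt (Q (length I)) * exp (- (c / 2) * norm \<xi> powr a))"
    proof (rule AE_I2)
      fix \<xi> :: "real^'n"
      have "(A * sqrt (Q (length I)) * exp (- (c / 2) * norm \<xi> powr a))\<^sup>2 = A\<^sup>2 * Q (length I) * exp (- c * norm \<xi> powr a)"
        using Q0 by (simp add: power_mult_distrib flip: exp_double)
      then show "norm (G I \<xi>) \<le> norm (A * sqrt (Q (length I)) * exp (- (c / 2) * norm \<xi> powr a))"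
        using G2[of I \<xi>] by (simp add: abs_le_square_iff)
    qed
  qed measurable
  have iF: "integrable lborel ?F"
    using iG[of "[]"] by (simp add: G_def[abs_def] frequency_monomial_def)
  interpret cosine_inversion u
    by standard (rule u sine iF)+
  define V where "V I v = (LINT \<xi>|lborel. G I \<xi> * cos (\<xi> \<bullet> v + real (length I) * (pi / 2)))" for I v
  define W where "W I v = V I v / P" for I v
  have plancherel: "integrable lborel (\<lambda>v. (V I v)\<^sup>2)" "(LINT v|lborel. (V I v)\<^sup>2) \<le> P * (LINT \<xi>|lborel. (G I \<xi>)\<^sup>2)"
      "V I \<in> borel_measurable borel" for I
    unfolding V_def[abs_def] P_def by (rule plancherel_le[OF iG iG2])+
  have W2: "(W I v)\<^sup>2 = (V I v)\<^sup>2 / P\<^sup>2" for I v by (simp add: W_def power_divide)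
  have WL2: "W I \<in> L2" for I
  proof -
    have "W I \<in> borel_measurable borel" unfolding W_def[abs_def] using plancherel(3)[of I] by measurable
    then show ?thesis using plancherel(1)[of I] by (simp add: L2_def W2)
  qed
  have "inverse_transform = W []"
    by (simp add: fun_eq_iff inverse_transform_def W_def V_def P_def G_def frequency_monomial_def)
  \<comment> \<open>Equality almost everywhere suffices, as membership in \<open>L2\<close> and weak
    derivatives do not see null sets.\<close>
  then have uW: "AE v in lborel. u v = W [] v" using inversion by simp
  have "u \<in> L2"
  proof -
    have "integrable lborel (\<lambda>v. (W [] v)\<^sup>2)" using WL2[of "[]"] by (simp add: L2_def)
    then have "integrable lborel (\<lambda>v. (u v)\<^sup>2)"
      by (rule Bochner_Integration.integrable_bound) (use uW in \<open>auto elim!: eventually_mono\<close>)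
    then show ?thesis by (simp add: L2_def)
  qed
  moreover have "has_weak_partial u I (W I)" for I
    unfolding has_weak_partial_def
  proof
    fix \<phi> :: "real^'n \<Rightarrow> real" assume \<phi>: "\<phi> \<in> test_functions"
    obtain R where "R > 0" and R: "\<And>I x. R \<le> norm x \<Longrightarrow> partials I \<phi> x = 0"
      by (rule test_function_support[OF \<phi>]) (rule that)
    have ip: "integrable lborel (partials J \<phi>)" for J
      by (rule integrable_compact_support[OF partials_continuous[OF \<phi>] R])
    have i\<phi>: "integrable lborel \<phi>" using ip[of "[]"] by simp
    note [measurable] = borel_measurable_integrable[OF ip, of I]
    have "(LINT x|lborel. u x * partials I \<phi> x) = (LINT x|lborel. W [] x * partials I \<phi> x)"
      using uW WL2[of "[]"] by (intro integral_cong_AE) (auto elim!: eventually_mono simp: L2_def)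
    also have "\<dots> = (LINT x|lborel. V [] x * partials I \<phi> x) / P"
      by (simp add: W_def)
    also have "(LINT x|lborel. V [] x * partials I \<phi> x) = (LINT \<xi>|lborel. G [] \<xi> * (LINT v|lborel. cos (\<xi> \<bullet> v + 0) * partials I \<phi> v))"
      using wave_integral_swap[OF iG[of "[]"] ip[of I], of 0] by (simp add: V_def)
    also have "\<dots> = (LINT \<xi>|lborel. (- 1) ^ length I * (G I \<xi> * (LINT v|lborel. cos (\<xi> \<bullet> v + real (length I) * (pi / 2)) * \<phi> v)))"
      unfolding wave_partial_integral[OF \<phi>] by (simp add: G_def frequency_monomial_def mult_ac)
    also have "\<dots> = (- 1) ^ length I * (LINT v|lborel. V I v * \<phi> v)"
      unfolding integral_mult_right_zero V_def wave_integral_swap[OF iG i\<phi>] ..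
    finally show "(LINT x|lborel. u x * partials I \<phi> x) = (- 1) ^ length I * (LINT x|lborel. W I x * \<phi> x)"
      by (simp add: W_def)
  qed
  moreover have "\<exists>C>0. \<forall>k::nat. sqrt (\<Sum>I | length I = k. (L2_norm (W I))\<^sup>2) \<le> C ^ (k + 1) * (fact k) powr (1 / a)"
  proof -
    define J where "J = (LINT \<xi>::real^'n|lborel. exp (- c * norm \<xi> powr a))"
    have J: "0 \<le> J" by (simp add: J_def)
    define B where "B = (2 / (c * a)) powr (2 / a)"
    have B: "0 \<le> B" by (simp add: B_def)
    \<comment> \<open>\<open>A * sqrt J\<close> is absorbed by the extra factor in C^(k+1) and
      \<open>sqrt B\<close> by C^k; the 1 keeps C positive even when A = 0.\<close>
    define C where "C = max 1 (max (A * sqrt J) (sqrt B))"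
    have "sqrt (\<Sum>I | length I = k. (L2_norm (W I))\<^sup>2) \<le> C ^ (k + 1) * (fact k) powr (1 / a)" for k
    proof -
      have "(L2_norm (W I))\<^sup>2 \<le> (LINT \<xi>|lborel. (G I \<xi>)\<^sup>2)" for I
      proof -
        have "(L2_norm (W I))\<^sup>2 = (LINT v|lborel. (V I v)\<^sup>2) / P\<^sup>2"
          unfolding L2_norm_def W2 by simp
        also have "\<dots> \<le> (P * (LINT \<xi>|lborel. (G I \<xi>)\<^sup>2)) / P\<^sup>2"
          by (intro divide_right_mono plancherel(2)) simp
        also have "\<dots> = (LINT \<xi>|lborel. (G I \<xi>)\<^sup>2) / P" using P by (simp add: power2_eq_square)
        also have "\<dots> \<le> (LINT \<xi>|lborel. (G I \<xi>)\<^sup>2) / 1" using P by (intro divide_left_mono) auto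
        finally show ?thesis by simp
      qed
      then have "(\<Sum>I | length I = k. (L2_norm (W I))\<^sup>2) \<le> (\<Sum>I | length I = k. LINT \<xi>|lborel. (G I \<xi>)\<^sup>2)"
        by (intro sum_mono)
      also have "\<dots> = (LINT \<xi>|lborel. (\<Sum>I | length I = k. (G I \<xi>)\<^sup>2))"
        by (rule Bochner_Integration.integral_sum[symmetric]) (rule iG2)
      also have "\<dots> \<le> (LINT \<xi>::real^'n|lborel. A\<^sup>2 * Q k * exp (- c * norm \<xi> powr a))"
      proof (rule integral_mono)
        show "integrable lborel (\<lambda>\<xi>::real^'n. A\<^sup>2 * Q k * exp (- c * norm \<xi> powr a))"
          by (intro integrable_mult_right integrable_stretched_exp a c)
        show "(\<Sum>I | length I = k. (G I \<xi>)\<^sup>2) \<le> A\<^sup>2 * Q k * exp (- c * norm \<xi> powr a)" for \<xi>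
          using F2[of \<xi> k] by (simp add: G_def power_mult_distrib sum_distrib_left[symmetric] sum_frequency_monomials)
      qed (intro Bochner_Integration.integrable_sum iG2)
      also have "\<dots> = A\<^sup>2 * Q k * J" by (simp add: J_def)
      finally have "sqrt (\<Sum>I | length I = k. (L2_norm (W I))\<^sup>2) \<le> sqrt (A\<^sup>2 * Q k * J)" by simp
      also have "\<dots> = (A * sqrt J) * sqrt B ^ k * fact k powr (1 / a)"
      proof -
        have "sqrt (fact k powr (2 / a)) = fact k powr (1 / a)"
          by (simp add: powr_half_sqrt[symmetric] powr_powr)
        then show ?thesis using A by (simp add: Q_def B_def real_sqrt_mult real_sqrt_power)
      qed
      also have "\<dots> \<le> C * C ^ k * fact k powr (1 / a)"
        using A J B by (intro mult_right_mono mult_mono power_mono) (auto simp: C_def)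
      finally show ?thesis by simp
    qed
    moreover have "0 < C" by (simp add: C_def)
    ultimately show ?thesis by blast
  qed
  ultimately show ?thesis
    unfolding gevrey_def using WL2 by blast
qed

section \<open>The initial frequency gap\<close>

lemma sin_ge_quarter: "z / 4 \<le> sin z" if "0 \<le> z" "z \<le> pi / 2" for z :: real
proof (cases "z \<le> 1")
  case True
  then show ?thesis using sin_ge_half[of z] that by simp
next
  case False
  have "sin 1 \<le> sin z" using that False by (intro sin_monotone_2pi_le) auto
  then show ?thesis using sin_ge_half[of 1] pi_less_4 that by simp
qed

text \<open>The set where \<open>|sin (r v\<^sub>1)|\<close> is small is covered by slabs around the zeros.\<close>

lemma small_sine_measure:
  fixes r e R :: real
  assumes r: "r > 0" and e: "e > 0" and R: "R > 0"
  shows "\<exists>B. B \<in> fmeasurable lborel \<and> {v::real^3. norm v \<le> R \<and> \<bar>sin (r * v $ 1)\<bar> < e * min 1 r} \<subseteq> B \<and>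
     measure lborel B \<le> 32 * R\<^sup>2 * e * (2 * R + 3)"
proof -
  \<comment> \<open>Scaling the threshold by min 1 r makes the measure bound uniform in r: for small
    r the sine is itself of order r, and for large r the number of slabs grows like r while their
    width shrinks like 1/r.\<close>
  define q where "q = min 1 r"
  have q: "0 < q" "q \<le> 1" "q \<le> r" using r by (auto simp: q_def)
  \<comment> \<open>If z is the distance in phase to the nearest zero, |sin z| >= |z|/4 turns |sin
    z| < e q into |z| <= 4 e q; division by r gives the half-width of a slab.\<close>
  define w where "w = 4 * e * q / r"
  have w: "0 < w" using e q r by (simp add: w_def)
  define N where "N = \<lfloor>r * R\<rfloor> + 1"
  have N: "0 \<le> N" "real_of_int N \<le> r * R + 1" "r * R \<le> real_of_int N" using r R by (auto simp: N_def)
  define lo up where "lo k = (\<chi> i::3. if i = 1 then real_of_int k * pi / r - w else - R)"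
    and "up k = (\<chi> i::3. if i = 1 then real_of_int k * pi / r + w else R)" for k
  define B where "B = (\<Union>k\<in>{-N..N}. cbox (lo k) (up k))"
  have B: "B \<in> fmeasurable lborel"
    unfolding B_def by (rule fmeasurable.finite_UN) auto
  have sub: "{v::real^3. norm v \<le> R \<and> \<bar>sin (r * v $ 1)\<bar> < e * min 1 r} \<subseteq> B"
  proof clarify
    fix v :: "real^3" assume v: "norm v \<le> R" "\<bar>sin (r * v $ 1)\<bar> < e * min 1 r"
    have vi: "\<bar>v $ i\<bar> \<le> R" for i using component_le_norm_cart[of v i] v(1) by linarith
    define Y where "Y = r * v $ 1 / pi"
    define k where "k = round Y"
    define z where "z = r * v $ 1 - real_of_int k * pi"
    have "\<bar>real_of_int k - Y\<bar> \<le> 1 / 2" unfolding k_def by (rule of_int_round_abs_le)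
    then have k1: "\<bar>Y - real_of_int k\<bar> \<le> 1 / 2" by (simp add: abs_minus_commute)
    have "z = (Y - real_of_int k) * pi" by (simp add: z_def Y_def left_diff_distrib)
    then have "\<bar>z\<bar> = \<bar>Y - real_of_int k\<bar> * pi" by (simp add: abs_mult)
    also have "\<dots> \<le> 1 / 2 * pi" by (intro mult_right_mono k1) simp
    finally have z: "\<bar>z\<bar> \<le> pi / 2" by simp
    have "\<bar>sin (r * v $ 1)\<bar> = \<bar>sin z\<bar>"
    proof -
      have "r * v $ 1 = z + real_of_int k * pi" by (simp add: z_def)
      then have "sin (r * v $ 1) = sin z * cos (real_of_int k * pi) + cos z * sin (real_of_int k * pi)"
        by (simp add: sin_add)
      moreover have "sin (real_of_int k * pi) = 0" by (simp add: sin_zero_iff_int2) 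
      moreover have "\<bar>cos (real_of_int k * pi)\<bar> = 1"
        using sin_cos_squared_add[of "real_of_int k * pi"] \<open>sin (real_of_int k * pi) = 0\<close>
        by (simp add: power2_eq_1_iff) auto
      ultimately show ?thesis by (simp add: abs_mult)
    qed
    moreover have "\<bar>sin z\<bar> = sin \<bar>z\<bar>"
      using z sin_ge_zero[of "\<bar>z\<bar>"] pi_gt_zero by (cases "z \<ge> 0") (auto simp: abs_if split: if_splits)
    moreover have "\<bar>z\<bar> / 4 \<le> sin \<bar>z\<bar>" by (rule sin_ge_quarter) (use z in auto)
    ultimately have zq: "\<bar>z\<bar> \<le> 4 * e * q" using v(2) by (simp add: q_def)
    have "\<bar>v $ 1 - real_of_int k * pi / r\<bar> = \<bar>z\<bar> / r"
    proof -
      have "v $ 1 - real_of_int k * pi / r = z / r" using r by (simp add: z_def diff_divide_distrib)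
      then show ?thesis using r by (simp add: abs_divide)
    qed
    also have "\<dots> \<le> w" using zq r by (simp add: w_def divide_right_mono)
    finally have v1: "\<bar>v $ 1 - real_of_int k * pi / r\<bar> \<le> w" .
    have "\<bar>Y\<bar> \<le> r * R / 3"
    proof -
      have "\<bar>Y\<bar> = r * \<bar>v $ 1\<bar> / pi" using r by (simp add: Y_def abs_mult)
      also have "\<dots> \<le> r * R / 3" 
      proof (rule frac_le)
        show "r * \<bar>v $ 1\<bar> \<le> r * R" by (rule mult_left_mono[OF vi]) (use r in simp)
      qed (use r R pi_gt3 in simp_all)
      finally show ?thesis .
    qed
    then have "\<bar>real_of_int k\<bar> \<le> r * R / 3 + 1 / 2" using k1 by linarith
    also have "\<dots> < real_of_int N + 1"
    proof -
      have "0 < r * R" using r R by simp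
      then show ?thesis using N(3) by linarith
    qed
    finally have "\<bar>k\<bar> < N + 1" by linarith
    then have "k \<in> {-N..N}" by auto
    moreover have "v \<in> cbox (lo k) (up k)"
      using v1 vi by (auto simp: mem_box_cart lo_def up_def abs_le_iff minus_le_iff forall_3)
    ultimately show "v \<in> B" by (auto simp: B_def)
  qed
  have "measure lborel B \<le> (\<Sum>k\<in>{-N..N}. measure lborel (cbox (lo k) (up k)))"
    unfolding B_def by (intro measure_UNION_le) auto
  also have "\<dots> = (\<Sum>k\<in>{-N..N}. 2 * w * (2 * R) * (2 * R))"
  proof (rule sum.cong[OF refl])
    fix k
    have ne: "cbox (lo k) (up k) \<noteq> {}"
      using w R by (auto simp: interval_ne_empty_cart lo_def up_def)
    show "measure lborel (cbox (lo k) (up k)) = 2 * w * (2 * R) * (2 * R)"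
      unfolding content_cbox_cart[OF ne] UNIV_3 by (simp add: lo_def up_def)
  qed
  also have "\<dots> = (2 * real_of_int N + 1) * (8 * w * R\<^sup>2)"
    using N by (simp add: power2_eq_square)
  also have "\<dots> \<le> (2 * (r * R) + 3) * (8 * w * R\<^sup>2)"
    using N w by (intro mult_right_mono) auto
  also have "\<dots> = 32 * R\<^sup>2 * e * (2 * R * q + 3 * (q / r))"
    using r by (simp add: w_def field_simps)
  also have "\<dots> \<le> 32 * R\<^sup>2 * e * (2 * R * 1 + 3 * 1)"
    using q r e R by (intro mult_left_mono add_mono) auto
  finally show ?thesis using B sub by (intro exI[of _ B]) simp
qed

text \<open>Since |cos y| <= 1 - sin^2 y / 2, the loss of mass is at least half the integral of u
  sin^2 (r v_1). On a bounded set of positive measure u is bounded below, and the slabs where the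
  sine is small can be made too thin to cover that set, uniformly in r. One axis suffices, since
  radial symmetry transports the bound to all frequencies later.\<close>

lemma cos_transform_gap:
  fixes u :: "real^3 \<Rightarrow> real"
  assumes u: "integrable lborel u" and u0: "AE v in lborel. 0 \<le> u v" and pos: "0 < (LINT v|lborel. u v)"
  shows "\<exists>\<kappa>>0. \<kappa> \<le> 1 \<and> (\<forall>r\<ge>0. \<bar>cos_transform u (r *\<^sub>R axis 1 1)\<bar> \<le> (LINT v|lborel. u v) * (1 - \<kappa> * min (r\<^sup>2) 1))"
proof -
  have [measurable]: "u \<in> borel_measurable borel" using borel_measurable_integrable[OF u] by simp
  define A where "A n = {v::real^3. norm v \<le> real (Suc n) \<and> 1 / real (Suc n) \<le> u v}" for n
  have A [measurable]: "A n \<in> sets borel" for n unfolding A_def by measurable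
  have "\<exists>n. emeasure lborel (A n) \<noteq> 0"
  proof (rule ccontr)
    assume "\<not> ?thesis"
    then have "(\<Union>n. A n) \<in> null_sets lborel" by (intro null_sets_UN) auto
    then have "AE v in lborel. v \<notin> (\<Union>n. A n)" by (rule AE_not_in)
    then have "AE v in lborel. u v = 0"
      using u0
    proof eventually_elim
      fix v assume v: "v \<notin> (\<Union>n. A n)" "0 \<le> u v"
      show "u v = 0"
      proof (rule ccontr)
        assume "u v \<noteq> 0"
        with v have "0 < u v" by simp
        obtain n where n: "norm v + 1 / u v < real n" using reals_Archimedean2 by blast
        then have "norm v < real n" "1 / u v < real n" using \<open>0 < u v\<close> by (smt (verit) divide_pos_pos, smt (verit) norm_ge_zero)
        then have "v \<in> A n" using \<open>0 < u v\<close> by (auto simp: A_def field_simps)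
        then show False using v by blast
      qed
    qed
    then have "(LINT v|lborel. u v) = 0" by (subst integral_cong_AE[where g = "\<lambda>_. 0"]) auto
    then show False using pos by simp
  qed
  then obtain n where n: "emeasure lborel (A n) \<noteq> 0" by blast
  define R where "R = real (Suc n)"
  have R: "R > 0" by (simp add: R_def)
  have fA: "A n \<in> fmeasurable lborel"
  proof (rule fmeasurableI)
    have "emeasure lborel (A n) \<le> emeasure lborel (cball (0::real^3) R)"
      by (intro emeasure_mono) (auto simp: A_def R_def)
    also have "\<dots> < \<infinity>" using emeasure_bounded_finite[OF bounded_cball[of "0::real^3" R]] by simp
    finally show "emeasure lborel (A n) < \<infinity>" .
  qed simp
  define a where "a = measure lborel (A n)"
  have a: "0 < a"
    using n fA unfolding a_def by (simp add: emeasure_eq_measure2 zero_less_measure_iff)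
  \<comment> \<open>Chosen so that the slab bound 32 R^2 e (2 R + 3) is exactly a / 2, leaving at
    least half of \<open>A n\<close>.\<close>
  define e where "e = a / (64 * R\<^sup>2 * (2 * R + 3))"
  have e: "e > 0" using a R by (simp add: e_def add_pos_pos)
  define M where "M = (LINT v|lborel. u v)"
  \<comment> \<open>The second entry is the product of 1/2, the lower bound e^2 / R for u sin^2 /
    q^2 and the remaining measure a/2, relative to the mass M.\<close>
  define \<kappa> where "\<kappa> = min 1 (e\<^sup>2 * a / (4 * R * M))"
  have \<kappa>: "0 < \<kappa>" "\<kappa> \<le> 1" using e a R pos by (auto simp: \<kappa>_def M_def)
  have "\<bar>cos_transform u (r *\<^sub>R axis 1 1)\<bar> \<le> M * (1 - \<kappa> * min (r\<^sup>2) 1)" if r: "0 < r" for r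
  proof -
    define q where "q = min 1 r"
    have q: "0 < q" "q\<^sup>2 = min (r\<^sup>2) 1" using r by (auto simp: q_def min_def power_le_one_iff abs_square_le_1)
    obtain B where B: "B \<in> fmeasurable lborel" "{v::real^3. norm v \<le> R \<and> \<bar>sin (r * v $ 1)\<bar> < e * q} \<subseteq> B"
      "measure lborel B \<le> 32 * R\<^sup>2 * e * (2 * R + 3)"
      using small_sine_measure[OF r e R] unfolding q_def by blast
    have "32 * R\<^sup>2 * e * (2 * R + 3) = a / 2"
    proof -
      define X where "X = 32 * R\<^sup>2 * (2 * R + 3)"
      have "X > 0" using R by (simp add: X_def add_pos_pos)
      moreover have "e = a / (2 * X)" "32 * R\<^sup>2 * e * (2 * R + 3) = X * e" by (simp_all add: e_def X_def)
      ultimately show ?thesis by simp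
    qed
    then have mB: "measure lborel B \<le> a / 2" using B(3) by simp
    have sB: "B \<in> sets lborel" using B(1) by (rule fmeasurableD)
    have "a \<le> measure lborel (A n \<union> B)"
      unfolding a_def by (rule measure_mono_fmeasurable) (use fA B(1) in \<open>auto intro: fmeasurable.Un\<close>)
    also have "A n \<union> B = (A n - B) \<union> B" by auto
    also have "measure lborel \<dots> \<le> measure lborel (A n - B) + measure lborel B"
      by (rule measure_Un_le) (use sB in auto)
    finally have dm: "a / 2 \<le> measure lborel (A n - B)" using mB by simp
    have fD: "A n - B \<in> fmeasurable lborel" using fA B(1) by (auto intro: fmeasurable_Diff)
    have isn: "integrable lborel (\<lambda>v. u v * (sin (r * v $ 1))\<^sup>2)"
      by (rule Bochner_Integration.integrable_bound[OF u]) (auto simp: abs_mult mult_left_le abs_square_le_1)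
    have "(1 / R * (e * q)\<^sup>2) * (a / 2) \<le> (1 / R * (e * q)\<^sup>2) * measure lborel (A n - B)"
      using dm R by (intro mult_left_mono) auto
    also have "\<dots> = (LINT v|lborel. (1 / R * (e * q)\<^sup>2) * indicator (A n - B) v)"
      by simp
    also have "\<dots> \<le> (LINT v|lborel. u v * (sin (r * v $ 1))\<^sup>2)"
    proof (rule integral_mono_AE)
      show "integrable lborel (\<lambda>v. (1 / R * (e * q)\<^sup>2) * indicator (A n - B) v)"
        using fD by (intro integrable_mult_right integrable_real_indicator) (auto simp: fmeasurable_def)
      show "AE v in lborel. (1 / R * (e * q)\<^sup>2) * indicator (A n - B) v \<le> u v * (sin (r * v $ 1))\<^sup>2"
        using u0
      proof eventually_elim
        fix v assume v: "0 \<le> u v"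
        show "(1 / R * (e * q)\<^sup>2) * indicator (A n - B) v \<le> u v * (sin (r * v $ 1))\<^sup>2"
        proof (cases "v \<in> A n - B")
          case True
          then have "1 / R \<le> u v" "norm v \<le> R" by (auto simp: A_def R_def)
          then have "\<not> \<bar>sin (r * v $ 1)\<bar> < e * q" using True B(2) by blast
          then have "(e * q)\<^sup>2 \<le> (sin (r * v $ 1))\<^sup>2"
            using e q by (simp add: abs_le_square_iff[symmetric])
          with \<open>1 / R \<le> u v\<close> v have "1 / R * (e * q)\<^sup>2 \<le> u v * (sin (r * v $ 1))\<^sup>2"
            by (intro mult_mono) auto
          then show ?thesis using True by simp
        qed (use v in auto)
      qed
    qed (rule isn)
    finally have low: "(1 / R * (e * q)\<^sup>2) * (a / 2) \<le> (LINT v|lborel. u v * (sin (r * v $ 1))\<^sup>2)" .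
    have ic: "integrable lborel (\<lambda>v. u v * cos ((r *\<^sub>R axis 1 1) \<bullet> v))"
      by (rule Bochner_Integration.integrable_bound[OF u]) (auto simp: abs_mult mult_left_le)
    have "\<bar>cos_transform u (r *\<^sub>R axis 1 1)\<bar> \<le> (LINT v|lborel. \<bar>u v * cos ((r *\<^sub>R axis 1 1) \<bullet> v)\<bar>)"
      unfolding cos_transform_def by (rule integral_abs_bound)
    also have "\<dots> \<le> (LINT v|lborel. u v - 1 / 2 * (u v * (sin (r * v $ 1))\<^sup>2))"
    proof (rule integral_mono_AE)
      show "AE v in lborel. \<bar>u v * cos ((r *\<^sub>R axis 1 1) \<bullet> v)\<bar> \<le> u v - 1 / 2 * (u v * (sin (r * v $ 1))\<^sup>2)"
        using u0
      proof eventually_elim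
        fix v :: "real^3" assume v: "0 \<le> u v"
        let ?x = "r * v $ 1"
        have "(sin ?x)\<^sup>2 = (1 - \<bar>cos ?x\<bar>) * (1 + \<bar>cos ?x\<bar>)"
          by (simp add: sin_squared_eq algebra_simps power2_eq_square)
        also have "\<dots> \<le> (1 - \<bar>cos ?x\<bar>) * 2" by (intro mult_left_mono) auto
        finally have "\<bar>cos ?x\<bar> \<le> 1 - 1 / 2 * (sin ?x)\<^sup>2" by simp
        from mult_left_mono[OF this v] show "\<bar>u v * cos ((r *\<^sub>R axis 1 1) \<bullet> v)\<bar> \<le> u v - 1 / 2 * (u v * (sin (r * v $ 1))\<^sup>2)"
          using v by (simp add: inner_axis' abs_mult algebra_simps)
      qed
    qed (use ic u isn in auto)
    also have "\<dots> = M - 1 / 2 * (LINT v|lborel. u v * (sin (r * v $ 1))\<^sup>2)"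
      using u isn by (subst Bochner_Integration.integral_diff) (auto simp: M_def)
    also have "\<dots> \<le> M - 1 / 2 * ((1 / R * (e * q)\<^sup>2) * (a / 2))"
      by (rule diff_left_mono, rule mult_left_mono[OF low]) simp
    also have "\<dots> = M - M * (e\<^sup>2 * a / (4 * R * M)) * q\<^sup>2"
      using pos by (simp add: M_def power_mult_distrib)
    also have "\<dots> \<le> M - M * \<kappa> * q\<^sup>2"
      using pos by (intro diff_left_mono mult_right_mono mult_left_mono) (auto simp: \<kappa>_def M_def)
    finally show ?thesis by (simp add: q algebra_simps)
  qed
  moreover have "\<bar>cos_transform u (0 *\<^sub>R axis 1 1)\<bar> \<le> M * (1 - \<kappa> * min (0\<^sup>2) 1)"
    using pos by (simp add: cos_transform_def M_def)
  ultimately have "\<forall>r\<ge>0. \<bar>cos_transform u (r *\<^sub>R axis 1 1)\<bar> \<le> M * (1 - \<kappa> * min (r\<^sup>2) 1)"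
    by (metis order_le_less)
  then show ?thesis using \<kappa> unfolding M_def by blast
qed

section \<open>Evolution of the Fourier modes\<close>

lemma sphere_to_borel: "(\<lambda>\<sigma>. \<sigma>) \<in> sphere_measure \<rightarrow>\<^sub>M borel"
  unfolding measurable_cong_sets[OF sets_sphere_measure refl] by (intro measurable_restrict_space1) simp

text \<open>The change of velocity is Bobylev's \<open>neg_part\<close> of the relative velocity, so
  the formulas of \<open>norm_parts\<close> also measure |v' - v|.\<close>

lemma post_v_neg_part: "post_v v w \<sigma> = v - neg_part (v - w) \<sigma>"
proof -
  have "v - (1 / 2) *\<^sub>R (v - w) = (1 / 2) *\<^sub>R (v + w)"
    by (simp add: vec_eq_iff field_simps)
  then show ?thesis
    by (simp add: post_v_def neg_part_def scaleR_right_diff_distrib algebra_simps)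
qed

lemma norm_post_v_diff:
  assumes "norm \<sigma> = 1"
  shows "norm (post_v v w \<sigma> - v) = norm (v - w) * sqrt ((1 - cos_dev v w \<sigma>) / 2)"
proof -
  have "norm (post_v v w \<sigma> - v) = norm (neg_part (v - w) \<sigma>)" by (simp add: post_v_neg_part)
  then show ?thesis using norm_parts(3)[OF assms, of "v - w"] by (simp add: deviation_def cos_dev_def)
qed

lemma pos_plus_neg: "pos_part \<xi> \<sigma> + neg_part \<xi> \<sigma> = \<xi>"
  by (simp add: pos_part_def neg_part_def vec_eq_iff field_simps)

lemma abs_cos_dev_le: "norm \<sigma> = 1 \<Longrightarrow> \<bar>cos_dev v w \<sigma>\<bar> \<le> 1"
  unfolding cos_dev_def by (rule abs_inner_sphere_le) (cases "v = w"; simp)+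

section \<open>Angular averages of test functions and Bobylev's identity\<close>

context singular_kernel
begin

text \<open>The axis is an arbitrary choice; it gives a name to the value that
  \<open>momentum_transfer\<close> asserts for all directions.\<close>

definition transfer_constant :: real where
  "transfer_constant = (LINT \<sigma>|sphere_measure. b (axis 1 1 \<bullet> (\<sigma> :: real^3)) * sqrt ((1 - axis 1 1 \<bullet> \<sigma>) / 2))"

lemma transfer_constant:
  "0 \<le> transfer_constant"
  "norm (m::real^3) = 1 \<Longrightarrow> integrable sphere_measure (\<lambda>\<sigma>. b (m \<bullet> \<sigma>) * sqrt ((1 - m \<bullet> \<sigma>) / 2))"
  "norm (m::real^3) = 1 \<Longrightarrow> (LINT \<sigma>|sphere_measure. b (m \<bullet> \<sigma>) * sqrt ((1 - m \<bullet> \<sigma>) / 2)) = transfer_constant"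
proof -
  obtain C where C: "0 \<le> C" "\<And>m::real^3. norm m = 1 \<Longrightarrow> integrable sphere_measure (\<lambda>\<sigma>. b (m \<bullet> \<sigma>) * sqrt ((1 - m \<bullet> \<sigma>) / 2))"
      "\<And>m::real^3. norm m = 1 \<Longrightarrow> (LINT \<sigma>|sphere_measure. b (m \<bullet> \<sigma>) * sqrt ((1 - m \<bullet> \<sigma>) / 2)) = C"
    using momentum_transfer by blast
  have "transfer_constant = C" unfolding transfer_constant_def by (rule C(3)) (simp add: norm_axis_1)
  then show "0 \<le> transfer_constant"
    "norm (m::real^3) = 1 \<Longrightarrow> integrable sphere_measure (\<lambda>\<sigma>. b (m \<bullet> \<sigma>) * sqrt ((1 - m \<bullet> \<sigma>) / 2))"
    "norm (m::real^3) = 1 \<Longrightarrow> (LINT \<sigma>|sphere_measure. b (m \<bullet> \<sigma>) * sqrt ((1 - m \<bullet> \<sigma>) / 2)) = transfer_constant"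
    using C by auto
qed

text \<open>The difference of test values stays inside the angular integral, since the kernel alone
  has infinite total mass on the sphere.\<close>

definition mean_change :: "(real^3 \<Rightarrow> real) \<Rightarrow> real^3 \<Rightarrow> real^3 \<Rightarrow> real" where
  "mean_change \<phi> v w = (LINT \<sigma>|sphere_measure. b (cos_dev v w \<sigma>) * (\<phi> (post_v v w \<sigma>) - \<phi> v))"

lemma change_measurable [measurable]:
  assumes [measurable]: "\<phi> \<in> borel_measurable borel"
  shows "(\<lambda>(p, \<sigma>). b (cos_dev (fst p) (snd p) \<sigma>) * (\<phi> (post_v (fst p) (snd p) \<sigma>) - \<phi> (fst p)))
     \<in> borel_measurable ((borel \<Otimes>\<^sub>M borel) \<Otimes>\<^sub>M sphere_measure)"
proof -
  have [measurable]: "snd \<in> (borel \<Otimes>\<^sub>M borel) \<Otimes>\<^sub>M sphere_measure \<rightarrow>\<^sub>M (borel :: (real^3) measure)"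
    by (rule measurable_compose[OF measurable_snd sphere_to_borel])
  have "(\<lambda>z. b (cos_dev (fst (fst z)) (snd (fst z)) (snd z))) \<in> borel_measurable ((borel \<Otimes>\<^sub>M borel) \<Otimes>\<^sub>M sphere_measure)"
  proof (rule angular_kernel_measurable[OF b])
    show "(\<lambda>z. cos_dev (fst (fst z)) (snd (fst z)) (snd z)) \<in> borel_measurable ((borel \<Otimes>\<^sub>M borel) \<Otimes>\<^sub>M sphere_measure)"
      unfolding cos_dev_def by measurable
    show "\<bar>cos_dev (fst (fst z)) (snd (fst z)) (snd z)\<bar> \<le> 1" if "z \<in> space ((borel \<Otimes>\<^sub>M borel) \<Otimes>\<^sub>M sphere_measure)" for z
      using that by (intro abs_cos_dev_le) (auto simp: space_pair_measure)
  qed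
  then show ?thesis
    unfolding case_prod_unfold post_v_def by measurable
qed

lemma mean_change_measurable:
  assumes "\<phi> \<in> borel_measurable borel"
  shows "(\<lambda>p. mean_change \<phi> (fst p) (snd p)) \<in> borel_measurable (borel \<Otimes>\<^sub>M borel)"
  unfolding mean_change_def
  using sphere.borel_measurable_lebesgue_integral[OF change_measurable[OF assms]] .

text \<open>The displacement |v' - v| = |v - w| sin (\<theta>/2) compensates the singularity of the
  kernel; beyond the Lipschitz constant nothing of \<phi> enters.\<close>

lemma change_bound:
  assumes L: "\<And>v w. \<bar>\<phi> v - \<phi> w\<bar> \<le> L * norm (v - w)" and \<sigma>: "\<sigma> \<in> space sphere_measure"
  shows "\<bar>b (cos_dev v w \<sigma>) * (\<phi> (post_v v w \<sigma>) - \<phi> v)\<bar> \<le> L * norm (v - w) * (b (cos_dev v w \<sigma>) * sqrt ((1 - cos_dev v w \<sigma>) / 2))"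
proof -
  have n: "norm \<sigma> = 1" using \<sigma> by simp
  have "0 \<le> b (cos_dev v w \<sigma>)" by (rule angular_kernel_nonneg[OF b abs_cos_dev_le[OF n]])
  moreover have "\<bar>\<phi> (post_v v w \<sigma>) - \<phi> v\<bar> \<le> L * (norm (v - w) * sqrt ((1 - cos_dev v w \<sigma>) / 2))"
    using L[of "post_v v w \<sigma>" v] norm_post_v_diff[OF n, of v w] by simp
  ultimately have "b (cos_dev v w \<sigma>) * \<bar>\<phi> (post_v v w \<sigma>) - \<phi> v\<bar> \<le> b (cos_dev v w \<sigma>) * (L * (norm (v - w) * sqrt ((1 - cos_dev v w \<sigma>) / 2)))"
    by (intro mult_left_mono)
  then show ?thesis using \<open>0 \<le> b (cos_dev v w \<sigma>)\<close> by (simp add: abs_mult mult_ac)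
qed

lemma change_dominated:
  fixes v w :: "real^3"
  assumes "v \<noteq> w"
  shows "integrable sphere_measure (\<lambda>\<sigma>. L * norm (v - w) * (b (cos_dev v w \<sigma>) * sqrt ((1 - cos_dev v w \<sigma>) / 2)))"
    and "(LINT \<sigma>|sphere_measure. L * norm (v - w) * (b (cos_dev v w \<sigma>) * sqrt ((1 - cos_dev v w \<sigma>) / 2))) = L * norm (v - w) * transfer_constant"
proof -
  have m: "norm ((v - w) /\<^sub>R norm (v - w)) = 1" using assms by simp
  show "integrable sphere_measure (\<lambda>\<sigma>. L * norm (v - w) * (b (cos_dev v w \<sigma>) * sqrt ((1 - cos_dev v w \<sigma>) / 2)))"
    unfolding cos_dev_def by (intro integrable_mult_right transfer_constant(2) m)
  show "(LINT \<sigma>|sphere_measure. L * norm (v - w) * (b (cos_dev v w \<sigma>) * sqrt ((1 - cos_dev v w \<sigma>) / 2))) = L * norm (v - w) * transfer_constant"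
    unfolding cos_dev_def integral_mult_right_zero transfer_constant(3)[OF m] ..
qed

lemma change_measurable_fixed:
  assumes "\<phi> \<in> borel_measurable borel"
  shows "(\<lambda>\<sigma>. b (cos_dev v w \<sigma>) * (\<phi> (post_v v w \<sigma>) - \<phi> v)) \<in> borel_measurable sphere_measure"
  using measurable_compose[OF measurable_Pair1' change_measurable[OF assms], of "(v, w)"] by (simp add: space_pair_measure)

text \<open>For v = w the direction of v - w is undefined and \<open>cos_dev\<close> takes its
  default 0, where \<open>b\<close> need not vanish; this is harmless because then v' = v.\<close>

lemma mean_change_diag: "mean_change \<phi> v v = 0"
  by (simp add: mean_change_def post_v_neg_part neg_part_def)

lemma mean_change_bound:
  assumes [measurable]: "\<phi> \<in> borel_measurable borel" and L: "\<And>v w. \<bar>\<phi> v - \<phi> w\<bar> \<le> L * norm (v - w)" and L0: "0 \<le> L"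
  shows "\<bar>mean_change \<phi> v w\<bar> \<le> L * transfer_constant * (norm v + norm w)"
proof (cases "v = w")
  case True
  then show ?thesis using L0 transfer_constant(1) by (simp add: mean_change_diag)
next
  case False
  have "\<bar>mean_change \<phi> v w\<bar> \<le> (LINT \<sigma>|sphere_measure. \<bar>b (cos_dev v w \<sigma>) * (\<phi> (post_v v w \<sigma>) - \<phi> v)\<bar>)"
    unfolding mean_change_def by (rule integral_abs_bound)
  also have "\<dots> \<le> (LINT \<sigma>|sphere_measure. L * norm (v - w) * (b (cos_dev v w \<sigma>) * sqrt ((1 - cos_dev v w \<sigma>) / 2)))"
  proof (rule integral_mono)
    show "integrable sphere_measure (\<lambda>\<sigma>. \<bar>b (cos_dev v w \<sigma>) * (\<phi> (post_v v w \<sigma>) - \<phi> v)\<bar>)"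
      by (rule Bochner_Integration.integrable_bound[OF change_dominated(1)[OF False, of L]])
         (use change_measurable_fixed[OF assms(1)] change_bound[OF L] in \<open>auto intro!: AE_I2 order.trans[OF _ abs_ge_self]\<close>)
  qed (use change_dominated(1)[OF False] change_bound[OF L] in auto)
  also have "\<dots> = L * norm (v - w) * transfer_constant" by (rule change_dominated(2)[OF False])
  also have "\<dots> \<le> L * (norm v + norm w) * transfer_constant"
    using L0 transfer_constant(1) norm_triangle_ineq4[of v w] by (intro mult_right_mono mult_left_mono) auto
  finally show ?thesis by (simp add: mult_ac)
qed

lemma mean_change_tendsto:
  fixes \<phi> :: "nat \<Rightarrow> real^3 \<Rightarrow> real"
  assumes m: "\<And>n. \<phi> n \<in> borel_measurable borel" "\<psi> \<in> borel_measurable borel"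
    and L: "\<And>n v w. \<bar>\<phi> n v - \<phi> n w\<bar> \<le> L * norm (v - w)"
    and lim: "\<And>v. (\<lambda>n. \<phi> n v) \<longlonglongrightarrow> \<psi> v"
  shows "(\<lambda>n. mean_change (\<phi> n) v w) \<longlonglongrightarrow> mean_change \<psi> v w"
proof (cases "v = w")
  case False
  show ?thesis
    unfolding mean_change_def
  proof (rule integral_dominated_convergence[OF change_measurable_fixed[OF m(2)] change_measurable_fixed[OF m(1)] change_dominated(1)[OF False, of L]])
    show "AE \<sigma> in sphere_measure. (\<lambda>n. b (cos_dev v w \<sigma>) * (\<phi> n (post_v v w \<sigma>) - \<phi> n v)) \<longlonglongrightarrow> b (cos_dev v w \<sigma>) * (\<psi> (post_v v w \<sigma>) - \<psi> v)"
      by (intro AE_I2 tendsto_intros lim)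
    show "AE \<sigma> in sphere_measure. norm (b (cos_dev v w \<sigma>) * (\<phi> n (post_v v w \<sigma>) - \<phi> n v)) \<le> L * norm (v - w) * (b (cos_dev v w \<sigma>) * sqrt ((1 - cos_dev v w \<sigma>) / 2))" for n
      unfolding real_norm_def by (intro AE_I2 change_bound L)
  qed
qed (simp add: mean_change_diag)

text \<open>Bobylev's identity: the phase of the post-collisional wave depends on \<open>\<sigma>\<close> only through \<open>\<xi> \<bullet> \<sigma>\<close>, and exchanging the
  directions of \<open>\<xi>\<close> and \<open>v - w\<close> on the sphere moves the angular variable of the kernel from velocities to frequencies.\<close>

lemma mean_change_wave:
  fixes \<xi> :: "real^3"
  assumes \<xi>: "\<xi> \<noteq> 0"
  shows "mean_change (\<lambda>v. cos (\<xi> \<bullet> v)) v w =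
    (LINT \<sigma>|sphere_measure. b ((\<xi> /\<^sub>R norm \<xi>) \<bullet> \<sigma>) * (cos (pos_part \<xi> \<sigma> \<bullet> v + neg_part \<xi> \<sigma> \<bullet> w) - cos (\<xi> \<bullet> v)))"
proof (cases "v = w")
  case True
  have "pos_part \<xi> \<sigma> \<bullet> v + neg_part \<xi> \<sigma> \<bullet> v = \<xi> \<bullet> v" for \<sigma>
    by (simp add: inner_add_left[symmetric] pos_plus_neg)
  then show ?thesis using True by (simp add: mean_change_diag)
next
  case False
  define m where "m = \<xi> /\<^sub>R norm \<xi>"
  define n where "n = (v - w) /\<^sub>R norm (v - w)"
  have mn: "norm m = 1" "norm n = 1" using \<xi> False by (auto simp: m_def n_def)
  \<comment> \<open>Both sides have the phase \<xi> . (v + w) / 2 + |v - w| |\<xi>| y / 2; they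
    differ only in which of the two cosines feeds the kernel and which one the phase.\<close>
  define f where "f x y = b x * (cos (\<xi> \<bullet> (v + w) / 2 + norm (v - w) * norm \<xi> / 2 * y) - cos (\<xi> \<bullet> v))" for x y
  have x: "\<xi> \<bullet> \<sigma> = norm \<xi> * (m \<bullet> \<sigma>)" "(v - w) \<bullet> \<sigma> = norm (v - w) * (n \<bullet> \<sigma>)" for \<sigma>
    using \<xi> False by (auto simp: m_def n_def)
  have 1: "f (n \<bullet> \<sigma>) (m \<bullet> \<sigma>) = b (cos_dev v w \<sigma>) * (cos (\<xi> \<bullet> post_v v w \<sigma>) - cos (\<xi> \<bullet> v))" for \<sigma>
  proof -
    have "\<xi> \<bullet> post_v v w \<sigma> = \<xi> \<bullet> (v + w) / 2 + norm (v - w) / 2 * (\<xi> \<bullet> \<sigma>)"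
      by (simp add: post_v_def inner_add_right)
    then show ?thesis by (simp add: f_def cos_dev_def n_def[symmetric] x mult_ac)
  qed
  have 2: "f (m \<bullet> \<sigma>) (n \<bullet> \<sigma>) = b (m \<bullet> \<sigma>) * (cos (pos_part \<xi> \<sigma> \<bullet> v + neg_part \<xi> \<sigma> \<bullet> w) - cos (\<xi> \<bullet> v))" for \<sigma>
  proof -
    have "pos_part \<xi> \<sigma> \<bullet> v + neg_part \<xi> \<sigma> \<bullet> w = \<xi> \<bullet> (v + w) / 2 + norm \<xi> / 2 * ((v - w) \<bullet> \<sigma>)"
      unfolding pos_part_def neg_part_def inner_scaleR_left inner_add_left inner_diff_left inner_add_right
      by (simp add: inner_commute[of \<sigma>] field_simps)
    then show ?thesis by (simp add: f_def x mult_ac)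
  qed
  have "(LINT \<sigma>|sphere_measure. f (n \<bullet> \<sigma>) (m \<bullet> \<sigma>)) = (LINT \<sigma>|sphere_measure. f (m \<bullet> \<sigma>) (n \<bullet> \<sigma>))"
  proof (rule sphere_integral_swap)
    have [measurable]: "(\<lambda>\<sigma>. b (m \<bullet> \<sigma>)) \<in> borel_measurable sphere_measure"
      using mn by (intro angular_kernel_measurable[OF b]) (auto intro!: abs_inner_sphere_le)
    show "(\<lambda>\<sigma>. f (m \<bullet> \<sigma>) (n \<bullet> \<sigma>)) \<in> borel_measurable sphere_measure" unfolding f_def by measurable
  qed (simp add: mn)
  then show ?thesis unfolding 1 2 by (simp add: mean_change_def m_def)
qed

text \<open>Fubini between the velocity pair and the angle, justified by keeping the difference of
  waves together. At a fixed angle cos (p . v + q . w) splits into products, and the product of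
  sines drops out by \<open>sine\<close>.\<close>

lemma collision_identity:
  fixes u :: "real^3 \<Rightarrow> real" and \<xi> :: "real^3"
  assumes u: "integrable lborel u" and u1: "integrable lborel (\<lambda>v. u v * norm v)"
    and sine: "\<And>\<xi>. (LINT v|lborel. u v * sin (\<xi> \<bullet> v)) = 0" and \<xi>: "\<xi> \<noteq> 0"
  shows "(LINT z|(lborel \<Otimes>\<^sub>M lborel). u (snd z) * u (fst z) * mean_change (\<lambda>v. cos (\<xi> \<bullet> v)) (fst z) (snd z)) =
      collision_rate (cos_transform u) (LINT v|lborel. u v) \<xi>" (is ?eq)
    and "integrable sphere_measure (\<lambda>\<sigma>. b ((\<xi> /\<^sub>R norm \<xi>) \<bullet> \<sigma>) *
     (cos_transform u (pos_part \<xi> \<sigma>) * cos_transform u (neg_part \<xi> \<sigma>) - (LINT v|lborel. u v) * cos_transform u \<xi>))" (is ?int)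
proof -
  note [measurable] = borel_measurable_integrable[OF u]
  define m where "m = \<xi> /\<^sub>R norm \<xi>"
  have m: "norm m = 1" using \<xi> by (simp add: m_def)
  let ?F = "cos_transform u"
  let ?M = "LINT v|lborel. u v"
  define h where "h z \<sigma> = cos (pos_part \<xi> \<sigma> \<bullet> fst z + neg_part \<xi> \<sigma> \<bullet> snd z) - cos (\<xi> \<bullet> fst z)" for z :: "(real^3) \<times> (real^3)" and \<sigma>
  define H where "H z \<sigma> = u (snd z) * u (fst z) * (b (m \<bullet> \<sigma>) * h z \<sigma>)" for z \<sigma>
  interpret P: pair_sigma_finite "lborel \<Otimes>\<^sub>M lborel :: ((real^3) \<times> (real^3)) measure" "sphere_measure :: (real^3) measure"
    unfolding lborel_prod ..
  have iuu: "integrable (lborel \<Otimes>\<^sub>M lborel) (\<lambda>z. u (snd z) * u (fst z) * (norm (fst z) + norm (snd z)))"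
    using Bochner_Integration.integrable_add[OF lborel_pair.product_integral_mult(1)[OF u1 u] lborel_pair.product_integral_mult(1)[OF u u1]]
    by (simp add: algebra_simps)
  have bm [measurable]: "(\<lambda>\<sigma>. b (m \<bullet> \<sigma>)) \<in> borel_measurable sphere_measure"
    using m by (intro angular_kernel_measurable[OF b]) (auto intro!: abs_inner_sphere_le)
  have H: "integrable ((lborel \<Otimes>\<^sub>M lborel) \<Otimes>\<^sub>M sphere_measure) (\<lambda>(z, \<sigma>). H z \<sigma>)"
  proof (rule Bochner_Integration.integrable_bound)
    show "integrable ((lborel \<Otimes>\<^sub>M lborel) \<Otimes>\<^sub>M sphere_measure) (\<lambda>y. (u (snd (fst y)) * u (fst (fst y)) * (norm (fst (fst y)) + norm (snd (fst y)))) *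
        (norm \<xi> * (b (m \<bullet> snd y) * sqrt ((1 - m \<bullet> snd y) / 2))))"
      by (intro P.product_integral_mult(1) iuu integrable_mult_right transfer_constant(2) m)
    have [measurable]: "snd \<in> (lborel \<Otimes>\<^sub>M lborel) \<Otimes>\<^sub>M sphere_measure \<rightarrow>\<^sub>M (borel :: (real^3) measure)"
      by (rule measurable_compose[OF measurable_snd sphere_to_borel])
    have [measurable]: "(\<lambda>y. b (m \<bullet> snd y)) \<in> borel_measurable ((lborel \<Otimes>\<^sub>M lborel) \<Otimes>\<^sub>M sphere_measure)"
      by (rule measurable_compose[OF measurable_snd bm])
    show "(\<lambda>(z, \<sigma>). H z \<sigma>) \<in> borel_measurable ((lborel \<Otimes>\<^sub>M lborel) \<Otimes>\<^sub>M sphere_measure)"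
      unfolding H_def h_def case_prod_unfold pos_part_def neg_part_def by measurable
    show "AE y in (lborel \<Otimes>\<^sub>M lborel) \<Otimes>\<^sub>M sphere_measure. norm (case y of (z, \<sigma>) \<Rightarrow> H z \<sigma>) \<le>
       norm ((u (snd (fst y)) * u (fst (fst y)) * (norm (fst (fst y)) + norm (snd (fst y)))) *
        (norm \<xi> * (b (m \<bullet> snd y) * sqrt ((1 - m \<bullet> snd y) / 2))))"
    proof (rule AE_I2, clarify)
      fix v w \<sigma> :: "real^3" assume "((v, w), \<sigma>) \<in> space ((lborel \<Otimes>\<^sub>M lborel) \<Otimes>\<^sub>M sphere_measure)"
      then have n: "norm \<sigma> = 1" by (simp add: space_pair_measure)
      define d where "d = sqrt ((1 - m \<bullet> \<sigma>) / 2)"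
      have d: "norm (neg_part \<xi> \<sigma>) = norm \<xi> * d"
        using norm_parts(3)[OF n, of \<xi>] by (simp add: d_def deviation_def m_def)
      have d0: "0 \<le> d" using deviation_bounds[OF n, of \<xi>] by (simp add: d_def deviation_def m_def)
      have "\<bar>h (v, w) \<sigma>\<bar> \<le> \<bar>pos_part \<xi> \<sigma> \<bullet> v + neg_part \<xi> \<sigma> \<bullet> w - \<xi> \<bullet> v\<bar>"
        unfolding h_def fst_conv snd_conv by (rule abs_cos_diff_le)
      \<comment> \<open>As the two frequencies sum to \<xi>, the phase difference involves only
        \<open>neg_part\<close>, whose length |\<xi>| sin (\<theta>/2) supplies the factor that
        tames the kernel.\<close>
      also have "pos_part \<xi> \<sigma> \<bullet> v + neg_part \<xi> \<sigma> \<bullet> w - \<xi> \<bullet> v = neg_part \<xi> \<sigma> \<bullet> (w - v)"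
        by (subst (3) pos_plus_neg[of \<xi> \<sigma>, symmetric]) (simp add: inner_add_left inner_diff_right)
      also have "\<bar>\<dots>\<bar> \<le> norm (neg_part \<xi> \<sigma>) * norm (w - v)" by (rule Cauchy_Schwarz_ineq2)
      also have "\<dots> \<le> norm (neg_part \<xi> \<sigma>) * (norm v + norm w)"
        using norm_triangle_ineq4[of w v] by (intro mult_left_mono) auto
      finally have "\<bar>h (v, w) \<sigma>\<bar> \<le> norm \<xi> * d * (norm v + norm w)" by (simp add: d)
      then have "\<bar>u w\<bar> * \<bar>u v\<bar> * \<bar>b (m \<bullet> \<sigma>)\<bar> * \<bar>h (v, w) \<sigma>\<bar> \<le> \<bar>u w\<bar> * \<bar>u v\<bar> * \<bar>b (m \<bullet> \<sigma>)\<bar> * (norm \<xi> * d * (norm v + norm w))"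
        by (intro mult_left_mono) auto
      then show "norm (H (v, w) \<sigma>) \<le> norm ((u (snd (fst ((v, w), \<sigma>))) * u (fst (fst ((v, w), \<sigma>))) * (norm (fst (fst ((v, w), \<sigma>))) + norm (snd (fst ((v, w), \<sigma>))))) *
        (norm \<xi> * (b (m \<bullet> snd ((v, w), \<sigma>)) * sqrt ((1 - m \<bullet> snd ((v, w), \<sigma>)) / 2))))"
        using d0 unfolding H_def fst_conv snd_conv d_def[symmetric] by (simp add: abs_mult mult_ac)
    qed
  qed
  have ic: "integrable lborel (\<lambda>v. u v * cos (\<eta> \<bullet> v))" "integrable lborel (\<lambda>v. u v * sin (\<eta> \<bullet> v))" for \<eta>
    by (rule Bochner_Integration.integrable_bound[OF u]; simp add: abs_mult mult_left_le)+
  have inner: "(LINT z|(lborel \<Otimes>\<^sub>M lborel). H z \<sigma>) = b (m \<bullet> \<sigma>) * (?F (pos_part \<xi> \<sigma>) * ?F (neg_part \<xi> \<sigma>) - ?M * ?F \<xi>)" for \<sigma>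
  proof -
    let ?p = "pos_part \<xi> \<sigma>" and ?q = "neg_part \<xi> \<sigma>"
    note C = lborel_pair.product_integral_mult[OF ic(1) ic(1), of ?p ?q]
    note S = lborel_pair.product_integral_mult[OF ic(2) ic(2), of ?p ?q]
    note U = lborel_pair.product_integral_mult[OF ic(1) u, of \<xi>]
    have "(LINT z|(lborel \<Otimes>\<^sub>M lborel). H z \<sigma>) = (LINT z|(lborel \<Otimes>\<^sub>M lborel). b (m \<bullet> \<sigma>) *
        ((u (fst z) * cos (?p \<bullet> fst z) * (u (snd z) * cos (?q \<bullet> snd z)) - u (fst z) * sin (?p \<bullet> fst z) * (u (snd z) * sin (?q \<bullet> snd z)))
           - u (fst z) * cos (\<xi> \<bullet> fst z) * u (snd z)))"
      by (intro Bochner_Integration.integral_cong) (auto simp: H_def h_def cos_add algebra_simps)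
    also have "\<dots> = b (m \<bullet> \<sigma>) * ((?F ?p * ?F ?q - 0 * 0) - ?F \<xi> * ?M)"
      unfolding integral_mult_right_zero
      by (subst Bochner_Integration.integral_diff, intro Bochner_Integration.integrable_diff C(1) S(1), rule U(1),
          subst Bochner_Integration.integral_diff, rule C(1), rule S(1)) (simp only: C(2) S(2) U(2) cos_transform_def sine)
    finally show ?thesis by (simp add: mult.commute)
  qed
  have "(LINT z|(lborel \<Otimes>\<^sub>M lborel). u (snd z) * u (fst z) * mean_change (\<lambda>v. cos (\<xi> \<bullet> v)) (fst z) (snd z)) =
      (LINT z|(lborel \<Otimes>\<^sub>M lborel). LINT \<sigma>|sphere_measure. H z \<sigma>)"
    unfolding mean_change_wave[OF \<xi>] H_def h_def m_def integral_mult_right_zero ..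
  also have "\<dots> = (LINT \<sigma>|sphere_measure. LINT z|(lborel \<Otimes>\<^sub>M lborel). H z \<sigma>)"
    by (rule P.Fubini_integral[symmetric, OF H])
  finally show ?eq unfolding inner collision_rate_def m_def .
  show ?int using P.integrable_snd[OF H] unfolding inner m_def .
qed

end

section \<open>The differential equation satisfied by each Fourier mode\<close>

locale weak_evolution = singular_kernel +
  fixes g\<^sub>0 :: "real^3 \<Rightarrow> real" and g :: "real \<Rightarrow> real^3 \<Rightarrow> real" and M E :: real
  assumes g: "\<And>t. 0 \<le> t \<Longrightarrow> integrable lborel (g t)"
    and nonneg: "\<And>t. 0 \<le> t \<Longrightarrow> AE v in lborel. 0 \<le> g t v"
    and mass: "\<And>t. 0 \<le> t \<Longrightarrow> (LINT v|lborel. g t v) = M"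
    and energy: "\<And>t. 0 \<le> t \<Longrightarrow> integrable lborel (\<lambda>v. g t v * (norm v)\<^sup>2)"
      "\<And>t. 0 \<le> t \<Longrightarrow> (LINT v|lborel. g t v * (norm v)\<^sup>2) = E"
    and sine: "\<And>t \<xi>. 0 \<le> t \<Longrightarrow> (LINT v|lborel. g t v * sin (\<xi> \<bullet> v)) = 0"
    and meas: "(\<lambda>(t, v). g t v) \<in> borel_measurable (lebesgue_on ({0<..} \<times> UNIV))"
    and weak: "\<And>\<phi> t. \<phi> \<in> test_functions \<Longrightarrow> 0 \<le> t \<Longrightarrow>
        (LINT v|lborel. g t v * \<phi> v) - (LINT v|lborel. g\<^sub>0 v * \<phi> v) =
        (LINT \<tau>:{0..t}|lebesgue. LINT (v, w)|(lborel \<Otimes>\<^sub>M lborel). LINT \<sigma>|sphere_measure.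
           b (cos_dev v w \<sigma>) * g \<tau> w * g \<tau> v * (\<phi> (post_v v w \<sigma>) - \<phi> v))"
begin

abbreviation mode :: "real \<Rightarrow> real^3 \<Rightarrow> real" where
  "mode t \<equiv> cos_transform (g t)"

lemma g_measurable: "0 \<le> t \<Longrightarrow> g t \<in> borel_measurable borel"
  using borel_measurable_integrable[OF g[of t]] by simp

text \<open>From |v| <= 1 + |v|^2 and the conservation laws; the resulting bound M + E, uniform in
  time, serves as the Lipschitz constant of the modes in frequency.\<close>

lemma first_moment:
  assumes t: "0 \<le> t"
  shows "integrable lborel (\<lambda>v. g t v * norm v)"
    and "0 \<le> (LINT v|lborel. g t v * norm v)" "(LINT v|lborel. g t v * norm v) \<le> M + E"
proof -
  note [measurable] = g_measurable[OF t]
  have i: "integrable lborel (\<lambda>v. g t v + g t v * (norm v)\<^sup>2)"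
    by (intro Bochner_Integration.integrable_add g energy(1) t)
  have le: "x \<le> 1 + x\<^sup>2" for x :: real
    using zero_le_power2[of "x - 1 / 2"] by (simp add: power2_eq_square algebra_simps)
  have AEle: "AE v in lborel. 0 \<le> g t v * norm v \<and> g t v * norm v \<le> g t v + g t v * (norm v)\<^sup>2"
    using nonneg[OF t]
  proof eventually_elim
    fix v assume "0 \<le> g t v"
    then show "0 \<le> g t v * norm v \<and> g t v * norm v \<le> g t v + g t v * (norm v)\<^sup>2"
      using mult_left_mono[OF le[of "norm v"], of "g t v"] by (simp add: distrib_left)
  qed
  show 1: "integrable lborel (\<lambda>v. g t v * norm v)"
  proof (rule Bochner_Integration.integrable_bound[OF i])
    show "AE v in lborel. norm (g t v * norm v) \<le> norm (g t v + g t v * (norm v)\<^sup>2)"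
      using AEle by eventually_elim (simp del: norm_mult)
  qed measurable
  show "0 \<le> (LINT v|lborel. g t v * norm v)"
    by (rule integral_nonneg_AE) (use AEle in \<open>auto elim!: eventually_mono\<close>)
  have "(LINT v|lborel. g t v * norm v) \<le> (LINT v|lborel. g t v + g t v * (norm v)\<^sup>2)"
    by (rule integral_mono_AE[OF 1 i]) (use AEle in \<open>auto elim!: eventually_mono\<close>)
  also have "\<dots> = M + E"
    by (subst Bochner_Integration.integral_add) (auto intro: g energy t simp: mass[OF t] energy(2)[OF t])
  finally show "(LINT v|lborel. g t v * norm v) \<le> M + E" .
qed

lemma M_nonneg: "0 \<le> M"
  using integral_nonneg_AE[OF nonneg[of 0]] mass[of 0] by simp

definition collisions :: "(real^3 \<Rightarrow> real) \<Rightarrow> real \<Rightarrow> real" where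
  "collisions \<phi> \<tau> = (LINT z|(lborel \<Otimes>\<^sub>M lborel). g \<tau> (snd z) * g \<tau> (fst z) * mean_change \<phi> (fst z) (snd z))"

lemma collisions_eq:
  "(LINT (v, w)|(lborel \<Otimes>\<^sub>M lborel). LINT \<sigma>|sphere_measure.
           b (cos_dev v w \<sigma>) * g \<tau> w * g \<tau> v * (\<phi> (post_v v w \<sigma>) - \<phi> v)) = collisions \<phi> \<tau>"
proof -
  have "(LINT \<sigma>|sphere_measure. b (cos_dev v w \<sigma>) * g \<tau> w * g \<tau> v * (\<phi> (post_v v w \<sigma>) - \<phi> v)) = g \<tau> w * g \<tau> v * mean_change \<phi> v w" for v w
    unfolding mean_change_def by (subst integral_mult_right_zero[symmetric]) (simp add: mult_ac)
  then show ?thesis unfolding collisions_def case_prod_unfold by simp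
qed

lemma pair_dominated:
  assumes t: "0 \<le> t"
  shows "integrable (lborel \<Otimes>\<^sub>M lborel) (\<lambda>z. g t (snd z) * g t (fst z) * (norm (fst z) + norm (snd z)))"
    and "(LINT z|(lborel \<Otimes>\<^sub>M lborel). g t (snd z) * g t (fst z) * (norm (fst z) + norm (snd z))) \<le> 2 * M * (M + E)"
    and "AE z in lborel \<Otimes>\<^sub>M lborel. 0 \<le> g t (snd z) * g t (fst z)"
proof -
  note [measurable] = g_measurable[OF t]
  note A = lborel_pair.product_integral_mult[OF first_moment(1)[OF t] g[OF t]]
  note B = lborel_pair.product_integral_mult[OF g[OF t] first_moment(1)[OF t]]
  have eq: "(\<lambda>z. g t (snd z) * g t (fst z) * (norm (fst z) + norm (snd z))) =
      (\<lambda>z. g t (fst z) * norm (fst z) * g t (snd z) + g t (fst z) * (g t (snd z) * norm (snd z)))"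
    by (auto simp: algebra_simps)
  show "integrable (lborel \<Otimes>\<^sub>M lborel) (\<lambda>z. g t (snd z) * g t (fst z) * (norm (fst z) + norm (snd z)))"
    unfolding eq by (intro Bochner_Integration.integrable_add A(1) B(1))
  have "(LINT z|(lborel \<Otimes>\<^sub>M lborel). g t (snd z) * g t (fst z) * (norm (fst z) + norm (snd z))) = 2 * M * (LINT v|lborel. g t v * norm v)"
    unfolding eq by (subst Bochner_Integration.integral_add[OF A(1) B(1)]) (simp add: A(2) B(2) mass[OF t])
  also have "\<dots> \<le> 2 * M * (M + E)"
    using M_nonneg first_moment(3)[OF t] by (intro mult_left_mono) auto
  finally show "(LINT z|(lborel \<Otimes>\<^sub>M lborel). g t (snd z) * g t (fst z) * (norm (fst z) + norm (snd z))) \<le> 2 * M * (M + E)" .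
  have "AE v in lborel. AE w in lborel. 0 \<le> g t w * g t v"
    using nonneg[OF t]
  proof eventually_elim
    fix v assume "0 \<le> g t v"
    with nonneg[OF t] show "AE w in lborel. 0 \<le> g t w * g t v" by (auto elim!: eventually_mono)
  qed
  moreover have "{z \<in> space (lborel \<Otimes>\<^sub>M lborel). 0 \<le> g t (snd z) * g t (fst z)} \<in> sets (lborel \<Otimes>\<^sub>M lborel)"
    by measurable
  ultimately show "AE z in lborel \<Otimes>\<^sub>M lborel. 0 \<le> g t (snd z) * g t (fst z)"
    by (intro lborel_pair.AE_pair_iff[where P = "\<lambda>v w. 0 \<le> g t w * g t v", THEN iffD1])
qed

lemma mean_change_measurable' [measurable]:
  "\<phi> \<in> borel_measurable borel \<Longrightarrow> (\<lambda>z. mean_change \<phi> (fst z) (snd z)) \<in> borel_measurable (lborel \<Otimes>\<^sub>M lborel)"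
  using mean_change_measurable by (simp cong: measurable_cong_sets sets_pair_measure_cong)

lemma collisions_integrand_bound:
  assumes \<phi>: "\<phi> \<in> borel_measurable borel" and L: "\<And>v w. \<bar>\<phi> v - \<phi> w\<bar> \<le> L * norm (v - w)" "0 \<le> L" and t: "0 \<le> t"
  shows "AE z in lborel \<Otimes>\<^sub>M lborel. \<bar>g t (snd z) * g t (fst z) * mean_change \<phi> (fst z) (snd z)\<bar> \<le>
      L * transfer_constant * (g t (snd z) * g t (fst z) * (norm (fst z) + norm (snd z)))"
  using pair_dominated(3)[OF t]
proof eventually_elim
  fix z :: "(real^3) \<times> (real^3)" assume z: "0 \<le> g t (snd z) * g t (fst z)"
  have "\<bar>g t (snd z) * g t (fst z) * mean_change \<phi> (fst z) (snd z)\<bar> = (g t (snd z) * g t (fst z)) * \<bar>mean_change \<phi> (fst z) (snd z)\<bar>"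
    using z by (simp only: abs_mult[of "g t (snd z) * g t (fst z)"] abs_of_nonneg)
  also have "\<dots> \<le> (g t (snd z) * g t (fst z)) * (L * transfer_constant * (norm (fst z) + norm (snd z)))"
    by (intro mult_left_mono mean_change_bound[OF \<phi> L] z)
  finally show "\<bar>g t (snd z) * g t (fst z) * mean_change \<phi> (fst z) (snd z)\<bar> \<le>
      L * transfer_constant * (g t (snd z) * g t (fst z) * (norm (fst z) + norm (snd z)))"
    by (simp add: mult_ac)
qed

lemma collisions_bound:
  assumes \<phi>: "\<phi> \<in> borel_measurable borel" and L: "\<And>v w. \<bar>\<phi> v - \<phi> w\<bar> \<le> L * norm (v - w)" "0 \<le> L" and t: "0 \<le> t"
  shows "\<bar>collisions \<phi> t\<bar> \<le> L * transfer_constant * (2 * M * (M + E))"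
proof -
  note [measurable] = g_measurable[OF t] \<phi>
  have i: "integrable (lborel \<Otimes>\<^sub>M lborel) (\<lambda>z. L * transfer_constant * (g t (snd z) * g t (fst z) * (norm (fst z) + norm (snd z))))"
    by (intro integrable_mult_right pair_dominated(1) t)
  have "\<bar>collisions \<phi> t\<bar> \<le> (LINT z|(lborel \<Otimes>\<^sub>M lborel). \<bar>g t (snd z) * g t (fst z) * mean_change \<phi> (fst z) (snd z)\<bar>)"
    unfolding collisions_def by (rule integral_abs_bound)
  also have "\<dots> \<le> (LINT z|(lborel \<Otimes>\<^sub>M lborel). L * transfer_constant * (g t (snd z) * g t (fst z) * (norm (fst z) + norm (snd z))))"
  proof (rule integral_mono_AE[OF _ i collisions_integrand_bound[OF assms]])
    show "integrable (lborel \<Otimes>\<^sub>M lborel) (\<lambda>z. \<bar>g t (snd z) * g t (fst z) * mean_change \<phi> (fst z) (snd z)\<bar>)"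
      by (rule Bochner_Integration.integrable_bound[OF i])
         (use collisions_integrand_bound[OF assms] in \<open>auto elim!: eventually_mono intro: order.trans[OF _ abs_ge_self]\<close>)
  qed
  also have "\<dots> \<le> L * transfer_constant * (2 * M * (M + E))"
    unfolding integral_mult_right_zero
    using L transfer_constant(1) by (intro mult_left_mono pair_dominated(2) t) auto
  finally show ?thesis .
qed

lemma collisions_tendsto:
  fixes \<phi> :: "nat \<Rightarrow> real^3 \<Rightarrow> real"
  assumes m: "\<And>n. \<phi> n \<in> borel_measurable borel" "\<psi> \<in> borel_measurable borel"
    and L: "\<And>n v w. \<bar>\<phi> n v - \<phi> n w\<bar> \<le> L * norm (v - w)" "0 \<le> L"
    and lim: "\<And>v. (\<lambda>n. \<phi> n v) \<longlonglongrightarrow> \<psi> v" and t: "0 \<le> t"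
  shows "(\<lambda>n. collisions (\<phi> n) t) \<longlonglongrightarrow> collisions \<psi> t"
  unfolding collisions_def
proof (rule integral_dominated_convergence)
  note [measurable] = g_measurable[OF t] m
  show "integrable (lborel \<Otimes>\<^sub>M lborel) (\<lambda>z. L * transfer_constant * (g t (snd z) * g t (fst z) * (norm (fst z) + norm (snd z))))"
    by (intro integrable_mult_right pair_dominated(1) t)
  show "AE z in lborel \<Otimes>\<^sub>M lborel. (\<lambda>n. g t (snd z) * g t (fst z) * mean_change (\<phi> n) (fst z) (snd z)) \<longlonglongrightarrow> g t (snd z) * g t (fst z) * mean_change \<psi> (fst z) (snd z)"
    by (intro AE_I2 tendsto_intros mean_change_tendsto[where L = L] m L lim)
  show "AE z in lborel \<Otimes>\<^sub>M lborel. norm (g t (snd z) * g t (fst z) * mean_change (\<phi> n) (fst z) (snd z)) \<le>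
      L * transfer_constant * (g t (snd z) * g t (fst z) * (norm (fst z) + norm (snd z)))" for n
    unfolding real_norm_def by (rule collisions_integrand_bound[OF m(1) L t])
qed (use m g_measurable[OF t] in measurable)

text \<open>Only joint Lebesgue measurability of \<open>g\<close> is available, so a Borel representative is used.\<close>

lemma collisions_measurable:
  assumes \<phi> [measurable]: "\<phi> \<in> borel_measurable borel"
  shows "(\<lambda>\<tau>. indicator {0..t} \<tau> * collisions \<phi> \<tau>) \<in> borel_measurable lebesgue"
proof -
  \<comment> \<open>\<open>h\<close> extends g by 0 to all of space-time. A Borel function
    \<open>h'\<close> agrees with it almost everywhere, hence by Fubini on almost every time slice,
    and products over velocity pairs can be integrated measurably in time through
    \<open>h'\<close>.\<close>
  define h where "h = (\<lambda>z. if z \<in> {0<..} \<times> UNIV then g (fst z) (snd z) else 0)"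
  have S: "{0::real<..} \<times> (UNIV :: (real^3) set) \<in> sets lebesgue"
    by (intro borel_open[THEN sets_completionI_sets[of _ lborel, simplified]] open_Times) auto
  have "(\<lambda>z. g (fst z) (snd z)) \<in> borel_measurable (lebesgue_on ({0<..} \<times> UNIV))"
    using meas by (simp add: case_prod_unfold)
  then have "h \<in> borel_measurable (lebesgue_on UNIV)"
    unfolding h_def by (subst borel_measurable_if_lebesgue_on[OF S]) auto
  then have "h \<in> borel_measurable (completion lborel)" by simp
  then obtain h' where h' [measurable]: "h' \<in> borel_measurable lborel" and hh: "AE z in lborel. h z = h' z"
    using completion_ex_borel_measurable_real by blast
  have h'2 [measurable]: "h' \<in> borel_measurable (lborel \<Otimes>\<^sub>M lborel)" using h' by (simp add: lborel_prod)
  have "AE z in lborel \<Otimes>\<^sub>M lborel. h z = h' z" unfolding lborel_prod by (rule hh)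
  then have ae: "AE \<tau> in lborel. AE v in lborel. h (\<tau>, v) = h' (\<tau>, v)"
    by (rule lborel_pair.AE_pair[of "\<lambda>z. h z = h' z", simplified])
  define J where "J \<tau> = (LINT z|(lborel \<Otimes>\<^sub>M lborel). h' (\<tau>, snd z) * h' (\<tau>, fst z) * mean_change \<phi> (fst z) (snd z))" for \<tau>
  have J [measurable]: "J \<in> borel_measurable borel"
    unfolding J_def lborel_prod
  proof (rule lborel.borel_measurable_lebesgue_integral[of _ borel, unfolded case_prod_unfold, where f = "\<lambda>\<tau> z. h' (\<tau>, snd z) * h' (\<tau>, fst z) * mean_change \<phi> (fst z) (snd z)"])
    have 1: "(\<lambda>y. (fst y, snd (snd y))) \<in> borel \<Otimes>\<^sub>M (lborel \<Otimes>\<^sub>M lborel) \<rightarrow>\<^sub>M lborel \<Otimes>\<^sub>M lborel"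
      "(\<lambda>y. (fst y, fst (snd y))) \<in> borel \<Otimes>\<^sub>M (lborel \<Otimes>\<^sub>M lborel) \<rightarrow>\<^sub>M lborel \<Otimes>\<^sub>M lborel"
      by measurable
    have "(\<lambda>y. h' (fst y, snd (snd y)) * h' (fst y, fst (snd y)) * mean_change \<phi> (fst (snd y)) (snd (snd y)))
        \<in> borel_measurable (borel \<Otimes>\<^sub>M (lborel \<Otimes>\<^sub>M lborel))"
      using measurable_compose[OF 1(1) h'2] measurable_compose[OF 1(2) h'2]
        measurable_compose[OF measurable_snd mean_change_measurable'[OF \<phi>]] by measurable
    then show "(\<lambda>y. h' (fst y, snd (snd y)) * h' (fst y, fst (snd y)) * mean_change \<phi> (fst (snd y)) (snd (snd y))) \<in> borel_measurable (borel \<Otimes>\<^sub>M lborel)"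
      by (simp add: lborel_prod)
  qed
  have "AE \<tau> in lborel. indicator {0..t} \<tau> * J \<tau> = indicator {0..t} \<tau> * collisions \<phi> \<tau>"
    using ae AE_lborel_singleton[of "0::real"]
  proof eventually_elim
    fix \<tau> :: real assume \<tau>: "AE v in lborel. h (\<tau>, v) = h' (\<tau>, v)" "\<tau> \<noteq> 0"
    show "indicator {0..t} \<tau> * J \<tau> = indicator {0..t} \<tau> * collisions \<phi> \<tau>"
    proof (cases "0 < \<tau>")
      case True
      note [measurable] = g_measurable[OF less_imp_le[OF True]]
      have hm [measurable]: "(\<lambda>v. h' (\<tau>, v)) \<in> borel_measurable borel"
        using measurable_compose[OF measurable_Pair1'[of \<tau> lborel lborel] h'2] by simp
      have eq: "AE v in lborel. g \<tau> v = h' (\<tau>, v)" using \<tau>(1) True by (simp add: h_def)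
      have "AE v in lborel. AE w in lborel. g \<tau> w * g \<tau> v = h' (\<tau>, w) * h' (\<tau>, v)"
        using eq
      proof eventually_elim
        fix v assume "g \<tau> v = h' (\<tau>, v)"
        with eq show "AE w in lborel. g \<tau> w * g \<tau> v = h' (\<tau>, w) * h' (\<tau>, v)" by (auto elim!: eventually_mono)
      qed
      moreover have "{z \<in> space (lborel \<Otimes>\<^sub>M lborel). g \<tau> (snd z) * g \<tau> (fst z) = h' (\<tau>, snd z) * h' (\<tau>, fst z)} \<in> sets (lborel \<Otimes>\<^sub>M lborel)"
        by measurable
      ultimately have "AE z in lborel \<Otimes>\<^sub>M lborel. g \<tau> (snd z) * g \<tau> (fst z) = h' (\<tau>, snd z) * h' (\<tau>, fst z)"
        by (intro lborel_pair.AE_pair_iff[where P = "\<lambda>v w. g \<tau> w * g \<tau> v = h' (\<tau>, w) * h' (\<tau>, v)", THEN iffD1])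
      then have "J \<tau> = collisions \<phi> \<tau>"
        unfolding J_def collisions_def by (intro integral_cong_AE) (auto elim!: eventually_mono)
      then show ?thesis by simp
    qed (use \<tau>(2) in \<open>auto simp: indicator_def\<close>)
  qed
  moreover have borel: "(\<lambda>\<tau>. indicator {0..t} \<tau> * J \<tau>) \<in> borel_measurable lborel"
    using J by simp
  ultimately have "AE \<tau> in lebesgue. indicator {0..t} \<tau> * J \<tau> = indicator {0..t} \<tau> * collisions \<phi> \<tau>"
    by (intro AE_completion)
  then show ?thesis
    by (rule borel_measurable_AE[rotated]) (rule measurable_completion[OF borel])
qed

lemma mode_at_0: "0 \<le> t \<Longrightarrow> mode t 0 = M"
  by (simp add: cos_transform_def mass)

lemma mode_integrable:
  assumes "0 \<le> t"
  shows "integrable lborel (\<lambda>v. g t v * cos (\<xi> \<bullet> v))"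
proof -
  note [measurable] = g_measurable[OF assms]
  show ?thesis
    by (rule Bochner_Integration.integrable_bound[OF g[OF assms]]) (auto simp: abs_mult mult_left_le)
qed

lemma mode_bound:
  assumes t: "0 \<le> t"
  shows "\<bar>mode t \<xi>\<bar> \<le> M"
proof -
  have "\<bar>mode t \<xi>\<bar> \<le> (LINT v|lborel. \<bar>g t v * cos (\<xi> \<bullet> v)\<bar>)"
    unfolding cos_transform_def by (rule integral_abs_bound)
  also have "\<dots> \<le> (LINT v|lborel. g t v)"
  proof (rule integral_mono_AE)
    show "AE v in lborel. \<bar>g t v * cos (\<xi> \<bullet> v)\<bar> \<le> g t v"
      using nonneg[OF t] by eventually_elim (simp add: abs_mult mult_left_le)
  qed (use mode_integrable[OF t] g[OF t] in auto)
  finally show ?thesis by (simp add: mass[OF t])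
qed

lemma mode_lipschitz:
  assumes t: "0 \<le> t"
  shows "\<bar>mode t \<xi> - mode t \<eta>\<bar> \<le> (M + E) * norm (\<xi> - \<eta>)"
proof -
  have "mode t \<xi> - mode t \<eta> = (LINT v|lborel. g t v * cos (\<xi> \<bullet> v) - g t v * cos (\<eta> \<bullet> v))"
    unfolding cos_transform_def by (rule Bochner_Integration.integral_diff[symmetric]) (rule mode_integrable[OF t])+
  also have "\<bar>\<dots>\<bar> \<le> (LINT v|lborel. \<bar>g t v * cos (\<xi> \<bullet> v) - g t v * cos (\<eta> \<bullet> v)\<bar>)"
    by (rule integral_abs_bound)
  also have "\<dots> \<le> (LINT v|lborel. g t v * norm v * norm (\<xi> - \<eta>))"
  proof (rule integral_mono_AE)
    show "AE v in lborel. \<bar>g t v * cos (\<xi> \<bullet> v) - g t v * cos (\<eta> \<bullet> v)\<bar> \<le> g t v * norm v * norm (\<xi> - \<eta>)"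
      using nonneg[OF t]
    proof eventually_elim
      fix v assume v: "0 \<le> g t v"
      have "\<bar>cos (\<xi> \<bullet> v) - cos (\<eta> \<bullet> v)\<bar> \<le> \<bar>(\<xi> - \<eta>) \<bullet> v\<bar>"
        using abs_cos_diff_le[of "\<xi> \<bullet> v" "\<eta> \<bullet> v"] by (simp add: inner_diff_left)
      also have "\<dots> \<le> norm (\<xi> - \<eta>) * norm v" by (rule Cauchy_Schwarz_ineq2)
      finally have "g t v * \<bar>cos (\<xi> \<bullet> v) - cos (\<eta> \<bullet> v)\<bar> \<le> g t v * (norm (\<xi> - \<eta>) * norm v)"
        using v by (rule mult_left_mono)
      then show "\<bar>g t v * cos (\<xi> \<bullet> v) - g t v * cos (\<eta> \<bullet> v)\<bar> \<le> g t v * norm v * norm (\<xi> - \<eta>)"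
        using v by (simp add: right_diff_distrib[symmetric] abs_mult mult_ac)
    qed
  qed (use mode_integrable[OF t] first_moment(1)[OF t] in auto)
  also have "\<dots> \<le> (M + E) * norm (\<xi> - \<eta>)"
    using first_moment(3)[OF t] by (simp add: mult_right_mono)
  finally show ?thesis .
qed

lemma collisions_wave: "0 \<le> \<tau> \<Longrightarrow> \<xi> \<noteq> 0 \<Longrightarrow> collisions (\<lambda>v. cos (\<xi> \<bullet> v)) \<tau> = collision_rate (mode \<tau>) M \<xi>"
  unfolding collisions_def using collision_identity(1)[OF g first_moment(1) sine, of \<tau> \<xi>] by (simp add: mass)

lemma rate_integrable:
  "0 \<le> \<tau> \<Longrightarrow> \<xi> \<noteq> 0 \<Longrightarrow> integrable sphere_measure (\<lambda>\<sigma>. b ((\<xi> /\<^sub>R norm \<xi>) \<bullet> \<sigma>) *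
     (mode \<tau> (pos_part \<xi> \<sigma>) * mode \<tau> (neg_part \<xi> \<sigma>) - M * mode \<tau> \<xi>))"
  using collision_identity(2)[OF g first_moment(1) sine, of \<tau> \<xi>] by (simp add: mass)

definition rate_bound :: "real^3 \<Rightarrow> real" where
  "rate_bound \<xi> = norm \<xi> * transfer_constant * (2 * M * (M + E))"

lemma abs_rate_le: "0 \<le> \<tau> \<Longrightarrow> \<xi> \<noteq> 0 \<Longrightarrow> \<bar>collision_rate (mode \<tau>) M \<xi>\<bar> \<le> rate_bound \<xi>"
  using collisions_bound[of "\<lambda>v. cos (\<xi> \<bullet> v)" "norm \<xi>" \<tau>, OF _ wave_lipschitz] by (simp add: collisions_wave rate_bound_def)

text \<open>The weak formulation is applied to cutoff waves and the radius is sent to infinity. The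
  Lipschitz constant \<open>L\<close> common to all cutoffs dominates the collision integral both
  over velocity pairs and over time.\<close>

lemma mode_evolution:
  assumes t: "0 \<le> t" and \<xi>: "\<xi> \<noteq> 0"
  shows "mode t \<xi> - mode 0 \<xi> = (LINT \<tau>:{0..t}|lebesgue. collision_rate (mode \<tau>) M \<xi>)"
    and "set_integrable lebesgue {0..t} (\<lambda>\<tau>. collision_rate (mode \<tau>) M \<xi>)"
proof -
  define \<phi> where "\<phi> n = cutoff_wave \<xi> (real n + 1)" for n
  define L where "L = 12 + norm \<xi>"
  have \<phi>m [measurable]: "\<phi> n \<in> borel_measurable borel" for n unfolding \<phi>_def cutoff_wave_def by measurable
  have \<phi>t: "\<phi> n \<in> test_functions" for n unfolding \<phi>_def by (rule cutoff_wave_test) simp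
  have \<phi>L: "\<bar>\<phi> n v - \<phi> n w\<bar> \<le> L * norm (v - w)" for n v w
    unfolding \<phi>_def L_def by (rule cutoff_wave_lipschitz) simp
  have \<phi>1: "\<bar>\<phi> n v\<bar> \<le> 1" for n v
    using cutoff_bounds[of "real n + 1" v] mult_mono[of "cutoff (real n + 1) v" 1 "\<bar>cos (\<xi> \<bullet> v)\<bar>" 1]
    by (simp add: \<phi>_def cutoff_wave_def abs_mult)
  have \<phi>lim: "(\<lambda>n. \<phi> n v) \<longlonglongrightarrow> cos (\<xi> \<bullet> v)" for v
    using tendsto_mult[OF cutoff_tendsto_1[of v] tendsto_const[of "cos (\<xi> \<bullet> v)"]] by (simp add: \<phi>_def cutoff_wave_def)
  have L0: "0 \<le> L" by (simp add: L_def)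
  have left: "(\<lambda>n. LINT v|lborel. g t v * \<phi> n v) \<longlonglongrightarrow> mode t \<xi>" if t: "0 \<le> t" for t
    unfolding cos_transform_def
  proof (rule integral_dominated_convergence[where w = "\<lambda>v. \<bar>g t v\<bar>"])
    show "AE v in lborel. (\<lambda>n. g t v * \<phi> n v) \<longlonglongrightarrow> g t v * cos (\<xi> \<bullet> v)"
      by (intro AE_I2 tendsto_intros \<phi>lim)
    show "AE v in lborel. norm (g t v * \<phi> n v) \<le> \<bar>g t v\<bar>" for n
      using \<phi>1 by (intro AE_I2) (simp add: abs_mult mult_left_le)
  qed (use g[OF t] g_measurable[OF t] in auto)
  \<comment> \<open>At time 0 the time integral runs over a null set, so the weak formulation itself
    identifies \<open>g 0\<close> with \<open>g\<^sub>0\<close> on test functions; subtracting the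
    two instances replaces \<open>g\<^sub>0\<close> by \<open>g 0\<close>.\<close>
  have eq: "(LINT v|lborel. g t v * \<phi> n v) - (LINT v|lborel. g 0 v * \<phi> n v) = (LINT \<tau>:{0..t}|lebesgue. collisions (\<phi> n) \<tau>)" for n
  proof -
    have "(LINT \<tau>:{0..0}|lebesgue. collisions (\<phi> n) \<tau>) = 0"
      unfolding set_lebesgue_integral_def
    proof (rule integral_eq_zero_AE)
      show "AE \<tau> in lebesgue. indicator {0..0} \<tau> *\<^sub>R collisions (\<phi> n) \<tau> = 0"
        using AE_completion[OF AE_lborel_singleton[of "0::real"]] by eventually_elim (simp add: indicator_def)
    qed
    then show ?thesis
      using weak[OF \<phi>t[of n] t] weak[OF \<phi>t[of n] order_refl] by (simp add: collisions_eq)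
  qed
  let ?C = "L * transfer_constant * (2 * M * (M + E))"
  have C: "\<bar>indicator {0..t} \<tau> *\<^sub>R collisions (\<phi> n) \<tau>\<bar> \<le> ?C * indicator {0..t} \<tau>" for n \<tau>
    using collisions_bound[OF \<phi>m \<phi>L L0, of \<tau> n] by (auto simp: indicator_def)
  have iC: "integrable lebesgue (\<lambda>\<tau>::real. ?C * indicator {0..t} \<tau>)"
    using t by (intro integrable_mult_right integrable_real_indicator) auto
  have m1: "(\<lambda>\<tau>. indicator {0..t} \<tau> *\<^sub>R collisions \<psi> \<tau>) \<in> borel_measurable lebesgue" if "\<psi> \<in> borel_measurable borel" for \<psi>
    using collisions_measurable[OF that, of t] by simp
  have "(\<lambda>n. LINT \<tau>:{0..t}|lebesgue. collisions (\<phi> n) \<tau>) \<longlonglongrightarrow> (LINT \<tau>:{0..t}|lebesgue. collisions (\<lambda>v. cos (\<xi> \<bullet> v)) \<tau>)"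
    unfolding set_lebesgue_integral_def
  proof (rule integral_dominated_convergence[OF m1 m1 iC])
    show "AE \<tau> in lebesgue. (\<lambda>n. indicator {0..t} \<tau> *\<^sub>R collisions (\<phi> n) \<tau>) \<longlonglongrightarrow> indicator {0..t} \<tau> *\<^sub>R collisions (\<lambda>v. cos (\<xi> \<bullet> v)) \<tau>"
      using collisions_tendsto[of \<phi> "\<lambda>v. cos (\<xi> \<bullet> v)" L, OF \<phi>m _ \<phi>L L0 \<phi>lim]
      by (intro AE_I2) (auto simp: indicator_def)
    show "AE \<tau> in lebesgue. norm (indicator {0..t} \<tau> *\<^sub>R collisions (\<phi> n) \<tau>) \<le> ?C * indicator {0..t} \<tau>" for n
      unfolding real_norm_def by (intro AE_I2 C)
  qed auto
  moreover have "(LINT \<tau>:{0..t}|lebesgue. collisions (\<lambda>v. cos (\<xi> \<bullet> v)) \<tau>) = (LINT \<tau>:{0..t}|lebesgue. collision_rate (mode \<tau>) M \<xi>)"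
    unfolding set_lebesgue_integral_def
    by (intro Bochner_Integration.integral_cong) (auto simp: indicator_def collisions_wave[OF _ \<xi>])
  ultimately show "mode t \<xi> - mode 0 \<xi> = (LINT \<tau>:{0..t}|lebesgue. collision_rate (mode \<tau>) M \<xi>)"
    using tendsto_diff[OF left[OF t] left[OF order_refl]] LIMSEQ_unique unfolding eq by fastforce
  have "integrable lebesgue (\<lambda>\<tau>. indicator {0..t} \<tau> *\<^sub>R collisions (\<lambda>v. cos (\<xi> \<bullet> v)) \<tau>)"
  proof (rule Bochner_Integration.integrable_bound[OF integrable_mult_right[of "rate_bound \<xi>" lebesgue "indicator {0..t}"]])
    show "AE \<tau> in lebesgue. norm (indicator {0..t} \<tau> *\<^sub>R collisions (\<lambda>v. cos (\<xi> \<bullet> v)) \<tau>) \<le> norm (rate_bound \<xi> * indicator {0..t} \<tau>)"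
      using abs_rate_le[OF _ \<xi>] by (intro AE_I2) (auto simp: indicator_def collisions_wave[OF _ \<xi>] intro: order.trans[OF _ abs_ge_self])
  qed (use t m1 in \<open>auto intro!: integrable_real_indicator\<close>)
  moreover have "(\<lambda>\<tau>. indicator {0..t} \<tau> *\<^sub>R collisions (\<lambda>v. cos (\<xi> \<bullet> v)) \<tau>) = (\<lambda>\<tau>. indicator {0..t} \<tau> *\<^sub>R collision_rate (mode \<tau>) M \<xi>)"
    by (auto simp: fun_eq_iff indicator_def collisions_wave[OF _ \<xi>])
  ultimately show "set_integrable lebesgue {0..t} (\<lambda>\<tau>. collision_rate (mode \<tau>) M \<xi>)"
    by (simp add: set_integrable_def)
qed

lemma mode_integral:
  assumes "0 \<le> t" "\<xi> \<noteq> 0"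
  shows "mode t \<xi> = mode 0 \<xi> + integral {0..t} (\<lambda>\<tau>. collision_rate (mode \<tau>) M \<xi>)"
    and "(\<lambda>\<tau>. collision_rate (mode \<tau>) M \<xi>) integrable_on {0..t}"
  using mode_evolution[OF assms] set_lebesgue_integral_eq_integral[OF mode_evolution(2)[OF assms]] by auto

lemma mode_time_lipschitz:
  assumes "0 \<le> r" "r \<le> t" "\<xi> \<noteq> 0"
  shows "\<bar>mode t \<xi> - mode r \<xi>\<bar> \<le> rate_bound \<xi> * (t - r)"
proof -
  let ?f = "\<lambda>\<tau>. collision_rate (mode \<tau>) M \<xi>"
  have i: "?f integrable_on {0..t}" using mode_integral(2)[of t \<xi>] assms by simp
  have "integral {0..r} ?f + integral {r..t} ?f = integral {0..t} ?f"
    using assms by (intro Henstock_Kurzweil_Integration.integral_combine i)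
  then have "mode t \<xi> - mode r \<xi> = integral {r..t} ?f"
    using mode_integral(1)[of t \<xi>] mode_integral(1)[of r \<xi>] assms by simp
  also have "norm (integral {r..t} ?f) \<le> integral {r..t} (\<lambda>_. rate_bound \<xi>)"
    using assms abs_rate_le by (intro integral_norm_bound_integral integrable_on_subinterval[OF i]) auto
  finally show ?thesis using assms by (simp add: mult.commute)
qed

text \<open>Joint continuity combines the Lipschitz bound in frequency, uniform in time, with the
  Lipschitz bound in time at the base frequency alone.\<close>

lemma mode_continuous: "continuous_on ({0..} \<times> UNIV) (\<lambda>(t, \<xi>). mode t \<xi>)"
  unfolding continuous_on_def
proof clarify
  fix t :: real and \<xi> :: "real^3" assume t: "0 \<le> t"
  let ?F = "at (t, \<xi>) within {0..} \<times> UNIV"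
  have rt: "\<bar>mode r \<xi> - mode t \<xi>\<bar> \<le> rate_bound \<xi> * \<bar>r - t\<bar>" if "0 \<le> r" for r
  proof (cases "\<xi> = 0")
    case True
    then show ?thesis using that t by (simp add: mode_at_0 rate_bound_def)
  next
    case False
    then show ?thesis using mode_time_lipschitz[of r t \<xi>] mode_time_lipschitz[of t r \<xi>] that t
      by (cases "r \<le> t") (auto simp: abs_minus_commute)
  qed
  have ev: "\<forall>\<^sub>F z in ?F. norm (mode (fst z) (snd z) - mode t \<xi>) \<le> (M + E) * norm (snd z - \<xi>) + rate_bound \<xi> * \<bar>fst z - t\<bar>"
    unfolding eventually_at_filter
  proof (rule always_eventually, clarify)
    fix r :: real and \<eta> :: "real^3" assume "0 \<le> r"
    then show "norm (mode (fst (r, \<eta>)) (snd (r, \<eta>)) - mode t \<xi>) \<le> (M + E) * norm (snd (r, \<eta>) - \<xi>) + rate_bound \<xi> * \<bar>fst (r, \<eta>) - t\<bar>"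
      using mode_lipschitz[of r \<eta> \<xi>] rt[of r] by (simp add: abs_le_iff)
  qed
  have "((\<lambda>z. (M + E) * norm (snd z - \<xi>) + rate_bound \<xi> * \<bar>fst z - t\<bar>) \<longlongrightarrow> (M + E) * norm (snd (t, \<xi>) - \<xi>) + rate_bound \<xi> * \<bar>fst (t, \<xi>) - t\<bar>) ?F"
    by (intro tendsto_intros)
  then have "((\<lambda>z. (M + E) * norm (snd z - \<xi>) + rate_bound \<xi> * \<bar>fst z - t\<bar>) \<longlongrightarrow> 0) ?F" by simp
  from Lim_null_comparison[OF ev this] have "((\<lambda>z. mode (fst z) (snd z) - mode t \<xi>) \<longlongrightarrow> 0) ?F" .
  then show "((\<lambda>(t, \<xi>). mode t \<xi>) \<longlongrightarrow> mode t \<xi>) ?F"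
    by (simp add: case_prod_unfold LIM_zero_iff)
qed

text \<open>Dominated convergence along sequences of times: the modes converge at each frequency,
  and their Lipschitz bound in frequency dominates the integrand by the momentum transfer.
  Continuity of the rate upgrades the integral equation to a derivative at every positive
  time.\<close>

lemma rate_continuous:
  assumes \<xi>: "\<xi> \<noteq> 0"
  shows "continuous_on {0..} (\<lambda>\<tau>. collision_rate (mode \<tau>) M \<xi>)"
  unfolding continuous_on_sequentially o_def
proof (intro allI ballI impI, elim conjE)
  fix X :: "nat \<Rightarrow> real" and t assume t: "t \<in> {0..}" and X': "\<forall>n. X n \<in> {0..}" "X \<longlonglongrightarrow> t"
  note X = t X'
  define m where "m = \<xi> /\<^sub>R norm \<xi>"
  have m: "norm m = 1" using \<xi> by (simp add: m_def)
  have lim: "(\<lambda>n. mode (X n) \<eta>) \<longlonglongrightarrow> mode t \<eta>" for \<eta>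
  proof -
    have "(\<lambda>n. (X n, \<eta>)) \<longlonglongrightarrow> (t, \<eta>)" by (intro tendsto_intros X)
    then show ?thesis
      using continuous_on_tendsto_compose[OF mode_continuous, of "\<lambda>n. (X n, \<eta>)" "(t, \<eta>)" sequentially] X by simp
  qed
  show "(\<lambda>n. collision_rate (mode (X n)) M \<xi>) \<longlonglongrightarrow> collision_rate (mode t) M \<xi>"
    unfolding collision_rate_def
  proof (rule integral_dominated_convergence)
    show "integrable sphere_measure (\<lambda>\<sigma>. 2 * M * (M + E) * norm \<xi> * (b (m \<bullet> \<sigma>) * sqrt ((1 - m \<bullet> \<sigma>) / 2)))"
      by (intro integrable_mult_right transfer_constant(2) m)
    show "AE \<sigma> in sphere_measure. (\<lambda>n. b ((\<xi> /\<^sub>R norm \<xi>) \<bullet> \<sigma>) * (mode (X n) (pos_part \<xi> \<sigma>) * mode (X n) (neg_part \<xi> \<sigma>) - M * mode (X n) \<xi>))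
        \<longlonglongrightarrow> b ((\<xi> /\<^sub>R norm \<xi>) \<bullet> \<sigma>) * (mode t (pos_part \<xi> \<sigma>) * mode t (neg_part \<xi> \<sigma>) - M * mode t \<xi>)"
      by (intro AE_I2 tendsto_intros lim)
    show "AE \<sigma> in sphere_measure. norm (b ((\<xi> /\<^sub>R norm \<xi>) \<bullet> \<sigma>) * (mode (X n) (pos_part \<xi> \<sigma>) * mode (X n) (neg_part \<xi> \<sigma>) - M * mode (X n) \<xi>))
        \<le> 2 * M * (M + E) * norm \<xi> * (b (m \<bullet> \<sigma>) * sqrt ((1 - m \<bullet> \<sigma>) / 2))" for n
    proof (rule AE_I2)
      fix \<sigma> :: "real^3" assume "\<sigma> \<in> space sphere_measure"
      then have s1: "norm \<sigma> = 1" by simp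
      have r: "0 \<le> X n" using X by simp
      let ?p = "pos_part \<xi> \<sigma>" and ?q = "neg_part \<xi> \<sigma>"
      have q: "norm ?q = norm \<xi> * sqrt ((1 - m \<bullet> \<sigma>) / 2)"
        using norm_parts(3)[OF s1, of \<xi>] by (simp add: deviation_def m_def)
      have b0: "0 \<le> b (m \<bullet> \<sigma>)" using m s1 by (intro angular_kernel_nonneg[OF b] abs_inner_sphere_le) auto
      have 1: "\<bar>mode (X n) ?q - M\<bar> \<le> (M + E) * norm ?q"
        using mode_lipschitz[OF r, of ?q 0] by (simp add: mode_at_0[OF r])
      have "\<xi> - ?p = ?q" using pos_plus_neg[of \<xi> \<sigma>] by (simp add: algebra_simps)
      then have 2: "\<bar>mode (X n) ?p - mode (X n) \<xi>\<bar> \<le> (M + E) * norm ?q"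
        using mode_lipschitz[OF r, of \<xi> ?p] by (simp add: abs_minus_commute)
      \<comment> \<open>Both differences are of size \<open>norm ?q\<close>: the mode equals M at
        frequency 0, and \<xi> differs from \<open>?p\<close> by exactly \<open>?q\<close>.\<close>
      have "\<bar>mode (X n) ?p * mode (X n) ?q - M * mode (X n) \<xi>\<bar> = \<bar>mode (X n) ?p * (mode (X n) ?q - M) + M * (mode (X n) ?p - mode (X n) \<xi>)\<bar>"
        by (simp add: algebra_simps)
      also have "\<dots> \<le> \<bar>mode (X n) ?p\<bar> * \<bar>mode (X n) ?q - M\<bar> + M * \<bar>mode (X n) ?p - mode (X n) \<xi>\<bar>"
        using M_nonneg by (intro order.trans[OF abs_triangle_ineq]) (simp add: abs_mult)
      also have "\<dots> \<le> M * ((M + E) * norm ?q) + M * ((M + E) * norm ?q)"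
        using 1 2 mode_bound[OF r, of ?p] M_nonneg by (intro add_mono mult_mono) auto
      finally have "\<bar>mode (X n) ?p * mode (X n) ?q - M * mode (X n) \<xi>\<bar> \<le> 2 * M * (M + E) * norm ?q" by (simp add: algebra_simps)
      from mult_left_mono[OF this b0]
      show "norm (b ((\<xi> /\<^sub>R norm \<xi>) \<bullet> \<sigma>) * (mode (X n) ?p * mode (X n) ?q - M * mode (X n) \<xi>))
        \<le> 2 * M * (M + E) * norm \<xi> * (b (m \<bullet> \<sigma>) * sqrt ((1 - m \<bullet> \<sigma>) / 2))"
        using b0 unfolding m_def[symmetric] q by (simp add: abs_mult mult_ac)
    qed
    show "(\<lambda>\<sigma>. b ((\<xi> /\<^sub>R norm \<xi>) \<bullet> \<sigma>) * (mode (X n) (pos_part \<xi> \<sigma>) * mode (X n) (neg_part \<xi> \<sigma>) - M * mode (X n) \<xi>)) \<in> borel_measurable sphere_measure" for n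
      using X by (intro borel_measurable_integrable rate_integrable \<xi>) simp
    show "(\<lambda>\<sigma>. b ((\<xi> /\<^sub>R norm \<xi>) \<bullet> \<sigma>) * (mode t (pos_part \<xi> \<sigma>) * mode t (neg_part \<xi> \<sigma>) - M * mode t \<xi>)) \<in> borel_measurable sphere_measure"
      using X by (intro borel_measurable_integrable rate_integrable \<xi>) simp
  qed
qed

lemma mode_derivative:
  assumes t: "0 < t" and \<xi>: "\<xi> \<noteq> 0"
  shows "((\<lambda>t. mode t \<xi>) has_real_derivative collision_rate (mode t) M \<xi>) (at t)"
proof -
  let ?f = "\<lambda>\<tau>. collision_rate (mode \<tau>) M \<xi>"
  have "continuous_on {0..t + 1} ?f" by (rule continuous_on_subset[OF rate_continuous[OF \<xi>]]) auto
  then have "((\<lambda>r. integral {0..r} ?f) has_vector_derivative ?f t) (at t within {0..t + 1})"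
    using t by (intro integral_has_vector_derivative) auto
  then have "((\<lambda>r. integral {0..r} ?f) has_real_derivative ?f t) (at t)"
    using t by (simp add: has_real_derivative_iff_has_vector_derivative at_within_Icc_at)
  then have "((\<lambda>r. mode 0 \<xi> + integral {0..r} ?f) has_real_derivative 0 + ?f t) (at t)"
    by (intro DERIV_add DERIV_const)
  then have "((\<lambda>r. mode 0 \<xi> + integral {0..r} ?f) has_real_derivative ?f t) (at t)" by simp
  then show ?thesis
  proof (rule has_field_derivative_transform_within_open)
    show "mode 0 \<xi> + integral {0..r} ?f = mode r \<xi>" if "r \<in> {0<..}" for r
      using that \<xi> by (intro mode_integral(1)[symmetric]) auto
  qed (use t in auto)
qed

end

text \<open>A single rotation carrying \<xi> to \<eta> suffices, so symmetry that holds almost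
  everywhere for each rotation separately is enough. Determinant 1 is requested because symmetry
  refers to rotations and not to reflections.\<close>

lemma radially_symmetric_integral:
  fixes u :: "real^3 \<Rightarrow> real" and h :: "real \<Rightarrow> real"
  assumes rad: "radially_symmetric u" and [measurable]: "u \<in> borel_measurable borel" "h \<in> borel_measurable borel"
    and eq: "norm \<xi> = norm \<eta>"
  shows "(LINT v|lborel. u v * h (\<xi> \<bullet> v)) = (LINT v|lborel. u v * h (\<eta> \<bullet> v))"
proof -
  obtain f where f: "orthogonal_transformation f" "det (matrix f) = 1" "f \<xi> = \<eta>"
    using rotation_exists[OF _ eq] by auto
  have fm: "f v = matrix f *v v" for v
    using orthogonal_transformation_linear[OF f(1)] by simp
  have "rotation_matrix (matrix f)"
    using f(1,2) by (simp add: rotation_matrix_def orthogonal_transformation_matrix)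
  then have "AE v in lborel. u (matrix f *v v) = u v"
    using rad by (simp add: radially_symmetric_def)
  then have ae: "AE v in lborel. u (f v) = u v"
    by (simp only: fm[symmetric])
  note [measurable] = orthogonal_transformation_measurable[OF f(1)]
  have "(LINT v|lborel. u v * h (\<eta> \<bullet> v)) = (LINT v|distr lborel borel f. u v * h (\<eta> \<bullet> v))"
    by (simp add: lborel_distr_orthogonal[OF f(1)])
  also have "\<dots> = (LINT v|lborel. u (f v) * h (\<eta> \<bullet> f v))"
    by (rule integral_distr) measurable
  also have "\<dots> = (LINT v|lborel. u v * h (\<xi> \<bullet> v))"
  proof (rule integral_cong_AE)
    have "\<eta> \<bullet> f v = \<xi> \<bullet> v" for v
      using f(1) unfolding f(3)[symmetric] orthogonal_transformation_def by blast
    with ae show "AE v in lborel. u (f v) * h (\<eta> \<bullet> f v) = u v * h (\<xi> \<bullet> v)" by (auto elim!: eventually_mono)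
  qed measurable
  finally show ?thesis ..
qed

text \<open>\<xi> and - \<xi> have equal norms, so the integral of an odd wave equals its own
  negative. Hence the Fourier transform is real.\<close>

lemma radially_symmetric_sine:
  fixes u :: "real^3 \<Rightarrow> real"
  assumes "radially_symmetric u" "u \<in> borel_measurable borel"
  shows "(LINT v|lborel. u v * sin (\<xi> \<bullet> v)) = 0"
  using radially_symmetric_integral[OF assms, of sin \<xi> "- \<xi>"] by simp

text \<open>Dividing by the mass makes the modes bounded by 1, as the barrier requires; the
  quadratic collision term then reappears with the factor M in front, which is the \<mu> of
  \<open>comparison\<close>.\<close>

lemma (in weak_evolution) mode_decay:
  assumes M: "0 < M" and rad: "radially_symmetric (g 0)" and p: "0 < p" "p \<le> s" and t: "0 < t"
  shows "\<exists>A c. 0 < c \<and> (\<forall>\<xi>. \<bar>mode t \<xi>\<bar> \<le> A * exp (- c * norm \<xi> powr (2 * p)))"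
proof -
  obtain \<kappa> where \<kappa>: "0 < \<kappa>" "\<kappa> \<le> 1"
    and gap: "\<And>r. 0 \<le> r \<Longrightarrow> \<bar>mode 0 (r *\<^sub>R axis 1 1)\<bar> \<le> M * (1 - \<kappa> * min (r\<^sup>2) 1)"
    using cos_transform_gap[OF g[of 0] nonneg[of 0]] M by (auto simp: mass)
  define f where "f t \<xi> = mode t \<xi> / M" for t \<xi>
  have "\<exists>\<epsilon>>0. \<forall>t\<ge>0. \<forall>\<xi>. \<bar>f t \<xi>\<bar> \<le> exp (- \<kappa> * profile p (1 - exp (- \<epsilon> * t)) ((norm \<xi>)\<^sup>2))"
  proof (rule comparison[OF M p \<kappa>])
    show "\<bar>f t \<xi>\<bar> \<le> 1" if "0 \<le> t" for t \<xi>
      using mode_bound[OF that, of \<xi>] M by (simp add: f_def)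
    show "continuous_on ({0..} \<times> UNIV) (\<lambda>(t, \<xi>). f t \<xi>)"
      using mode_continuous M unfolding f_def case_prod_unfold by (intro continuous_on_divide continuous_on_const) auto
    have scale: "f t \<zeta> * f t \<eta> - 1 * f t \<xi> = (mode t \<zeta> * mode t \<eta> - M * mode t \<xi>) / M\<^sup>2" for t \<zeta> \<eta> \<xi>
      using M by (simp add: f_def power2_eq_square field_simps)
    show "integrable sphere_measure (\<lambda>\<sigma>. b ((\<xi> /\<^sub>R norm \<xi>) \<bullet> \<sigma>) * (f t (pos_part \<xi> \<sigma>) * f t (neg_part \<xi> \<sigma>) - 1 * f t \<xi>))"
      if "0 \<le> t" "\<xi> \<noteq> 0" for t \<xi>
      unfolding scale times_divide_eq_right by (intro integrable_divide rate_integrable that)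
    show "((\<lambda>t. f t \<xi>) has_real_derivative M * collision_rate (f t) 1 \<xi>) (at t)" if "0 < t" "\<xi> \<noteq> 0" for t \<xi>
    proof -
      have "collision_rate (f t) 1 \<xi> = collision_rate (mode t) M \<xi> / M\<^sup>2"
        unfolding collision_rate_def scale times_divide_eq_right integral_divide_zero ..
      then have "M * collision_rate (f t) 1 \<xi> = collision_rate (mode t) M \<xi> / M"
        using M by (simp add: power2_eq_square)
      then show ?thesis
        unfolding f_def by (metis DERIV_cdivide mode_derivative[OF that])
    qed
    show "\<bar>f 0 \<xi>\<bar> \<le> exp (- \<kappa> * min ((norm \<xi>)\<^sup>2) 1)" for \<xi>
    proof -
      have "mode 0 \<xi> = mode 0 (norm \<xi> *\<^sub>R axis 1 1)"
        unfolding cos_transform_def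
        by (rule radially_symmetric_integral[OF rad g_measurable]) (auto simp: norm_axis_1)
      then have "\<bar>mode 0 \<xi>\<bar> \<le> M * (1 - \<kappa> * min ((norm \<xi>)\<^sup>2) 1)"
        using gap[of "norm \<xi>"] by simp
      also have "\<dots> \<le> M * exp (- \<kappa> * min ((norm \<xi>)\<^sup>2) 1)"
        using M exp_ge_add_one_self[of "- \<kappa> * min ((norm \<xi>)\<^sup>2) 1"] by (intro mult_left_mono) auto
      finally show ?thesis using M by (simp add: f_def field_simps)
    qed
  qed
  then obtain \<epsilon> where \<epsilon>: "0 < \<epsilon>" "\<And>t \<xi>. 0 \<le> t \<Longrightarrow> \<bar>f t \<xi>\<bar> \<le> exp (- \<kappa> * profile p (1 - exp (- \<epsilon> * t)) ((norm \<xi>)\<^sup>2))"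
    by blast
  define \<tau> where "\<tau> = 1 - exp (- \<epsilon> * t)"
  have \<tau>: "0 < \<tau>" using \<epsilon> t by (simp add: \<tau>_def)
  \<comment> \<open>The factor \<open>exp (\<kappa> * \<tau>)\<close> pays for the -1 in the
    profile, so that a pure power remains for all frequencies, including those below 1.\<close>
  have "\<bar>mode t \<xi>\<bar> \<le> M * exp (\<kappa> * \<tau>) * exp (- (\<kappa> * \<tau>) * norm \<xi> powr (2 * p))" for \<xi>
  proof -
    have "norm \<xi> powr (2 * p) \<le> max 1 ((norm \<xi>)\<^sup>2) powr p"
    proof (cases "\<xi> = 0")
      case False
      then have "norm \<xi> powr (2 * p) = ((norm \<xi>)\<^sup>2) powr p"
        by (simp add: powr_powr flip: powr_numeral)
      also have "\<dots> \<le> max 1 ((norm \<xi>)\<^sup>2) powr p" using p by (intro powr_mono2) auto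
      finally show ?thesis .
    qed simp
    then have "\<tau> * (norm \<xi> powr (2 * p) - 1) \<le> \<tau> * (max 1 ((norm \<xi>)\<^sup>2) powr p - 1)"
      using \<tau> by (intro mult_left_mono) auto
    also have "\<dots> \<le> profile p \<tau> ((norm \<xi>)\<^sup>2)"
      by (simp add: profile_def)
    finally have "- \<kappa> * profile p \<tau> ((norm \<xi>)\<^sup>2) \<le> - \<kappa> * (\<tau> * (norm \<xi> powr (2 * p) - 1))"
      using \<kappa> by (simp add: mult_left_mono)
    also have "\<dots> = \<kappa> * \<tau> + - (\<kappa> * \<tau>) * norm \<xi> powr (2 * p)"
      by (simp add: algebra_simps)
    finally have le: "- \<kappa> * profile p \<tau> ((norm \<xi>)\<^sup>2) \<le> \<kappa> * \<tau> + - (\<kappa> * \<tau>) * norm \<xi> powr (2 * p)" .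
    have "\<bar>f t \<xi>\<bar> \<le> exp (- \<kappa> * profile p \<tau> ((norm \<xi>)\<^sup>2))"
      unfolding \<tau>_def using t by (intro \<epsilon>(2)) simp
    also have "\<dots> \<le> exp (\<kappa> * \<tau> + - (\<kappa> * \<tau>) * norm \<xi> powr (2 * p))"
      using le by (simp only: exp_le_cancel_iff)
    also have "\<dots> = exp (\<kappa> * \<tau>) * exp (- (\<kappa> * \<tau>) * norm \<xi> powr (2 * p))" by (rule exp_add)
    finally have "\<bar>f t \<xi>\<bar> \<le> exp (\<kappa> * \<tau>) * exp (- (\<kappa> * \<tau>) * norm \<xi> powr (2 * p))" .
    from mult_left_mono[OF this, of M] show ?thesis using M by (simp add: f_def mult.assoc)
  qed
  moreover have "0 < \<kappa> * \<tau>" using \<kappa> \<tau> by simp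
  ultimately show ?thesis by blast
qed

theorem theorem1p3:
  fixes s K :: real
    and b :: "real \<Rightarrow> real"
    and g\<^sub>0 :: "real^3 \<Rightarrow> real"
    and g :: "real \<Rightarrow> real^3 \<Rightarrow> real"
  assumes "0 < s" "s < 1/2"
    and "angular_kernel b"
    and "K > 0"
    and "((\<lambda>\<theta>. \<theta> powr (1 + 2 * s) * (sin \<theta> * b (cos \<theta>))) \<longlongrightarrow> K) (at_right 0)"
    and "g\<^sub>0 \<in> L1w (2 + 2 * s) \<inter> LlogL"
    and "AE v in lborel. 0 \<le> g\<^sub>0 v"
    and "radially_symmetric g\<^sub>0"
    and "g \<in> Linfty_L1w_LlogL (2 + 2 * s)"
    and "nonneg_weak_solution b g\<^sub>0 g"
    and "\<forall>t\<ge>0. radially_symmetric (g t)"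
  shows "\<forall>t>0. \<forall>s'. 0 < s' \<and> s' < s \<longrightarrow> g t \<in> gevrey (1 / (2 * s'))"
proof (intro allI impI, elim conjE)
  fix t s' :: real assume t: "0 < t" and s': "0 < s'" "s' < s"
  let ?M = "LINT v|lborel. g\<^sub>0 v"
  interpret singular_kernel b s K
    by standard (use assms in auto)
  have sol: "\<And>t. 0 \<le> t \<Longrightarrow> AE v in lborel. 0 \<le> g t v" "weak_solution b g\<^sub>0 g"
    using assms(10) by (auto simp: nonneg_weak_solution_def)
  have int: "integrable lborel (g t)" if "0 \<le> t" for t
    using sol(2) that by (simp add: weak_solution_def)
  interpret weak_evolution b s K g\<^sub>0 g ?M "LINT v|lborel. g\<^sub>0 v * (norm v)\<^sup>2"
  proof
    show "(\<lambda>(t, v). g t v) \<in> borel_measurable (lebesgue_on ({0<..} \<times> UNIV))"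
      using assms(9) by (simp add: Linfty_L1w_LlogL_def)
    show "(LINT v|lborel. g t v * sin (\<xi> \<bullet> v)) = 0" if "0 \<le> t" for t \<xi>
      using borel_measurable_integrable[OF int[OF that]] assms(11) that by (intro radially_symmetric_sine) auto
  qed (use sol in \<open>auto simp: weak_solution_def\<close>)
  have "\<exists>A c. 0 < c \<and> (\<forall>\<xi>. \<bar>mode t \<xi>\<bar> \<le> A * exp (- c * norm \<xi> powr (2 * s')))"
  \<comment> \<open>Normalization needs positive mass; with zero mass every mode vanishes and the
    decay is trivial.\<close>
  proof (cases "?M = 0")
    case True
    then have "mode t \<xi> = 0" for \<xi> using mode_bound[of t \<xi>] t by simp
    then show ?thesis by (intro exI[of _ 0] exI[of _ 1]) auto
  next
    case False
    then show ?thesis using mode_decay[of s' t] M_nonneg s' t assms(11) by auto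
  qed
  then obtain A c where "0 < c" "\<And>\<xi>. \<bar>mode t \<xi>\<bar> \<le> A * exp (- c * norm \<xi> powr (2 * s'))" by blast
  then show "g t \<in> gevrey (1 / (2 * s'))"
    using t s' by (intro gevrey_of_cos_transform_decay[of "g t" "2 * s'" c A] g nonneg sine) auto
qed

end
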